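(* Let $t\ge 1$ and $c_1,\ldots,c_t\ge 1$ be integers, and let $\mathcal N_{c_1,\ldots,c_t}$ be the variety of polynilpotent groups of class row $(c_1,\ldots,c_t)$. Let $G\cong \mathbf Z^{(m)}\oplus \mathbf Z_{n_1}\oplus\cdots\oplus \mathbf Z_{n_k}$ be a finitely generated abelian group, where $m,k\ge 0$, the $n_i$ are positive integers, and $n_{i+1}\mid n_i$ for all $1\le i\le k-1$. Then the Baer invariant (polynilpotent multiplier) of $G$ with respect to $\mathcal N_{c_1,\ldots,c_t}$ is $$\mathcal N_{c_1,\ldots,c_t}M(G)\cong \mathbf Z^{(f_m)}\oplus \mathbf Z_{n_1}^{(f_{m+1}-f_m)}\oplus\cdots\oplus \mathbf Z_{n_k}^{(f_{m+k}-f_{m+k-1})},$$ where $f_i=\chi_{c_t+1}(\chi_{c_{t-1}+1}(\cdots(\chi_{c_1+1}(i))\cdots))$ for all $m\le i\le m+k$.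
   Context: $\mathbf Z_n$ is the cyclic group of order $n$, and $A^{(r)}$ denotes the direct sum of $r$ copies of $A$. $\chi_n(d)$ is the number of basic commutators of weight $n$ on $d$ letters, given by Witt's formula $\chi_n(d)=\frac1n\sum_{e\mid n}\mu(e)d^{n/e}$, with $\mu$ the Möbius function (so $\chi_n(0)=0$). $\gamma_j(H)$ is the $j$-th term of the lower central series of $H$ ($\gamma_1(H)=H$). $\mathcal N_{c_1,\ldots,c_t}$ is the variety of groups $H$ with $\gamma_{c_t+1}(\gamma_{c_{t-1}+1}(\cdots(\gamma_{c_1+1}(H))\cdots))=1$. Baer invariant: let $G\cong F/R$ be a free presentation, $F$ a free group. For a variety $\mathcal V$ with set of words $V$, $\mathcal VM(G)=\dfrac{R\cap V(F)}{[RV^*F]}$, where $V(F)$ is the verbal subgroup of $F$ and $[RV^*F]$ is the subgroup generated by all $v(f_1,\ldots,f_ir,\ldots,f_n)\,v(f_1,\ldots,f_i,\ldots,f_n)^{-1}$ with $r\in R$, $v\in V$, $f_j\in F$, $1\le i\le n$, $n\in\mathbf N$. Up to isomorphism this depends only on $G$ and $\mathcal V$. For $\mathcal V=\mathcal N_{c_1,\ldots,c_t}$ it is known that this equals $$\mathcal N_{c_1,\ldots,c_t}M(G)=\frac{R\cap \gamma_{c_t+1}(\cdots(\gamma_{c_1+1}(F))\cdots)}{[R,\ _{c_1}F,\ _{c_2}\gamma_{c_1+1}(F),\ldots,\ _{c_t}\gamma_{c_{t-1}+1}(\cdots(\gamma_{c_1+1}(F))\cdots)]},$$ where commutators of subgroups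 are left-normed, $[A,\ _1B]=[A,B]$ and $[A,\ _cB]=[[A,\ _{c-1}B],B]$. *)

theory Defs
  imports "HOL-Algebra.Algebra" "HOL-Computational_Algebra.Squarefree"
begin

section \<open>Words and free groups\<close>

text \<open>A letter \<open>(x, True)\<close> stands for \<open>x\<close>, a letter \<open>(x, False)\<close> for the inverse of \<open>x\<close>.\<close>

type_synonym 'x gword = "('x \<times> bool) list"

fun word_value :: "('a, 'b) monoid_scheme \<Rightarrow> ('x \<Rightarrow> 'a) \<Rightarrow> 'x gword \<Rightarrow> 'a" where
  "word_value G f [] = \<one>\<^bsub>G\<^esub>"
| "word_value G f ((x, b) # w) = (if b then f x else inv\<^bsub>G\<^esub> (f x)) \<otimes>\<^bsub>G\<^esub> word_value G f w"

definition reduced :: "'x gword \<Rightarrow> bool" where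
  "reduced w \<longleftrightarrow> successively (\<lambda>(x, b) (y, c). x = y \<longrightarrow> b = c) w"

definition free_group_on :: "('a, 'b) monoid_scheme \<Rightarrow> 'a set \<Rightarrow> bool" where
  "free_group_on F S \<longleftrightarrow> group F \<and> S \<subseteq> carrier F \<and> generate F S = carrier F \<and>
     (\<forall>w. reduced w \<and> w \<noteq> [] \<and> fst ` set w \<subseteq> S \<longrightarrow> word_value F (\<lambda>x. x) w \<noteq> \<one>\<^bsub>F\<^esub>)"

section \<open>Varieties, verbal subgroups and Baer invariants\<close>

text \<open>Words of a variety are written in countably many variables, indexed by \<open>nat\<close>.\<close>

definition satisfies_laws :: "('a, 'b) monoid_scheme \<Rightarrow> nat gword set \<Rightarrow> bool" where
  "satisfies_laws G V \<longleftrightarrow> (\<forall>v \<in> V. \<forall>f \<in> UNIV \<rightarrow> carrier G. word_value G f v = \<one>\<^bsub>G\<^esub>)"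

text \<open>\<open>V\<close> is a set of words of the variety of all groups with property \<open>P\<close>.  HOL cannot
  quantify over the carrier type, so this is tested on the groups with carrier in \<open>nat\<close>, which
  up to isomorphism are the countable groups.  This loses nothing when, as for
  polynilpotency, a group has property \<open>P\<close> iff all its finitely generated subgroups do:
  satisfaction of laws is such a property as well.\<close>

definition words_of_variety :: "nat gword set \<Rightarrow> (nat monoid \<Rightarrow> bool) \<Rightarrow> bool" where
  "words_of_variety V P \<longleftrightarrow> (\<forall>H :: nat monoid. group H \<longrightarrow> (satisfies_laws H V \<longleftrightarrow> P H))"

definition verbal_subgroup :: "('a, 'b) monoid_scheme \<Rightarrow> nat gword set \<Rightarrow> 'a set" where
  "verbal_subgroup F V = generate F {word_value F f v | v f. v \<in> V \<and> f \<in> UNIV \<rightarrow> carrier F}"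

text \<open>The subgroup \<open>[R V\<^sup>* F]\<close>.  If the variable \<open>i\<close> does not occur in \<open>v\<close>, the
  generator below is the identity.\<close>

definition marginal_commutator ::
    "('a, 'b) monoid_scheme \<Rightarrow> 'a set \<Rightarrow> nat gword set \<Rightarrow> 'a set" where
  "marginal_commutator F R V = generate F
     {word_value F (f(i := f i \<otimes>\<^bsub>F\<^esub> r)) v \<otimes>\<^bsub>F\<^esub> inv\<^bsub>F\<^esub> (word_value F f v) | v f i r.
        v \<in> V \<and> f \<in> UNIV \<rightarrow> carrier F \<and> r \<in> R}"

definition baer_invariant ::
    "('a, 'b) monoid_scheme \<Rightarrow> 'a set \<Rightarrow> nat gword set \<Rightarrow> 'a set monoid" where
  "baer_invariant F R V =
     (F\<lparr>carrier := R \<inter> verbal_subgroup F V\<rparr> Mod marginal_commutator F R V)"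

section \<open>Polynilpotent groups\<close>

definition commutator_subgroup ::
    "('a, 'b) monoid_scheme \<Rightarrow> 'a set \<Rightarrow> 'a set \<Rightarrow> 'a set" where
  "commutator_subgroup G A B =
     generate G (\<Union>a \<in> A. \<Union>b \<in> B. {a \<otimes>\<^bsub>G\<^esub> b \<otimes>\<^bsub>G\<^esub> inv\<^bsub>G\<^esub> a \<otimes>\<^bsub>G\<^esub> inv\<^bsub>G\<^esub> b})"

text \<open>\<open>lower_central G j H\<close> is \<open>\<gamma>\<^sub>j(H)\<close> for a subgroup \<open>H\<close> of \<open>G\<close>; the numbering starts
  with \<open>\<gamma>\<^sub>1(H) = H\<close>, and the index \<open>0\<close> is not used.\<close>

definition lower_central :: "('a, 'b) monoid_scheme \<Rightarrow> nat \<Rightarrow> 'a set \<Rightarrow> 'a set" where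
  "lower_central G j H = ((\<lambda>K. commutator_subgroup G K H) ^^ (j - 1)) H"

text \<open>The class row \<open>(c\<^sub>1, \<dots>, c\<^sub>t)\<close> is the list \<open>cs\<close>; its head \<open>c\<^sub>1\<close> belongs to the innermost
  term \<open>\<gamma>\<close>.\<close>

definition poly_lower_central :: "('a, 'b) monoid_scheme \<Rightarrow> nat list \<Rightarrow> 'a set" where
  "poly_lower_central G cs = foldl (\<lambda>H c. lower_central G (c + 1) H) (carrier G) cs"

definition polynilpotent :: "nat list \<Rightarrow> ('a, 'b) monoid_scheme \<Rightarrow> bool" where
  "polynilpotent cs G \<longleftrightarrow> group G \<and> poly_lower_central G cs = {\<one>\<^bsub>G\<^esub>}"

section \<open>Witt's formula\<close>

definition moebius :: "nat \<Rightarrow> int" where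
  "moebius n = (if squarefree n then (- 1) ^ card (prime_factors n) else 0)"

text \<open>The number \<open>\<chi>\<^sub>n(d)\<close> of basic commutators of weight \<open>n \<ge> 1\<close> on \<open>d\<close> letters.  The sum in
  Witt's formula is non-negative and divisible by \<open>n\<close>, so neither \<open>div\<close> nor \<open>nat\<close> loses
  anything.\<close>

definition witt :: "nat \<Rightarrow> nat \<Rightarrow> nat" where
  "witt n d = nat ((\<Sum>e | e dvd n. moebius e * int d ^ (n div e)) div int n)"

definition poly_witt :: "nat list \<Rightarrow> nat \<Rightarrow> nat" where
  "poly_witt cs i = foldl (\<lambda>d c. witt (c + 1) d) i cs"

section \<open>Direct sums of cyclic groups\<close>

definition direct_copies :: "('a, 'b) monoid_scheme \<Rightarrow> nat \<Rightarrow> (nat \<Rightarrow> 'a) monoid" where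
  "direct_copies A r = sum_group {..<r} (\<lambda>_. A)"

end

theory Submission
  imports Defs "HOL-Library.List_Lexorder" "HOL-Library.Countable_Set"
begin

text \<open>
  Let \<open>B / N\<close> be an abelian quotient of a subgroup \<open>B\<close> of a free group, a direct sum of cyclic
  groups whose orders form a divisibility chain.  Then \<open>\<gamma>\<^sub>c\<^sub>+\<^sub>1(B) / [N, \<^sub>c B]\<close> is the component of
  degree \<open>c + 1\<close> of the free Lie ring on the abelian group \<open>B / N\<close>: it is generated by the brackets
  of the Lyndon words of length \<open>c + 1\<close> in the cyclic generators (rewriting with the Jacobi
  identity), the order of a bracket divides the greatest common divisor of the orders of its
  letters, and there are no further relations.  The last point is seen by lifting \<open>B \<rightarrow> B / N\<close> to
  the group of noncommutative power series with constant term \<open>1\<close>, where the bracket of a Lyndon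
  word \<open>w\<close> has the leading term \<open>w\<close>; the lift exists because subgroups of free groups are
  projective.  The number of Lyndon words in the first \<open>i\<close> letters is given by Witt's formula, so
  this step turns the multiplicities \<open>f\<^sub>i\<close> into \<open>\<chi>\<^sub>c\<^sub>+\<^sub>1(f\<^sub>i)\<close>.

  The Baer invariant is the result of iterating this step from \<open>F / R\<close>, because \<open>F / R\<close> being
  abelian puts the verbal subgroup inside \<open>R\<close>, and because each \<open>[N, \<^sub>c B]\<close> contains the derived
  subgroup of \<open>\<gamma>\<^sub>c\<^sub>+\<^sub>1(B)\<close>.
\<close>

section \<open>Lyndon words\<close>

text \<open>The subgroup \<open>B\<close> is in general not finitely generated, only
  \<open>B / N\<close> is; so finitely many letters generate \<open>B\<close> together with
  \<open>N\<close>, and freeness enters only through the lifting of homomorphisms. The orders of the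
  summands vary. Coefficients of power series therefore stay integral, and the coefficient at a word
  is read modulo the gcd of the orders of its letters. This respects multiplication because the gcd
  of a word divides that of each of its factors. Order 0 stands for infinite order, so free and
  torsion summands are treated alike. To be iterable, a step must reproduce its own hypotheses: the
  divisibility chain makes the gcd of several orders equal to one of them, so no new orders arise,
  and listing Lyndon words by growing alphabets keeps the generators sorted. Lyndon words are the
  basis of choice because both halves are triangular for the lexicographic order: rewriting only
  moves upwards, and the leading coefficient of a bracket is 1, so that independence holds modulo
  every gcd.\<close>

lemma append_less_append_iff [simp]: "xs @ ys < xs @ zs \<longleftrightarrow> ys < (zs :: nat list)"
  by (induction xs) auto

lemma less_append_self: "ys \<noteq> [] \<Longrightarrow> xs < xs @ (ys :: nat list)"
  by (induction xs) (auto simp: neq_Nil_conv)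

text \<open>A lexicographic inequality has two causes: a proper prefix, or a first differing letter.
  Only the second survives arbitrary tails, and most comparisons below split on this.\<close>

lemma less_list_cases:
  fixes xs ys :: "nat list"
  assumes "xs < ys"
  obtains zs where "zs \<noteq> []" "ys = xs @ zs" | "\<And>us vs. xs @ us < ys @ vs"
proof -
  have "(\<exists>zs. zs \<noteq> [] \<and> ys = xs @ zs) \<or> (\<forall>us vs. xs @ us < ys @ vs)"
    using assms
  proof (induction xs arbitrary: ys)
    case (Cons x xs)
    then show ?case by (cases ys) auto
  qed auto
  then show ?thesis using that by blast
qed

lemma less_append_of_length_le:
  fixes xs ys :: "nat list"
  assumes "xs < ys" "length ys \<le> length xs"
  shows "xs @ us < ys @ vs"
  using assms by (cases rule: less_list_cases) auto

text \<open>Among the equivalent characterizations the one by suffixes is taken, since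
  factorizations compare suffixes. Counting uses the one by rotations, supplied by
  \<open>lyndon_less_rotate\<close> and \<open>lyndonI_rotate\<close>.\<close>

definition lyndon :: "nat list \<Rightarrow> bool" where
  "lyndon w \<longleftrightarrow> w \<noteq> [] \<and> (\<forall>u v. w = u @ v \<and> u \<noteq> [] \<and> v \<noteq> [] \<longrightarrow> w < v)"

lemma lyndon_not_Nil: "lyndon w \<Longrightarrow> w \<noteq> []"
  by (simp add: lyndon_def)

lemma lyndon_less_suffix: "lyndon (u @ v) \<Longrightarrow> u \<noteq> [] \<Longrightarrow> v \<noteq> [] \<Longrightarrow> u @ v < v"
  unfolding lyndon_def by blast

lemma lyndon_singleton: "lyndon [a]"
  by (auto simp: lyndon_def Cons_eq_append_conv)

text \<open>A suffix of \<open>u @ v\<close> that meets \<open>u\<close> is \<open>t @ v\<close>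
  with \<open>u < t\<close> and \<open>t\<close> shorter than \<open>u\<close>, so a differing
  letter decides and the tails are harmless. All other suffixes are suffixes of \<open>v\<close>,
  and \<open>u @ v < v\<close> remains: if \<open>v = u @ zs\<close>, cancel \<open>u\<close> in
  \<open>v < zs\<close>.\<close>

lemma lyndon_append:
  assumes u: "lyndon u" and v: "lyndon v" and "u < v"
  shows "lyndon (u @ v)"
proof -
  have ne: "u \<noteq> []" "v \<noteq> []" using u v lyndon_not_Nil by auto
  have uv: "u @ v < v"
    using \<open>u < v\<close>
  proof (cases rule: less_list_cases)
    case (1 zs)
    then show ?thesis using v ne lyndon_less_suffix[of u zs] by simp
  next
    case 2
    then show ?thesis by (metis append_Nil2)
  qed
  show ?thesis unfolding lyndon_def
  proof (intro conjI allI impI)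
    fix p s assume "u @ v = p @ s \<and> p \<noteq> [] \<and> s \<noteq> []"
    then consider t where "p @ t = u" "s = t @ v" "p \<noteq> []" "s \<noteq> []"
      | t where "u @ t = p" "v = t @ s" "s \<noteq> []"
      by (auto simp: append_eq_append_conv2)
    then show "u @ v < s"
    proof cases
      case 1
      show ?thesis
      proof (cases "t = []")
        case False
        then have "u < t" using u 1 lyndon_less_suffix[of p t] by simp
        then show ?thesis using 1 by (auto intro!: less_append_of_length_le)
      qed (use uv 1 in simp)
    next
      case 2
      then show ?thesis using uv v lyndon_less_suffix[of t s] by (cases "t = []") auto
    qed
  qed (use ne in simp)
qed

text \<open>The right factor of the standard factorization is the lexicographically smallest proper
  suffix.\<close>

definition lyndon_right :: "nat list \<Rightarrow> nat list" where
  "lyndon_right w = Min ((\<lambda>i. drop i w) ` {1..<length w})"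

definition lyndon_left :: "nat list \<Rightarrow> nat list" where
  "lyndon_left w = take (length w - length (lyndon_right w)) w"

lemma lyndon_right_cases:
  assumes "length w \<ge> 2"
  obtains i where "1 \<le> i" "i < length w" "lyndon_right w = drop i w" "lyndon_left w = take i w"
proof -
  have "lyndon_right w \<in> (\<lambda>i. drop i w) ` {1..<length w}"
    unfolding lyndon_right_def using assms by (intro Min_in) auto
  then obtain i where i: "1 \<le> i" "i < length w" "lyndon_right w = drop i w" by auto
  then have "lyndon_left w = take i w" by (simp add: lyndon_left_def)
  with i that show ?thesis by blast
qed

lemma lyndon_left_append_right: "length w \<ge> 2 \<Longrightarrow> lyndon_left w @ lyndon_right w = w"
  by (metis append_take_drop_id lyndon_right_cases)

lemma length_lyndon_left: "length w \<ge> 2 \<Longrightarrow> length (lyndon_left w) < length w"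
  and length_lyndon_right: "length w \<ge> 2 \<Longrightarrow> length (lyndon_right w) < length w"
  and lyndon_left_not_Nil: "length w \<ge> 2 \<Longrightarrow> lyndon_left w \<noteq> []"
  and lyndon_right_not_Nil: "length w \<ge> 2 \<Longrightarrow> lyndon_right w \<noteq> []"
  by (erule lyndon_right_cases; auto)+

lemma lyndon_right_le:
  assumes "w = u @ v" "u \<noteq> []" "v \<noteq> []"
  shows "lyndon_right w \<le> v"
proof -
  have "v = drop (length u) w" "length u \<in> {1..<length w}"
    using assms by (auto simp: Suc_le_eq)
  then show ?thesis unfolding lyndon_right_def by (intro Min_le) auto
qed

lemma lyndon_lyndon_right:
  assumes "length w \<ge> 2"
  shows "lyndon (lyndon_right w)"
  unfolding lyndon_def
proof (intro conjI allI impI)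
  fix u v assume *: "lyndon_right w = u @ v \<and> u \<noteq> [] \<and> v \<noteq> []"
  then have "w = (lyndon_left w @ u) @ v" using lyndon_left_append_right[OF assms] by simp
  then have "lyndon_right w \<le> v" using * lyndon_right_le by blast
  moreover have "lyndon_right w \<noteq> v" using * by auto
  ultimately show "lyndon_right w < v" by simp
qed (use lyndon_right_not_Nil[OF assms] in simp)

text \<open>Suppose a proper suffix \<open>s\<close> of the left factor \<open>u\<close> is smaller
  than \<open>u\<close>. If a letter decides, the suffix \<open>s @ v\<close> of \<open>w\<close> is
  smaller than \<open>w\<close>. If \<open>u = s @ t\<close>, cancelling \<open>s\<close> gives
  \<open>t @ v < v\<close>, against the minimality of the right factor \<open>v\<close>.\<close>

lemma lyndon_lyndon_left:
  assumes "length w \<ge> 2" and w: "lyndon w"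
  shows "lyndon (lyndon_left w)"
proof -
  define u v where "u = lyndon_left w" and "v = lyndon_right w"
  have ne: "u \<noteq> []" "v \<noteq> []" and wuv: "w = u @ v"
    using assms lyndon_left_not_Nil lyndon_right_not_Nil lyndon_left_append_right by (auto simp: u_def v_def)
  show ?thesis unfolding lyndon_def u_def[symmetric]
  proof (intro conjI allI impI)
    fix p s assume us: "u = p @ s \<and> p \<noteq> [] \<and> s \<noteq> []"
    show "u < s"
    proof (rule ccontr)
      assume "\<not> u < s"
      moreover have "s \<noteq> u" using us by auto
      ultimately have "s < u" by simp
      then show False
      proof (cases rule: less_list_cases)
        case (1 t)
        have "p @ (s @ v) < s @ v"
        proof (rule lyndon_less_suffix)
          have "w = p @ (s @ v)" using wuv us by simp
          with w show "lyndon (p @ (s @ v))" by metis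
        qed (use us in blast)+
        moreover have "p @ (s @ v) = s @ (t @ v)"
          using 1 us by (metis append.assoc)
        ultimately have "t @ v < v" by simp
        moreover have "v \<le> t @ v"
          unfolding v_def
        proof (rule lyndon_right_le)
          have "w = s @ (t @ v)" using wuv 1 by simp
          then show "w = s @ (t @ lyndon_right w)" unfolding v_def .
        qed (use us ne in \<open>auto simp flip: v_def\<close>)
        ultimately show False by simp
      next
        case 2
        have "u @ v < s @ v"
          using lyndon_less_suffix[of p "s @ v"] w wuv us ne by simp
        with 2[of v v] show False by simp
      qed
    qed
  qed (use ne in simp)
qed

lemma lyndon_left_less_right:
  assumes "length w \<ge> 2" and w: "lyndon w"
  shows "lyndon_left w < lyndon_right w"
proof -
  have "lyndon_left w < w"
    using lyndon_left_append_right[OF assms(1)] less_append_self[OF lyndon_right_not_Nil[OF assms(1)]]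
    by metis
  also have "w < lyndon_right w"
    using lyndon_less_suffix[of "lyndon_left w" "lyndon_right w"] assms
      lyndon_left_append_right lyndon_left_not_Nil lyndon_right_not_Nil by simp
  finally show ?thesis .
qed

text \<open>A suffix longer than \<open>v\<close> is \<open>t @ v\<close>, where \<open>t\<close> is
  a proper suffix of \<open>u\<close>, hence \<open>t\<close> is at least
  \<open>lyndon_right u\<close> and so at least \<open>v\<close>. The rewriting of commutators stops
  exactly at pairs of this kind.\<close>

lemma lyndon_right_append:
  assumes u: "lyndon u" and v: "lyndon v"
    and std: "length u \<ge> 2 \<Longrightarrow> v \<le> lyndon_right u"
  shows "lyndon_right (u @ v) = v" "lyndon_left (u @ v) = u"
proof -
  have ne: "u \<noteq> []" "v \<noteq> []" using u v lyndon_not_Nil by auto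
  have "v \<le> lyndon_right (u @ v)"
  proof -
    have l2: "length (u @ v) \<ge> 2" using ne by (cases u; cases v) auto
    let ?r = "lyndon_right (u @ v)" and ?l = "lyndon_left (u @ v)"
    have "u @ v = ?l @ ?r" "?l \<noteq> []" "?r \<noteq> []"
      using lyndon_left_append_right[OF l2] lyndon_left_not_Nil[OF l2] lyndon_right_not_Nil[OF l2] by auto
    then consider t where "?l @ t = u" "?r = t @ v" | t where "u @ t = ?l" "v = t @ ?r"
      by (metis append_eq_append_conv2)
    then show ?thesis
    proof cases
      case 1
      show ?thesis
      proof (cases "t = []")
        case False
        with 1 \<open>?l \<noteq> []\<close> have "length ?l \<ge> 1" "length t \<ge> 1"
          by (simp_all add: Suc_le_eq)
        then have "length u \<ge> 2" using arg_cong[OF 1(1), of length] by simp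
        then have "v \<le> lyndon_right u" by (rule std)
        also have "\<dots> \<le> t" using lyndon_right_le[of u ?l t] 1 False \<open>?l \<noteq> []\<close> by simp
        also have "t \<le> t @ v" using less_append_self[OF ne(2), of t] by simp
        finally show ?thesis using 1 by simp
      qed (use 1 in simp)
    next
      case 2
      show ?thesis
      proof (cases "t = []")
        case False
        then show ?thesis using lyndon_less_suffix[of t ?r] v 2 \<open>?r \<noteq> []\<close> by simp
      qed (use 2 in simp)
    qed
  qed
  moreover have "lyndon_right (u @ v) \<le> v" by (rule lyndon_right_le) (use ne in auto)
  ultimately show *: "lyndon_right (u @ v) = v" by simp
  show "lyndon_left (u @ v) = u" by (simp add: lyndon_left_def *)
qed

section \<open>Rotations and powers of Lyndon words\<close>

lemma lyndon_less_rotate: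
  assumes "lyndon w" "1 \<le> i" "i < length w"
  shows "w < rotate i w"
proof -
  have "take i w @ drop i w < drop i w"
    by (rule lyndon_less_suffix) (use assms in auto)
  moreover have "take i w \<noteq> []" using assms by auto
  then have "drop i w < drop i w @ take i w" by (rule less_append_self)
  ultimately show ?thesis
    using assms by (simp add: rotate_drop_take)
qed

text \<open>Let \<open>w = u @ v\<close> with \<open>v < w\<close>. If a letter decides, the
  rotation \<open>v @ u\<close> is smaller than \<open>w\<close>. If \<open>w = v @ t\<close>, then
  \<open>w < v @ u\<close> forces \<open>t < u\<close> with equal lengths, and the rotation
  \<open>t @ v\<close> is smaller than \<open>w\<close>.\<close>

lemma lyndonI_rotate:
  assumes "w \<noteq> []" and rot: "\<And>i. 1 \<le> i \<Longrightarrow> i < length w \<Longrightarrow> w < rotate i w"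
  shows "lyndon w"
  unfolding lyndon_def
proof (intro conjI allI impI, fact, rule ccontr)
  fix u v assume *: "w = u @ v \<and> u \<noteq> [] \<and> v \<noteq> []" and "\<not> w < v"
  have r: "u @ v < v @ u"
    using rot[of "length u"] * by (simp add: Suc_le_eq rotate_append)
  have "v \<noteq> w" using * by simp
  with \<open>\<not> w < v\<close> have "v < w" by simp
  then show False
  proof (cases rule: less_list_cases)
    case (1 t)
    then have "v @ t < v @ u" using r * by simp
    then have tu: "t < u" by simp
    have len: "length t = length u" using 1 * by (metis add.commute add_left_cancel length_append)
    have "length v \<in> {1..<length w}" using * by (auto simp: Suc_le_eq)
    then have "w < rotate (length v) w" using rot by simp
    also have "rotate (length v) w = t @ v" using 1 by (simp add: rotate_append)
    also have "\<dots> < u @ v" by (rule less_append_of_length_le) (use tu len in auto)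
    finally show False using * by simp
  next
    case 2
    have "v @ u < w @ []" by (rule 2)
    then show False using r * by simp
  qed
qed

abbreviation list_power :: "nat \<Rightarrow> nat list \<Rightarrow> nat list" where
  "list_power k u \<equiv> concat (replicate k u)"

lemma length_list_power: "length (list_power k u) = k * length u"
  by (induction k) auto

lemma rotate1_list_power: "rotate1 (list_power k u) = list_power k (rotate1 u)"
proof (cases u)
  case Nil
  then show ?thesis by (induction k) auto
next
  case (Cons a u')
  have *: "list_power k (a # u') @ [a] = a # list_power k (u' @ [a])" for k
    by (induction k) auto
  show ?thesis
  proof (cases k)
    case (Suc j)
    then show ?thesis using *[of j] Cons by simp
  qed simp
qed

lemma rotate_list_power: "rotate i (list_power k u) = list_power k (rotate i u)"
  by (induction i) (simp_all add: rotate1_list_power)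

lemma list_power_less:
  assumes "u < v" "length u = length v" "k > 0"
  shows "list_power k u < list_power k v"
proof -
  obtain j where "k = Suc j" using assms gr0_conv_Suc by auto
  then show ?thesis using less_append_of_length_le[of u v] assms by simp
qed

lemma list_power_inject:
  assumes "list_power k u = list_power j v" "length u = length v" "k > 0" "j > 0"
  shows "u = v"
  using assms by (cases k; cases j) auto

lemma list_power_le_rotate:
  assumes "lyndon u" "k > 0"
  shows "list_power k u \<le> rotate i (list_power k u)"
proof -
  have "u \<le> rotate i u"
  proof (cases "i mod length u = 0")
    case False
    have "u < rotate (i mod length u) u"
      by (rule lyndon_less_rotate) (use assms False lyndon_not_Nil in \<open>auto simp: Suc_le_eq\<close>)
    then show ?thesis by (simp flip: rotate_conv_mod)
  qed (simp add: rotate_id)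
  then consider "u < rotate i u" | "rotate i u = u" by fastforce
  then show ?thesis
  proof cases
    case 1
    show ?thesis
      unfolding rotate_list_power
      by (rule less_imp_le, rule list_power_less[OF 1]) (use assms(2) in simp_all)
  next
    case 2
    then show ?thesis by (metis order_refl rotate_list_power)
  qed
qed

lemma lyndon_rotate_eq_dvd:
  assumes "lyndon u" "rotate i u = u"
  shows "length u dvd i"
proof (rule ccontr)
  assume "\<not> length u dvd i"
  then have "u < rotate (i mod length u) u"
    by (intro lyndon_less_rotate) (use assms lyndon_not_Nil in \<open>auto simp: Suc_le_eq dvd_eq_mod_eq_0\<close>)
  then show False using assms by (simp flip: rotate_conv_mod)
qed

text \<open>A power of a Lyndon word is the least of its rotations, so the two powers agree. Each
  base is fixed by the rotation by the length of the other, hence the lengths divide each other. The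
  bounds on \<open>r\<close> and \<open>s\<close> then leave only the full turn.\<close>

lemma rotate_list_power_lyndon_inj:
  assumes u: "lyndon u" and v: "lyndon v" and "k > 0" "j > 0" and r: "r < length u" "s < length v"
    and eq: "rotate r (list_power k u) = rotate s (list_power j v)"
  shows "u = v \<and> r = s"
proof -
  have inv: "\<exists>i'. rotate i' (rotate i w) = w" for i and w :: "nat list"
  proof
    show "rotate (length w - i mod length w) (rotate i w) = w"
    proof (cases "w = []")
      case False
      have "(length w - i mod length w + i) mod length w = (length w - i mod length w + i mod length w) mod length w"
        by (simp add: mod_add_right_eq)
      also have "\<dots> = 0" using False by (simp add: less_imp_le)
      finally show ?thesis by (simp add: rotate_rotate rotate_id)
    qed simp
  qed
  have le: "list_power k u \<le> list_power j v"
    if "lyndon u" "k > 0" "rotate r (list_power k u) = rotate s (list_power j v)" for u k v j r s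
  proof -
    obtain i where "rotate i (rotate s (list_power j v)) = list_power j v" using inv by blast
    then have "list_power j v = rotate (i + r) (list_power k u)"
      using that by (metis rotate_rotate)
    then show ?thesis using list_power_le_rotate that by simp
  qed
  have pw: "list_power k u = list_power j v"
    using le[OF u assms(3) eq] le[OF v assms(4) eq[symmetric]] by simp
  have dvd: "length v dvd length u" if "lyndon v" "j > 0" "list_power k u = list_power j v" for u v k j
  proof -
    have "rotate (length u) (list_power k u) = list_power k u"
      by (simp add: rotate_list_power)
    then have "list_power j (rotate (length u) v) = list_power j v"
      using that by (simp add: rotate_list_power)
    then have "rotate (length u) v = v"
      by (rule list_power_inject) (use that in auto)
    then show ?thesis using lyndon_rotate_eq_dvd that by blast
  qed
  have len: "length u = length v"
    using dvd[OF v assms(4) pw] dvd[OF u assms(3) pw[symmetric]] by (simp add: dvd_antisym)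
  have uv: "u = v" by (rule list_power_inject[OF pw len]) fact+
  have "list_power k (rotate r u) = list_power j (rotate s v)"
    using eq by (simp add: rotate_list_power)
  then have "rotate r u = rotate s u"
    using uv by (metis assms(3,4) len length_rotate list_power_inject)
  then have "rotate (length u - r) (rotate s u) = u"
    using r by (metis rotate_rotate le_add_diff_inverse2 less_imp_le rotate_length01 rotate_id mod_self)
  then have "length u dvd (length u - r + s)"
    using lyndon_rotate_eq_dvd[OF u] by (simp add: rotate_rotate)
  then obtain q where q: "length u - r + s = length u * q" by blast
  have "q = 1"
  proof -
    have "0 < length u * q" "length u * q < length u * 2" using q r len by linarith+
    then show ?thesis by simp
  qed
  then show ?thesis using q r uv by simp
qed

text \<open>Take the least rotation and write it as a power of a shortest root \<open>u\<close>. A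
  nontrivial rotation fixing \<open>u\<close> would split \<open>u\<close> into two commuting words,
  which are powers of a common word, and this contradicts the choice of \<open>u\<close>.\<close>

lemma rotation_of_lyndon_power:
  assumes "w \<noteq> []"
  obtains u k r where "lyndon u" "k > 0" "r < length u" "w = rotate r (list_power k u)"
proof -
  define m where "m = Min (range (\<lambda>i. rotate i w))"
  have "range (\<lambda>i. rotate i w) \<subseteq> {v. set v \<subseteq> set w \<and> length v = length w}" by auto
  then have fin: "finite (range (\<lambda>i. rotate i w))"
    using finite_lists_length_eq[of "set w" "length w"] finite_subset by blast
  then have "m \<in> range (\<lambda>i. rotate i w)" unfolding m_def by (intro Min_in) auto
  then obtain i where i: "m = rotate i w" by auto
  have m_le: "m \<le> rotate j m" for j
    unfolding i rotate_rotate by (subst i[symmetric], subst m_def, rule Min_le[OF fin]) auto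
  have ex: "\<exists>l u k. length u = l \<and> u \<noteq> [] \<and> m = list_power k u"
    by (rule exI, rule exI[of _ m], rule exI[of _ 1]) (use assms i in auto)
  define l where "l = (LEAST l. \<exists>u k. length u = l \<and> u \<noteq> [] \<and> m = list_power k u)"
  obtain u k where u: "length u = l" "u \<noteq> []" "m = list_power k u"
    using LeastI_ex[OF ex] unfolding l_def by blast
  have least: "l \<le> length v" if "v \<noteq> []" "m = list_power j v" for v j
    unfolding l_def by (rule Least_le) (use that in blast)
  have k: "k > 0" using u i assms by (cases k) auto
  have "lyndon u"
  proof (rule lyndonI_rotate[OF u(2)])
    fix j assume j: "1 \<le> j" "j < length u"
    have "\<not> rotate j u < u"
      using list_power_less[of "rotate j u" u k] m_le[of j] k u by (auto simp: rotate_list_power)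
    moreover have "rotate j u \<noteq> u"
    proof
      assume "rotate j u = u"
      then have "drop j u @ take j u = take j u @ drop j u"
        using j by (simp add: rotate_drop_take)
      then obtain a b t where t: "list_power a t = drop j u" "list_power b t = take j u"
        using comm_append_are_replicate by blast
      have ne: "drop j u \<noteq> []" "take j u \<noteq> []" using j u by auto
      have "u = list_power (b + a) t"
        using t by (simp add: replicate_add)
      then have "m = list_power (k * (b + a)) t"
        unfolding u(3)
      proof -
        assume *: "u = list_power (b + a) t"
        have "list_power k (list_power c t) = list_power (k * c) t" for c
          by (induction k) (simp_all add: replicate_add)
        with * show "list_power k u = list_power (k * (b + a)) t" by simp
      qed
      moreover have "t \<noteq> []" using t ne by (metis concat_replicate_trivial)
      ultimately have "l \<le> length t" using least by blast
      moreover have "length t \<le> length (drop j u)"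
        using ne by (cases a) (auto simp flip: t(1))
      ultimately show False using u j by simp
    qed
    ultimately show "u < rotate j u" by simp
  qed
  moreover obtain j where j: "w = rotate j m"
  proof -
    have "rotate (length w - i mod length w) m = w"
    proof -
      have "(length w - i mod length w + i) mod length w = (length w - i mod length w + i mod length w) mod length w"
        by (simp add: mod_add_right_eq)
      also have "\<dots> = 0" using assms by (simp add: less_imp_le)
      finally show ?thesis by (simp add: i rotate_rotate rotate_id)
    qed
    then show ?thesis using that by metis
  qed
  have "w = rotate (j mod length u) (list_power k u)"
    unfolding j u(3) by (metis rotate_list_power rotate_conv_mod)
  moreover have "j mod length u < length u" using u(2) by simp
  ultimately show ?thesis using that k by blast
qed

section \<open>Counting Lyndon words\<close>

definition lyndon_words :: "nat \<Rightarrow> nat \<Rightarrow> nat list set" where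
  "lyndon_words n d = {w. lyndon w \<and> length w = n \<and> set w \<subseteq> {..<d}}"

lemma finite_lyndon_words: "finite (lyndon_words n d)"
  by (rule finite_subset[OF _ finite_lists_length_eq[of "{..<d}" n]]) (auto simp: lyndon_words_def)

text \<open>Every word of length \<open>n\<close> is a rotation of a power of a unique Lyndon word \<open>u\<close>, and it
  has \<open>length u\<close> distinct rotations.\<close>

lemma power_eq_sum_lyndon_words:
  assumes "n > 0"
  shows "d ^ n = (\<Sum>e | e dvd n. e * card (lyndon_words e d))"
proof -
  let ?W = "{w. set w \<subseteq> {..<d} \<and> length w = n}"
  let ?S = "SIGMA e:{e. e dvd n}. lyndon_words e d \<times> {..<e}"
  let ?f = "\<lambda>(e, u, r). rotate r (list_power (n div e) u)"
  have fin: "finite {e. e dvd n}" using assms by simp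
  have inj: "inj_on ?f ?S"
  proof (rule inj_onI)
    fix x y assume xy: "x \<in> ?S" "y \<in> ?S" "?f x = ?f y"
    obtain e u r e' u' r' where x: "x = (e, u, r)" "y = (e', u', r')" by (metis prod_cases3)
    have *: "(u, r) \<in> lyndon_words e d \<times> {..<e}" "(u', r') \<in> lyndon_words e' d \<times> {..<e'}"
      "e dvd n" "e' dvd n" "rotate r (list_power (n div e) u) = rotate r' (list_power (n div e') u')"
      using xy by (auto simp: x)
    have "u = u' \<and> r = r'"
      by (rule rotate_list_power_lyndon_inj[OF _ _ _ _ _ _ *(5)])
         (use * assms in \<open>auto simp: lyndon_words_def dvd_div_eq_0_iff intro!: Nat.gr0I\<close>)
    moreover have "length u = e" "length u' = e'" using * by (simp_all add: lyndon_words_def)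
    ultimately show "x = y" unfolding x by metis
  qed
  have img: "?f ` ?S = ?W"
  proof (intro equalityI subsetI)
    fix w assume "w \<in> ?f ` ?S"
    then obtain e u r where *: "e dvd n" "u \<in> lyndon_words e d" "r < e"
      "w = rotate r (list_power (n div e) u)" by auto
    then have "set w \<subseteq> set u" by auto
    with * show "w \<in> ?W" by (auto simp: lyndon_words_def length_list_power)
  next
    fix w assume w: "w \<in> ?W"
    then have "w \<noteq> []" using assms by auto
    then obtain u k r where *: "lyndon u" "k > 0" "r < length u" "w = rotate r (list_power k u)"
      by (rule rotation_of_lyndon_power)
    have n: "n = k * length u" using w * by (auto simp: length_list_power)
    have "set u \<subseteq> set w" using * by auto
    with w * n have "(length u, u, r) \<in> ?S" by (auto simp: lyndon_words_def)
    moreover have "?f (length u, u, r) = w" using * n lyndon_not_Nil[OF *(1)] by simp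
    ultimately show "w \<in> ?f ` ?S" by (metis (no_types, lifting) image_eqI)
  qed
  have "card ?W = card ?S" using card_image[OF inj] unfolding img .
  also have "\<dots> = (\<Sum>e | e dvd n. e * card (lyndon_words e d))"
    using fin by (subst card_SigmaI) (auto simp: finite_lyndon_words card_cartesian_product mult.commute)
  finally show ?thesis by (simp add: card_lists_length_eq)
qed

text \<open>Multiplication by a prime divisor \<open>p\<close> of \<open>N\<close> pairs off the squarefree divisors.\<close>

lemma sum_moebius:
  assumes "N > 0"
  shows "(\<Sum>e | e dvd N. moebius e) = (if N = 1 then 1 else 0)"
proof (cases "N = 1")
  case True
  then show ?thesis by (simp add: moebius_def)
next
  case False
  then obtain p where p: "Factorial_Ring.prime p" "p dvd N" using prime_factor_nat by blast
  define A where "A = {e. e dvd N \<and> squarefree e \<and> \<not> p dvd e}"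
  define B where "B = {e. e dvd N \<and> squarefree e \<and> p dvd e}"
  have fin: "finite {e. e dvd N}" using assms by simp
  have finAB: "finite A" "finite B" by (auto intro: finite_subset[OF _ fin] simp: A_def B_def)
  have "(\<Sum>e | e dvd N. moebius e) = (\<Sum>e\<in>A \<union> B. moebius e)"
    by (rule sum.mono_neutral_right) (use fin in \<open>auto simp: A_def B_def moebius_def\<close>)
  also have "\<dots> = (\<Sum>e\<in>A. moebius e) + (\<Sum>e\<in>B. moebius e)"
    by (rule sum.union_disjoint) (use finAB in \<open>auto simp: A_def B_def\<close>)
  also have "(\<Sum>e\<in>B. moebius e) = (\<Sum>e\<in>A. moebius (p * e))"
  proof (rule sum.reindex_bij_witness[of _ "\<lambda>e. p * e" "\<lambda>e. e div p"])
    fix e assume e: "e \<in> B"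
    then obtain f where f: "e = p * f" by (auto simp: B_def)
    have "squarefree f" using e f by (auto simp: B_def dest: squarefree_multD)
    moreover have "\<not> p dvd f"
    proof
      assume "p dvd f"
      then have "p ^ 2 dvd e" using f by (simp add: power2_eq_square)
      with e have "p dvd 1" by (metis (lifting) B_def mem_Collect_eq squarefree_def)
      then show False using p by simp
    qed
    moreover have "f dvd N" using e f by (auto simp: B_def)
    ultimately show "e div p \<in> A" using f p by (auto simp: A_def)
    show "p * (e div p) = e" using f by simp
    show "moebius (p * (e div p)) = moebius e" using f by simp
  next
    fix e assume e: "e \<in> A"
    show "p * e div p = e" using p by (auto simp: prime_gt_0_nat)
    have cop: "coprime p e" using e p by (auto simp: A_def prime_imp_coprime)
    then have "squarefree (p * e)"
      using e p by (simp add: A_def squarefree_mult_coprime squarefree_prime)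
    moreover have "p * e dvd N" using e p cop by (auto simp: A_def divides_mult)
    ultimately show "p * e \<in> B" by (simp add: B_def)
  qed
  also have "\<dots> = (\<Sum>e\<in>A. - moebius e)"
  proof (rule sum.cong[OF refl])
    fix e assume e: "e \<in> A"
    have cop: "coprime p e" using e p by (auto simp: A_def prime_imp_coprime)
    then have "squarefree (p * e)"
      using e p by (simp add: A_def squarefree_mult_coprime squarefree_prime)
    moreover have "e \<noteq> 0" using e assms by (auto simp: A_def)
    then have "prime_factors (p * e) = insert p (prime_factors e)"
      using p by (simp add: prime_factors_product prime_gt_0_nat prime_prime_factors)
    moreover have "p \<notin> prime_factors e" using e by (auto simp: A_def)
    ultimately show "moebius (p * e) = - moebius e"
      using e by (simp add: moebius_def A_def)
  qed
  finally show ?thesis using False by (simp add: sum_negf)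
qed

text \<open>Moebius inversion of \<open>power_eq_sum_lyndon_words\<close>: after exchanging the
  sums, the coefficient of \<open>k * card (lyndon_words k d)\<close> is the sum of
  \<open>moebius e\<close> over the divisors \<open>e\<close> of \<open>n div k\<close>, which
  vanishes unless \<open>k = n\<close>.\<close>

lemma witt_eq_card_lyndon_words:
  assumes "n > 0"
  shows "witt n d = card (lyndon_words n d)"
proof -
  let ?l = "\<lambda>k. int (k * card (lyndon_words k d))"
  have "(\<Sum>e | e dvd n. moebius e * int d ^ (n div e))
      = (\<Sum>e | e dvd n. \<Sum>k | k dvd n \<and> e * k dvd n. moebius e * ?l k)"
  proof (rule sum.cong[OF refl])
    fix e assume e: "e \<in> {e. e dvd n}"
    then have pos: "n div e > 0" "e > 0" using assms by (auto simp: dvd_div_eq_0_iff intro!: Nat.gr0I)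
    have "{k. k dvd n div e} = {k. k dvd n \<and> e * k dvd n}"
      using e pos by (auto simp: dvd_div_iff_mult mult.commute elim: dvd_trans[rotated])
    moreover have "int d ^ (n div e) = (\<Sum>k | k dvd n div e. ?l k)"
      using power_eq_sum_lyndon_words[OF pos(1), of d] by (metis of_nat_power of_nat_sum)
    ultimately show "moebius e * int d ^ (n div e) = (\<Sum>k | k dvd n \<and> e * k dvd n. moebius e * ?l k)"
      by (simp add: sum_distrib_left)
  qed
  also have "\<dots> = (\<Sum>k | k dvd n. \<Sum>e | e dvd n \<and> e * k dvd n. moebius e * ?l k)"
    using sum.swap_restrict[of "{e. e dvd n}" "{k. k dvd n}" "\<lambda>e k. moebius e * ?l k" "\<lambda>e k. e * k dvd n"]
      assms by simp
  also have "\<dots> = (\<Sum>k | k dvd n. if k = n then ?l k else 0)"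
  proof (rule sum.cong[OF refl])
    fix k assume k: "k \<in> {k. k dvd n}"
    then have pos: "n div k > 0" "k > 0" using assms by (auto simp: dvd_div_eq_0_iff intro!: Nat.gr0I)
    have "{e. e dvd n \<and> e * k dvd n} = {e. e dvd n div k}"
      using k pos by (auto simp: dvd_div_iff_mult mult.commute elim: dvd_trans[rotated])
    then have "(\<Sum>e | e dvd n \<and> e * k dvd n. moebius e * ?l k) = (\<Sum>e | e dvd n div k. moebius e) * ?l k"
      by (simp add: sum_distrib_right)
    also have "\<dots> = (if k = n then ?l k else 0)"
      using sum_moebius[OF pos(1)] k pos assms by (auto elim!: dvdE)
    finally show "(\<Sum>e | e dvd n \<and> e * k dvd n. moebius e * ?l k) = (if k = n then ?l k else 0)" .
  qed
  also have "\<dots> = ?l n" using assms by simp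
  finally show ?thesis using assms by (simp add: witt_def)
qed

section \<open>Commutator subgroups\<close>

definition group_commutator :: "('a, 'b) monoid_scheme \<Rightarrow> 'a \<Rightarrow> 'a \<Rightarrow> 'a" where
  "group_commutator G a b = a \<otimes>\<^bsub>G\<^esub> b \<otimes>\<^bsub>G\<^esub> inv\<^bsub>G\<^esub> a \<otimes>\<^bsub>G\<^esub> inv\<^bsub>G\<^esub> b"

text \<open>\<open>iterated_commutator G B N j\<close> is \<open>[N, \<^sub>j B]\<close>, so that \<open>\<gamma>\<^sub>j\<^sub>+\<^sub>1(B)\<close> is
  \<open>iterated_commutator G B B j\<close>.\<close>

definition iterated_commutator ::
    "('a, 'b) monoid_scheme \<Rightarrow> 'a set \<Rightarrow> 'a set \<Rightarrow> nat \<Rightarrow> 'a set" where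
  "iterated_commutator G B N j = ((\<lambda>K. commutator_subgroup G K B) ^^ j) N"

lemma iterated_commutator_0 [simp]: "iterated_commutator G B N 0 = N"
  and iterated_commutator_Suc:
    "iterated_commutator G B N (Suc j) = commutator_subgroup G (iterated_commutator G B N j) B"
  by (simp_all add: iterated_commutator_def)

text \<open>Splitting off the innermost commutator instead of the outermost one lets an inclusion of
  \<open>[B, B]\<close> in \<open>N\<close> pass to all iterated commutators.\<close>

lemma iterated_commutator_Suc':
  "iterated_commutator G B N (Suc j) = iterated_commutator G B (commutator_subgroup G N B) j"
  by (simp add: iterated_commutator_def funpow_swap1 del: funpow.simps(2))
     (simp add: funpow_Suc_right del: funpow.simps(2))

lemma lower_central_eq: "lower_central G (c + 1) H = iterated_commutator G H H c"
  by (simp add: lower_central_def iterated_commutator_def)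

context group
begin

lemma inv_cancel_left: "x \<in> carrier G \<Longrightarrow> y \<in> carrier G \<Longrightarrow> inv x \<otimes> (x \<otimes> y) = y"
  and inv_cancel_left': "x \<in> carrier G \<Longrightarrow> y \<in> carrier G \<Longrightarrow> x \<otimes> (inv x \<otimes> y) = y"
  by (simp_all flip: m_assoc)

lemmas group_normalize = m_assoc inv_mult_group inv_cancel_left inv_cancel_left'

lemma commutator_closed [simp]:
  "a \<in> carrier G \<Longrightarrow> b \<in> carrier G \<Longrightarrow> group_commutator G a b \<in> carrier G"
  by (simp add: group_commutator_def)

lemma inv_commutator:
  "a \<in> carrier G \<Longrightarrow> b \<in> carrier G \<Longrightarrow> inv (group_commutator G a b) = group_commutator G b a"
  by (simp add: group_commutator_def group_normalize)

lemma commutator_mult_left: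
  assumes "a \<in> carrier G" "b \<in> carrier G" "c \<in> carrier G"
  shows "group_commutator G (a \<otimes> b) c
    = a \<otimes> group_commutator G b c \<otimes> inv a \<otimes> group_commutator G a c"
  using assms by (simp add: group_commutator_def group_normalize)

lemma conj_commutator:
  assumes "g \<in> carrier G" "a \<in> carrier G" "b \<in> carrier G"
  shows "g \<otimes> group_commutator G a b \<otimes> inv g
    = group_commutator G (g \<otimes> a \<otimes> inv g) (g \<otimes> b \<otimes> inv g)"
  using assms by (simp add: group_commutator_def group_normalize)

lemma commutator_one_left [simp]: "b \<in> carrier G \<Longrightarrow> group_commutator G \<one> b = \<one>"
  and commutator_self [simp]: "b \<in> carrier G \<Longrightarrow> group_commutator G b b = \<one>"
  by (simp_all add: group_commutator_def group_normalize)

lemma commutator_subgroup_alt: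
  "commutator_subgroup G A B = generate G {group_commutator G a b | a b. a \<in> A \<and> b \<in> B}"
proof -
  have "(\<Union>a\<in>A. \<Union>b\<in>B. {a \<otimes> b \<otimes> inv a \<otimes> inv b})
      = {group_commutator G a b | a b. a \<in> A \<and> b \<in> B}"
    by (auto simp: group_commutator_def)
  then show ?thesis by (simp add: commutator_subgroup_def)
qed

lemma commutator_subgroup_mono:
  "A \<subseteq> A' \<Longrightarrow> B \<subseteq> B' \<Longrightarrow> commutator_subgroup G A B \<subseteq> commutator_subgroup G A' B'"
  unfolding commutator_subgroup_alt by (rule mono_generate) blast

lemma commutator_in_commutator_subgroup:
  "a \<in> A \<Longrightarrow> b \<in> B \<Longrightarrow> group_commutator G a b \<in> commutator_subgroup G A B"
  unfolding commutator_subgroup_alt by (rule generate.incl) blast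

lemma commutator_subgroup_least:
  assumes "subgroup Y G" "\<And>a b. a \<in> A \<Longrightarrow> b \<in> B \<Longrightarrow> group_commutator G a b \<in> Y"
  shows "commutator_subgroup G A B \<subseteq> Y"
  unfolding commutator_subgroup_alt by (rule generate_subgroup_incl) (use assms in auto)

lemma subgroup_commutator_subgroup:
  assumes "A \<subseteq> carrier G" "B \<subseteq> carrier G"
  shows "subgroup (commutator_subgroup G A B) G"
  unfolding commutator_subgroup_alt
  by (rule generate_is_subgroup) (use assms in \<open>auto intro!: commutator_closed\<close>)

lemma normal_commutator_subgroup:
  assumes "A \<lhd> G" "B \<lhd> G"
  shows "commutator_subgroup G A B \<lhd> G"
proof -
  interpret A: normal A G by fact
  interpret B: normal B G by fact
  show ?thesis
    unfolding commutator_subgroup_alt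
  proof (rule normal_generateI)
    fix h g
    assume "h \<in> {group_commutator G a b | a b. a \<in> A \<and> b \<in> B}" and g: "g \<in> carrier G"
    then obtain a b where ab: "a \<in> A" "b \<in> B" "h = group_commutator G a b" by auto
    then have "g \<otimes> h \<otimes> inv g = group_commutator G (g \<otimes> a \<otimes> inv g) (g \<otimes> b \<otimes> inv g)"
      using g by (simp add: conj_commutator)
    moreover have "g \<otimes> a \<otimes> inv g \<in> A" "g \<otimes> b \<otimes> inv g \<in> B"
      using ab g by (auto intro: A.inv_op_closed2 B.inv_op_closed2)
    ultimately show "g \<otimes> h \<otimes> inv g \<in> {group_commutator G a b | a b. a \<in> A \<and> b \<in> B}"
      by blast
  qed auto
qed

lemma commutator_subgroup_consistent:
  assumes "subgroup H G" "A \<subseteq> H" "B \<subseteq> H"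
  shows "commutator_subgroup (G\<lparr>carrier := H\<rparr>) A B = commutator_subgroup G A B"
proof -
  interpret H: subgroup H G by fact
  have *: "(\<Union>a\<in>A. \<Union>b\<in>B. {a \<otimes> b \<otimes> inv\<^bsub>G\<lparr>carrier := H\<rparr>\<^esub> a \<otimes> inv\<^bsub>G\<lparr>carrier := H\<rparr>\<^esub> b})
      = (\<Union>a\<in>A. \<Union>b\<in>B. {a \<otimes> b \<otimes> inv a \<otimes> inv b})"
    using assms by (intro SUP_cong refl) (auto simp: m_inv_consistent subset_iff)
  have "(\<Union>a\<in>A. \<Union>b\<in>B. {a \<otimes> b \<otimes> inv a \<otimes> inv b}) \<subseteq> H"
    using assms by (auto intro!: H.m_closed H.m_inv_closed)
  then show ?thesis
    unfolding commutator_subgroup_def using assms * by (simp add: generate_consistent)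
qed

lemma subgroup_iterated_commutator:
  assumes "subgroup B G" "subgroup N G"
  shows "subgroup (iterated_commutator G B N j) G"
proof (cases j)
  case (Suc i)
  have "iterated_commutator G B N i \<subseteq> carrier G"
  proof (induction i)
    case (Suc i)
    then show ?case
      using assms subgroup.subset[OF subgroup_commutator_subgroup, of _ B]
      by (simp add: iterated_commutator_Suc subgroup.subset)
  qed (use assms in \<open>simp add: subgroup.subset\<close>)
  then show ?thesis
    using assms Suc by (simp add: iterated_commutator_Suc subgroup_commutator_subgroup subgroup.subset)
qed (use assms in auto)

lemma iterated_commutator_subset:
  assumes "subgroup B G" "N \<subseteq> B"
  shows "iterated_commutator G B N j \<subseteq> B"
proof (induction j)
  case (Suc j)
  interpret B: subgroup B G by fact
  show ?case unfolding iterated_commutator_Suc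
    by (rule commutator_subgroup_least) (use Suc assms in \<open>auto simp: group_commutator_def\<close>)
qed (use assms in auto)

lemma iterated_commutator_consistent:
  assumes "subgroup H G" "B \<subseteq> H" "subgroup B G" "N \<subseteq> B"
  shows "iterated_commutator (G\<lparr>carrier := H\<rparr>) B N j = iterated_commutator G B N j"
proof (induction j)
  case (Suc j)
  then show ?case
    using assms iterated_commutator_subset[OF assms(3,4), of j]
    by (simp add: iterated_commutator_Suc) (rule commutator_subgroup_consistent, auto)
qed auto

lemma iterated_commutator_mono:
  assumes "N \<subseteq> N'" "B \<subseteq> B'"
  shows "iterated_commutator G B N j \<subseteq> iterated_commutator G B' N' j"
proof (induction j)
  case (Suc j)
  then show ?case
    unfolding iterated_commutator_Suc by (rule commutator_subgroup_mono) fact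
qed (use assms in simp)

text \<open>Both sides are the quotient of \<open>(ab) c (ab)\<^sup>-\<^sup>1\<close> by \<open>c\<close>, with \<open>ab\<close> also
  written as \<open>[a, b] b a\<close>.\<close>

lemma hall_witt_expansion:
  assumes carr: "a \<in> carrier G" "b \<in> carrier G" "c \<in> carrier G"
  shows "group_commutator G a (group_commutator G b c) \<otimes> (group_commutator G b c \<otimes> group_commutator G a c)
    = group_commutator G a b \<otimes> (group_commutator G b (group_commutator G a c)
      \<otimes> (group_commutator G a c \<otimes> group_commutator G b c)) \<otimes> inv (group_commutator G a b)
      \<otimes> group_commutator G (group_commutator G a b) c"
  using assms by (simp add: group_commutator_def group_normalize)

end

section \<open>The elementwise Jacobi identity and the three subgroups lemma\<close>

context group
begin

lemma commutator_eq_one_iff: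
  assumes "x \<in> carrier G" "y \<in> carrier G"
  shows "group_commutator G x y = \<one> \<longleftrightarrow> x \<otimes> y = y \<otimes> x"
proof -
  have "group_commutator G x y \<otimes> (y \<otimes> x) = x \<otimes> y"
    using assms by (simp add: group_commutator_def group_normalize)
  then show ?thesis
    using assms by (metis commutator_closed l_one m_closed r_cancel_one')
qed

lemma commutator_mult_commute:
  assumes "x \<in> carrier G" "y \<in> carrier G"
  shows "x \<otimes> y = group_commutator G x y \<otimes> y \<otimes> x"
  using assms by (simp add: group_commutator_def group_normalize)

text \<open>With \<open>z = [b, c]\<close>, \<open>w = [a, c]\<close> and \<open>t = [a, b]\<close>,
  the first two hypotheses reduce the expansion above to \<open>z w = t (w z) inv t [t, c]\<close>.
  As \<open>z\<close>, \<open>w\<close> and \<open>t\<close> commute pairwise, the conjugation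
  disappears and \<open>[t, c]\<close> must be trivial.\<close>

lemma jacobi_trivial:
  assumes carr: "a \<in> carrier G" "b \<in> carrier G" "c \<in> carrier G"
    and "group_commutator G a (group_commutator G b c) = \<one>"
    and "group_commutator G b (group_commutator G a c) = \<one>"
    and "group_commutator G (group_commutator G b c) (group_commutator G a c) = \<one>"
    and "group_commutator G (group_commutator G a b) (group_commutator G b c) = \<one>"
    and "group_commutator G (group_commutator G a b) (group_commutator G a c) = \<one>"
  shows "group_commutator G (group_commutator G a b) c = \<one>"
proof -
  define z w t where "z = group_commutator G b c" and "w = group_commutator G a c"
    and "t = group_commutator G a b"
  have c: "z \<in> carrier G" "w \<in> carrier G" "t \<in> carrier G"
    using carr by (simp_all add: z_def w_def t_def)
  have zw: "z \<otimes> w = w \<otimes> z" and tz: "t \<otimes> z = z \<otimes> t" and tw: "t \<otimes> w = w \<otimes> t"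
    using assms(6-8) c by (simp_all add: commutator_eq_one_iff flip: z_def w_def t_def)
  have "z \<otimes> w = t \<otimes> (w \<otimes> z) \<otimes> inv t \<otimes> group_commutator G t c"
    using hall_witt_expansion[OF carr] assms c by (simp flip: z_def w_def t_def)
  also have "t \<otimes> (w \<otimes> z) = w \<otimes> z \<otimes> t"
    using c tz tw by (metis m_assoc)
  also have "w \<otimes> z \<otimes> t \<otimes> inv t = z \<otimes> w"
    using c zw by (simp add: m_assoc)
  finally show ?thesis
    using c carr l_cancel_one'[of "z \<otimes> w" "group_commutator G t c"] by (simp add: t_def)
qed

text \<open>Moving \<open>c\<close> to the left past \<open>a b\<close> and past \<open>b a\<close>
  produces the same factor \<open>z w\<close>, so the quotient \<open>inv (b a) (a b)\<close>
  commutes with \<open>c\<close>; this quotient is the commutator of the inverses.\<close>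

lemma commute_commutator_inv:
  assumes carr: "a \<in> carrier G" "b \<in> carrier G" "c \<in> carrier G"
    and az: "a \<otimes> group_commutator G b c = group_commutator G b c \<otimes> a"
    and bw: "b \<otimes> group_commutator G a c = group_commutator G a c \<otimes> b"
    and zw: "group_commutator G b c \<otimes> group_commutator G a c
      = group_commutator G a c \<otimes> group_commutator G b c"
  shows "group_commutator G (inv a) (inv b) \<otimes> c = c \<otimes> group_commutator G (inv a) (inv b)"
proof -
  define z w where "z = group_commutator G b c" and "w = group_commutator G a c"
  have c: "z \<in> carrier G" "w \<in> carrier G"
    using carr by (simp_all add: z_def w_def)
  note az = az[folded z_def] and bw = bw[folded w_def] and zw = zw[folded z_def w_def]
  have bc: "b \<otimes> c = z \<otimes> c \<otimes> b" and ac: "a \<otimes> c = w \<otimes> c \<otimes> a"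
    using carr by (simp_all add: z_def w_def flip: commutator_mult_commute)
  have "a \<otimes> b \<otimes> c = a \<otimes> z \<otimes> c \<otimes> b"
    using carr c bc by (simp add: m_assoc)
  also have "\<dots> = z \<otimes> (a \<otimes> c) \<otimes> b"
    using carr c az by (simp add: m_assoc[symmetric])
  also have "\<dots> = z \<otimes> w \<otimes> c \<otimes> (a \<otimes> b)"
    using carr c by (simp add: ac m_assoc)
  finally have 1: "a \<otimes> b \<otimes> c = z \<otimes> w \<otimes> c \<otimes> (a \<otimes> b)" .
  have "b \<otimes> a \<otimes> c = b \<otimes> w \<otimes> c \<otimes> a"
    using carr c ac by (simp add: m_assoc)
  also have "\<dots> = w \<otimes> (b \<otimes> c) \<otimes> a"
    using carr c bw by (simp add: m_assoc[symmetric])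
  also have "\<dots> = z \<otimes> w \<otimes> c \<otimes> (b \<otimes> a)"
    using carr c by (simp add: bc zw m_assoc)
  finally have 2: "b \<otimes> a \<otimes> c = z \<otimes> w \<otimes> c \<otimes> (b \<otimes> a)" .
  have "inv (b \<otimes> a) \<otimes> (z \<otimes> w \<otimes> c) = c \<otimes> inv (b \<otimes> a)"
    using 2 carr c by (metis inv_solve_left inv_solve_right m_closed inv_closed m_assoc)
  then have "inv (b \<otimes> a) \<otimes> (a \<otimes> b) \<otimes> c = c \<otimes> (inv (b \<otimes> a) \<otimes> (a \<otimes> b))"
    using 1 carr c by (metis inv_closed m_assoc m_closed)
  moreover have "inv (b \<otimes> a) \<otimes> (a \<otimes> b) = group_commutator G (inv a) (inv b)"
    using carr by (simp add: group_commutator_def group_normalize)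
  ultimately show ?thesis by simp
qed

text \<open>The missing hypothesis of \<open>commute_commutator_inv\<close>, that
  \<open>z = [b, c]\<close> commutes with \<open>[a, c]\<close>, comes from the first assumption at
  \<open>inv c\<close>: conjugation by \<open>c\<close> shows that \<open>c (inv a) (inv c)\<close>
  commutes with \<open>z\<close>, and \<open>[a, c]\<close> is \<open>a\<close> times this
  element.\<close>

lemma three_subgroups_trivial:
  assumes sub: "subgroup A G" "subgroup B G" "subgroup C G"
    and 1: "\<And>a b c. a \<in> A \<Longrightarrow> b \<in> B \<Longrightarrow> c \<in> C \<Longrightarrow> group_commutator G a (group_commutator G b c) = \<one>"
    and 2: "\<And>a b c. a \<in> A \<Longrightarrow> b \<in> B \<Longrightarrow> c \<in> C \<Longrightarrow> group_commutator G b (group_commutator G a c) = \<one>"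
    and abc: "a \<in> A" "b \<in> B" "c \<in> C"
  shows "group_commutator G (group_commutator G a b) c = \<one>"
proof -
  have *: "group_commutator G (group_commutator G (inv a) (inv b)) c = \<one>"
    if abc: "a \<in> A" "b \<in> B" "c \<in> C" for a b c
  proof -
    have carr: "a \<in> carrier G" "b \<in> carrier G" "c \<in> carrier G"
      using that sub by (auto dest: subgroup.mem_carrier)
    have az: "a \<otimes> group_commutator G b c = group_commutator G b c \<otimes> a" 
      using 1[OF abc] carr by (simp add: commutator_eq_one_iff)
    have bw: "b \<otimes> group_commutator G a c = group_commutator G a c \<otimes> b"
      using 2[OF abc] carr by (simp add: commutator_eq_one_iff)
    define v where "v = group_commutator G (inv c) b"
    have v: "v \<in> carrier G" using carr by (simp add: v_def)
    have "inv c \<in> C" using abc sub subgroup.m_inv_closed by metis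
    then have "group_commutator G a (group_commutator G b (inv c)) = \<one>"
      using 1 abc by blast
    then have "a \<otimes> inv v = inv v \<otimes> a"
      using carr by (simp add: commutator_eq_one_iff v_def inv_commutator)
    then have "inv a \<otimes> v = v \<otimes> inv a"
      using carr v by (metis inv_closed inv_mult_group inv_inv)
    moreover have "v = inv c \<otimes> group_commutator G b c \<otimes> c"
      using carr by (simp add: v_def group_commutator_def group_normalize)
    ultimately have iav: "inv a \<otimes> (inv c \<otimes> group_commutator G b c \<otimes> c)
        = (inv c \<otimes> group_commutator G b c \<otimes> c) \<otimes> inv a"
      by simp
    define z where "z = group_commutator G b c"
    have z: "z \<in> carrier G" using carr by (simp add: z_def)
    have iav': "c \<otimes> inv a \<otimes> inv c \<otimes> z = z \<otimes> (c \<otimes> inv a \<otimes> inv c)"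
    proof -
      have "c \<otimes> inv a \<otimes> inv c \<otimes> z = c \<otimes> (inv a \<otimes> (inv c \<otimes> z \<otimes> c)) \<otimes> inv c"
        using carr z by (simp add: group_normalize)
      also have "\<dots> = c \<otimes> ((inv c \<otimes> z \<otimes> c) \<otimes> inv a) \<otimes> inv c"
        using iav by (simp add: z_def)
      also have "\<dots> = z \<otimes> (c \<otimes> inv a \<otimes> inv c)"
        using carr z by (simp add: group_normalize)
      finally show ?thesis .
    qed
    have w: "group_commutator G a c = a \<otimes> (c \<otimes> inv a \<otimes> inv c)"
      using carr by (simp add: group_commutator_def group_normalize)
    have "z \<otimes> (a \<otimes> (c \<otimes> inv a \<otimes> inv c)) = a \<otimes> z \<otimes> (c \<otimes> inv a \<otimes> inv c)"
      using az carr z by (simp add: z_def m_assoc)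
    also have "\<dots> = a \<otimes> (c \<otimes> inv a \<otimes> inv c) \<otimes> z"
      using iav' carr z by (simp add: m_assoc)
    finally have "group_commutator G b c \<otimes> group_commutator G a c
      = group_commutator G a c \<otimes> group_commutator G b c"
      by (simp add: w z_def)
    from commute_commutator_inv[OF carr az bw this] show ?thesis
      using carr by (simp add: commutator_eq_one_iff)
  qed
  \<comment> \<open>The inverses in the auxiliary fact are undone by applying it to
    \<open>inv a\<close> and \<open>inv b\<close>.\<close>
  have "inv a \<in> A" "inv b \<in> B" "a \<in> carrier G" "b \<in> carrier G"
    using abc sub by (simp_all add: subgroup.m_inv_closed subgroup.mem_carrier)
  with *[of "inv a" "inv b" c] abc show ?thesis by simp
qed

end

lemma hom_commutator:
  assumes "group G" "group H" "h \<in> hom G H" "a \<in> carrier G" "b \<in> carrier G"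
  shows "h (group_commutator G a b) = group_commutator H (h a) (h b)"
proof -
  interpret group_hom G H h using assms by (simp add: group_hom_def group_hom_axioms_def)
  show ?thesis using assms(4,5) by (simp add: group_commutator_def)
qed

context normal
begin

lemma coset_eq_one_iff:
  assumes "x \<in> carrier G"
  shows "H #> x = H \<longleftrightarrow> x \<in> H"
  using coset_join1[OF _ assms subgroup_axioms] coset_join2[OF assms subgroup_axioms] by blast

lemma commutator_in_iff:
  assumes "x \<in> carrier G" "y \<in> carrier G"
  shows "group_commutator G x y \<in> H \<longleftrightarrow> group_commutator (G Mod H) (H #> x) (H #> y) = \<one>\<^bsub>G Mod H\<^esub>"
  using assms
  by (simp add: coset_eq_one_iff flip: hom_commutator[OF is_group factorgroup_is_group r_coset_hom_Mod])

lemma commutator_mem_left: "x \<in> H \<Longrightarrow> y \<in> carrier G \<Longrightarrow> group_commutator G x y \<in> H"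
proof -
  assume *: "x \<in> H" "y \<in> carrier G"
  then have "x \<otimes> (y \<otimes> inv x \<otimes> inv y) \<in> H"
    by (intro subgroup.m_closed[OF subgroup_axioms] inv_op_closed2 subgroup.m_inv_closed[OF subgroup_axioms])
  with * show ?thesis by (simp add: group_commutator_def m_assoc mem_carrier)
qed

lemma commutator_mem_swap:
  "x \<in> carrier G \<Longrightarrow> y \<in> carrier G \<Longrightarrow> group_commutator G x y \<in> H \<longleftrightarrow> group_commutator G y x \<in> H"
  by (metis inv_commutator m_inv_closed)

text \<open>This set is the preimage of the centralizer of the coset of \<open>b\<close> in the
  factor group; it reduces commutator conditions modulo \<open>H\<close> to generators.\<close>

lemma subgroup_commutator_left:
  assumes b: "b \<in> carrier G"
  shows "subgroup {a \<in> carrier G. group_commutator G a b \<in> H} G"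
proof (rule subgroupI)
  show "{a \<in> carrier G. group_commutator G a b \<in> H} \<noteq> {}"
    using b one_closed by (auto intro!: exI[of _ \<one>])
next
  fix x y
  assume "x \<in> {a \<in> carrier G. group_commutator G a b \<in> H}" "y \<in> {a \<in> carrier G. group_commutator G a b \<in> H}"
  then show "x \<otimes> y \<in> {a \<in> carrier G. group_commutator G a b \<in> H}"
    using b by (auto simp: commutator_mult_left intro!: m_closed inv_op_closed2)
next
  fix x assume "x \<in> {a \<in> carrier G. group_commutator G a b \<in> H}"
  then have x: "x \<in> carrier G" "group_commutator G b x \<in> H" using b commutator_mem_swap by auto
  have "group_commutator G (inv x) b = inv x \<otimes> group_commutator G b x \<otimes> x"
    using x b by (simp add: group_commutator_def group_normalize)
  also have "\<dots> \<in> H" using x by (intro inv_op_closed1)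
  finally show "inv x \<in> {a \<in> carrier G. group_commutator G a b \<in> H}" using x by simp
qed auto

lemma commutator_generate_left:
  assumes "A \<subseteq> carrier G" "b \<in> carrier G" "\<And>a. a \<in> A \<Longrightarrow> group_commutator G a b \<in> H"
    and "x \<in> generate G A"
  shows "group_commutator G x b \<in> H"
  using generate_subgroup_incl[OF _ subgroup_commutator_left[OF assms(2)], of A] assms by auto

lemma commutator_generate_right:
  assumes "A \<subseteq> carrier G" "b \<in> carrier G" "\<And>a. a \<in> A \<Longrightarrow> group_commutator G b a \<in> H"
    and "x \<in> generate G A"
  shows "group_commutator G b x \<in> H"
proof -
  have "group_commutator G x b \<in> H"
    by (rule commutator_generate_left[OF assms(1,2) _ assms(4)])
       (use assms commutator_mem_swap in auto)
  then show ?thesis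
    using assms commutator_mem_swap generate_in_carrier by blast
qed

lemma three_subgroups:
  assumes sub: "subgroup A G" "subgroup B G" "subgroup C G"
    and 1: "\<And>a b c. a \<in> A \<Longrightarrow> b \<in> B \<Longrightarrow> c \<in> C \<Longrightarrow> group_commutator G a (group_commutator G b c) \<in> H"
    and 2: "\<And>a b c. a \<in> A \<Longrightarrow> b \<in> B \<Longrightarrow> c \<in> C \<Longrightarrow> group_commutator G b (group_commutator G a c) \<in> H"
    and z: "z \<in> commutator_subgroup G A B" and c: "c \<in> C"
  shows "group_commutator G z c \<in> H"
proof -
  interpret Q: group "G Mod H" by (rule factorgroup_is_group)
  interpret h: group_hom G "G Mod H" "(#>) H"
    by (simp add: group_hom_def group_hom_axioms_def r_coset_hom_Mod)
  have carr: "\<And>x. x \<in> A \<Longrightarrow> x \<in> carrier G" "\<And>x. x \<in> B \<Longrightarrow> x \<in> carrier G" "\<And>x. x \<in> C \<Longrightarrow> x \<in> carrier G"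
    using sub by (auto dest: subgroup.mem_carrier)
  have qsub: "subgroup ((#>) H ` A) (G Mod H)" "subgroup ((#>) H ` B) (G Mod H)" "subgroup ((#>) H ` C) (G Mod H)"
    using sub by (auto intro: h.subgroup_img_is_subgroup)
  note hc = hom_commutator[OF is_group Q.is_group r_coset_hom_Mod, symmetric]
  have *: "group_commutator G (group_commutator G a b) c \<in> H" if abc: "a \<in> A" "b \<in> B" for a b
  proof -
    have "group_commutator (G Mod H) (group_commutator (G Mod H) (H #> a) (H #> b)) (H #> c) = \<one>\<^bsub>G Mod H\<^esub>"
    proof (rule Q.three_subgroups_trivial[OF qsub])
      fix x y z
      assume "x \<in> (#>) H ` A" "y \<in> (#>) H ` B" "z \<in> (#>) H ` C"
      then obtain x' y' z' where xyz: "x' \<in> A" "y' \<in> B" "z' \<in> C" "x = H #> x'" "y = H #> y'" "z = H #> z'"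
        by blast
      with carr have c': "x' \<in> carrier G" "y' \<in> carrier G" "z' \<in> carrier G" by simp_all
      show "group_commutator (G Mod H) x (group_commutator (G Mod H) y z) = \<one>\<^bsub>G Mod H\<^esub>"
        using 1[OF xyz(1-3)] c' by (simp add: xyz hc coset_eq_one_iff)
      show "group_commutator (G Mod H) y (group_commutator (G Mod H) x z) = \<one>\<^bsub>G Mod H\<^esub>"
        using 2[OF xyz(1-3)] c' by (simp add: xyz hc coset_eq_one_iff)
    qed (use that c in auto)
    then show ?thesis
      using that c carr by (simp add: hc coset_eq_one_iff)
  qed
  show ?thesis
    by (rule commutator_generate_left[OF _ _ _ z[unfolded commutator_subgroup_alt]])
       (use * c carr in auto)
qed

lemma jacobi_mem:
  assumes carr: "a \<in> carrier G" "b \<in> carrier G" "c \<in> carrier G"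
    and "group_commutator G a (group_commutator G b c) \<in> H"
    and "group_commutator G b (group_commutator G a c) \<in> H"
    and "group_commutator G (group_commutator G b c) (group_commutator G a c) \<in> H"
    and "group_commutator G (group_commutator G a b) (group_commutator G b c) \<in> H"
    and "group_commutator G (group_commutator G a b) (group_commutator G a c) \<in> H"
  shows "group_commutator G (group_commutator G a b) c \<in> H"
proof -
  interpret Q: group "G Mod H" by (rule factorgroup_is_group)
  interpret h: group_hom G "G Mod H" "(#>) H"
    by (simp add: group_hom_def group_hom_axioms_def r_coset_hom_Mod)
  note hc = hom_commutator[OF is_group Q.is_group r_coset_hom_Mod, symmetric]
  have "group_commutator (G Mod H) (group_commutator (G Mod H) (H #> a) (H #> b)) (H #> c) = \<one>\<^bsub>G Mod H\<^esub>"
    by (rule Q.jacobi_trivial)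
       (use assms in \<open>simp_all add: hc coset_eq_one_iff\<close>)
  then show ?thesis
    using carr by (simp add: hc coset_eq_one_iff)
qed

end

section \<open>Depth of commutators along the lower central series\<close>

context group
begin

abbreviation lcs :: "nat \<Rightarrow> 'a set" where
  "lcs j \<equiv> iterated_commutator G (carrier G) (carrier G) j"

lemma normal_iterated_commutator:
  "N \<lhd> G \<Longrightarrow> iterated_commutator G (carrier G) N j \<lhd> G"
  by (induction j) (simp_all add: iterated_commutator_Suc normal_commutator_subgroup normal_self)

lemma normal_lcs: "lcs j \<lhd> G"
  by (rule normal_iterated_commutator[OF normal_self])

lemma iterated_commutator_Suc_subset:
  assumes "N \<lhd> G"
  shows "iterated_commutator G (carrier G) N (Suc j) \<subseteq> iterated_commutator G (carrier G) N j"
proof -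
  interpret M: normal "iterated_commutator G (carrier G) N j" G
    by (rule normal_iterated_commutator[OF assms])
  show ?thesis unfolding iterated_commutator_Suc
    by (rule commutator_subgroup_least[OF M.subgroup_axioms]) (rule M.commutator_mem_left)
qed

lemma iterated_commutator_antimono:
  assumes "N \<lhd> G" "i \<le> j"
  shows "iterated_commutator G (carrier G) N j \<subseteq> iterated_commutator G (carrier G) N i"
  using assms(2) by (induction rule: dec_induct) (use iterated_commutator_Suc_subset[OF assms(1)] in auto)

text \<open>Induction on \<open>i\<close> by the three subgroups lemma, as
  \<open>lcs (Suc i)\<close> is \<open>[lcs i, G]\<close>: both permuted commutators combine one
  bracket with \<open>G\<close> and one with \<open>lcs i\<close>. The extra 1 in the index arises
  because \<open>lcs i\<close> is the lower central term of number \<open>i + 1\<close>.\<close>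

lemma lcs_commutator_mem:
  assumes N: "N \<lhd> G" and "c \<in> lcs i" "m \<in> iterated_commutator G (carrier G) N j"
  shows "group_commutator G c m \<in> iterated_commutator G (carrier G) N (i + j + 1)"
  using assms(2,3)
proof (induction i arbitrary: c m j)
  case 0
  interpret M: normal "iterated_commutator G (carrier G) N j" G
    by (rule normal_iterated_commutator[OF N])
  interpret M': normal "iterated_commutator G (carrier G) N (Suc j)" G
    by (rule normal_iterated_commutator[OF N])
  have "group_commutator G m c \<in> iterated_commutator G (carrier G) N (Suc j)"
    using 0 by (simp add: iterated_commutator_Suc commutator_in_commutator_subgroup)
  then show ?case using 0 M.mem_carrier M'.commutator_mem_swap by simp
next
  case (Suc i)
  interpret M: normal "iterated_commutator G (carrier G) N (Suc i + j + 1)" G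
    by (rule normal_iterated_commutator[OF N])
  interpret J: normal "iterated_commutator G (carrier G) N j" G
    by (rule normal_iterated_commutator[OF N])
  interpret C: normal "lcs i" G by (rule normal_lcs)
  have swap: "group_commutator G x m \<in> iterated_commutator G (carrier G) N (Suc j)"
    if "x \<in> carrier G" "m \<in> iterated_commutator G (carrier G) N j" for x m j
  proof -
    interpret M: normal "iterated_commutator G (carrier G) N j" G
      by (rule normal_iterated_commutator[OF N])
    interpret M': normal "iterated_commutator G (carrier G) N (Suc j)" G
      by (rule normal_iterated_commutator[OF N])
    have "group_commutator G m x \<in> iterated_commutator G (carrier G) N (Suc j)"
      using that by (simp add: iterated_commutator_Suc commutator_in_commutator_subgroup)
    then show ?thesis using that M.mem_carrier M'.commutator_mem_swap by simp
  qed
  show ?case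
  proof (rule M.three_subgroups)
    show "subgroup (lcs i) G" "subgroup (carrier G) G"
      "subgroup (iterated_commutator G (carrier G) N j) G"
      by (rule C.subgroup_axioms subgroup_self J.subgroup_axioms)+
    show "c \<in> commutator_subgroup G (lcs i) (carrier G)"
      using Suc.prems by (simp add: iterated_commutator_Suc)
    show "m \<in> iterated_commutator G (carrier G) N j" by fact
  next
    fix a b m
    assume *: "a \<in> lcs i" "b \<in> carrier G" "m \<in> iterated_commutator G (carrier G) N j"
    show "group_commutator G a (group_commutator G b m)
        \<in> iterated_commutator G (carrier G) N (Suc i + j + 1)"
      using Suc.IH[OF *(1) swap[OF *(2,3)]] by simp
    show "group_commutator G b (group_commutator G a m)
        \<in> iterated_commutator G (carrier G) N (Suc i + j + 1)"
      using swap[OF *(2) Suc.IH[OF *(1,3)]] by simp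
  qed
qed

end

text \<open>The subgroup \<open>B\<close> of the free group becomes the ambient group here, so that
  normality and commutators need no reference to a larger group.\<close>

locale abelian_quotient = normal N G for N and G (structure) +
  assumes derived_subset: "commutator_subgroup G (carrier G) (carrier G) \<subseteq> N"
begin

abbreviation itc :: "nat \<Rightarrow> 'a set" where
  "itc j \<equiv> iterated_commutator G (carrier G) N j"

lemma normal_itc: "itc j \<lhd> G"
  by (rule normal_iterated_commutator) (rule normal_axioms)

lemma lcs_antimono: "i \<le> j \<Longrightarrow> lcs j \<subseteq> lcs i"
  by (rule iterated_commutator_antimono[OF normal_self])

lemma lcs_carrier: "x \<in> lcs j \<Longrightarrow> x \<in> carrier G"
  using normal_imp_subgroup[OF normal_lcs] by (rule subgroup.mem_carrier)

lemma itc_subset_lcs: "itc j \<subseteq> lcs j"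
  by (rule iterated_commutator_mono) (auto intro: mem_carrier)

text \<open>With \<open>itc_subset_lcs\<close> this interleaves the two series. Consequently
  \<open>lcs j / itc j\<close> is abelian, and central in the quotient of the whole group by
  \<open>itc j\<close>.\<close>

lemma lcs_Suc_subset_itc: "lcs (Suc j) \<subseteq> itc j"
  unfolding iterated_commutator_Suc' by (rule iterated_commutator_mono[OF derived_subset]) simp

lemma commutator_lcs_itc: "c \<in> lcs i \<Longrightarrow> m \<in> itc j \<Longrightarrow> group_commutator G c m \<in> itc (i + j + 1)"
  using lcs_commutator_mem normal_axioms by blast

lemma commutator_itc_lcs: "c \<in> lcs i \<Longrightarrow> m \<in> itc j \<Longrightarrow> group_commutator G m c \<in> itc (j + i + 1)"
  using commutator_lcs_itc normal.commutator_mem_swap[OF normal_itc]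
  by (metis add.commute in_mono itc_subset_lcs lcs_carrier)

lemma commutator_lcs_lcs: "c \<in> lcs i \<Longrightarrow> d \<in> lcs j \<Longrightarrow> group_commutator G c d \<in> lcs (i + j + 1)"
  using lcs_commutator_mem[OF normal_self] by blast

lemma normal_between:
  assumes "subgroup Y G" "itc n \<subseteq> Y" "Y \<subseteq> lcs n"
  shows "Y \<lhd> G"
proof (rule normal_invI[OF assms(1)])
  fix x h assume x: "x \<in> carrier G" and h: "h \<in> Y"
  then have hc: "h \<in> carrier G" using assms lcs_carrier by auto
  have "group_commutator G x h \<in> lcs (0 + n + 1)"
    by (rule commutator_lcs_lcs) (use x h assms in auto)
  then have "group_commutator G x h \<otimes> h \<in> Y"
    using lcs_Suc_subset_itc[of n] assms h by (auto intro: subgroup.m_closed)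
  then show "x \<otimes> h \<otimes> inv x \<in> Y"
    using x hc by (simp add: group_commutator_def group_normalize)
qed

text \<open>The commutators among \<open>[a, b]\<close>, \<open>[b, c]\<close> and
  \<open>[a, c]\<close> that \<open>jacobi_mem\<close> asks for contain one of the three elements
  twice. They lie at least one lower central step beyond index \<open>i + j + k + 2\<close>, hence
  in \<open>itc (i + j + k + 2)\<close>.\<close>

lemma jacobi_lcs:
  assumes abc: "a \<in> lcs i" "b \<in> lcs j" "c \<in> lcs k"
    and Y: "Y \<lhd> G" "itc (i + j + k + 2) \<subseteq> Y"
    and "group_commutator G a (group_commutator G b c) \<in> Y"
    and "group_commutator G b (group_commutator G a c) \<in> Y"
  shows "group_commutator G (group_commutator G a b) c \<in> Y"
proof -
  interpret Y: normal Y G by fact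
  have bc: "group_commutator G b c \<in> lcs (j + k + 1)" and ac: "group_commutator G a c \<in> lcs (i + k + 1)"
    and ab: "group_commutator G a b \<in> lcs (i + j + 1)"
    using abc commutator_lcs_lcs by blast+
  have sub: "x \<in> Y" if "x \<in> lcs m" "m > i + j + k + 2" for m x
    using lcs_antimono[of "Suc (i + j + k + 2)" m] lcs_Suc_subset_itc Y that by fastforce
  show ?thesis
  proof (rule Y.jacobi_mem)
    show "a \<in> carrier G" "b \<in> carrier G" "c \<in> carrier G"
      using abc lcs_carrier by blast+
    show "group_commutator G (group_commutator G b c) (group_commutator G a c) \<in> Y"
      by (rule sub[OF commutator_lcs_lcs[OF bc ac]]) simp
    show "group_commutator G (group_commutator G a b) (group_commutator G b c) \<in> Y"
      by (rule sub[OF commutator_lcs_lcs[OF ab bc]]) simp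
    show "group_commutator G (group_commutator G a b) (group_commutator G a c) \<in> Y"
      by (rule sub[OF commutator_lcs_lcs[OF ab ac]]) simp
  qed fact+
qed

end

section \<open>Brackets of Lyndon words in a group\<close>

text \<open>The operation \<open>br\<close> is a parameter so that one recursion yields both group
  commutators and Lie polynomials of Lyndon words.\<close>

function lyndon_bracket :: "(nat \<Rightarrow> 'b) \<Rightarrow> ('b \<Rightarrow> 'b \<Rightarrow> 'b) \<Rightarrow> nat list \<Rightarrow> 'b" where
  "lyndon_bracket f br w = (if length w < 2 then f (hd w)
     else br (lyndon_bracket f br (lyndon_left w)) (lyndon_bracket f br (lyndon_right w)))"
  by auto
termination
  by (relation "measure (\<lambda>(f, br, w). length w)")
     (auto simp: length_lyndon_left length_lyndon_right not_less)

declare lyndon_bracket.simps [simp del]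

lemma lyndon_bracket_singleton [simp]: "lyndon_bracket f br [a] = f a"
  by (simp add: lyndon_bracket.simps)

lemma lyndon_bracket_split:
  "length w \<ge> 2 \<Longrightarrow> lyndon_bracket f br w
    = br (lyndon_bracket f br (lyndon_left w)) (lyndon_bracket f br (lyndon_right w))"
  by (simp add: lyndon_bracket.simps[of f br w])

lemma lyndon_induct [consumes 1, case_names singleton split]:
  assumes "lyndon w" and "\<And>a. P [a]"
    and "\<And>w. lyndon w \<Longrightarrow> length w \<ge> 2 \<Longrightarrow> lyndon (lyndon_left w) \<Longrightarrow> lyndon (lyndon_right w) \<Longrightarrow>
      P (lyndon_left w) \<Longrightarrow> P (lyndon_right w) \<Longrightarrow> P w"
  shows "P w"
  using assms(1)
proof (induction "length w" arbitrary: w rule: less_induct)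
  case less
  show ?case
  proof (cases "length w \<ge> 2")
    case True
    show ?thesis
      by (rule assms(3)[OF less.prems True lyndon_lyndon_left[OF True less.prems] lyndon_lyndon_right[OF True]
            less.hyps less.hyps])
         (use True less.prems lyndon_lyndon_left lyndon_lyndon_right length_lyndon_left length_lyndon_right in auto)
  next
    case False
    then obtain a where "w = [a]" using lyndon_not_Nil[OF less.prems] by (cases w) (auto simp: Suc_le_eq)
    then show ?thesis using assms(2) by simp
  qed
qed

lemma set_lyndon_left_right: "length w \<ge> 2 \<Longrightarrow> set (lyndon_left w) \<union> set (lyndon_right w) = set w"
  by (metis lyndon_left_append_right set_append)

lemma length_lyndon_left_right: "length w \<ge> 2 \<Longrightarrow> length (lyndon_left w) + length (lyndon_right w) = length w"
  by (metis lyndon_left_append_right length_append)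

lemma length_lyndon: "lyndon w \<Longrightarrow> length w > 0"
  by (simp add: lyndon_not_Nil)

section \<open>Orders of commutators modulo a normal subgroup\<close>

context group
begin

lemma pow_gcd_mem:
  assumes "subgroup H G" "a \<in> carrier G" "a [^] (m :: nat) \<in> H" "a [^] (n :: nat) \<in> H"
  shows "a [^] gcd m n \<in> H"
proof -
  obtain u v where uv: "u * int m + v * int n = gcd (int m) (int n)"
    using bezout_int by blast
  have "a [^] (gcd m n) = a [^] (int m * u + int n * v)"
    using uv by (simp add: int_pow_int[symmetric] mult.commute gcd_int_int_eq)
  also have "\<dots> = (a [^] m) [^] u \<otimes> (a [^] n) [^] v"
    using assms by (simp add: int_pow_mult int_pow_pow[symmetric] int_pow_int)
  also have "\<dots> \<in> H"
    using assms by (intro subgroup.m_closed subgroup_int_pow_closed)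
  finally show ?thesis .
qed

lemma pow_Gcd_mem:
  assumes "finite A" "subgroup H G" "a \<in> carrier G" "\<And>m. m \<in> A \<Longrightarrow> a [^] (m :: nat) \<in> H"
  shows "a [^] Gcd A \<in> H"
  using assms(1,4)
proof (induction A rule: finite_induct)
  case (insert m A)
  then show ?case using assms by (simp add: pow_gcd_mem)
qed (use assms in \<open>simp add: subgroup.one_closed\<close>)

lemma commutator_pow_left:
  assumes "a \<in> carrier G" "b \<in> carrier G" "group_commutator G a (group_commutator G a b) = \<one>"
  shows "group_commutator G (a [^] (k :: nat)) b = group_commutator G a b [^] k"
proof (induction k)
  case (Suc k)
  have "a \<otimes> group_commutator G a b = group_commutator G a b \<otimes> a"
    using assms by (simp add: commutator_eq_one_iff)
  then have "a [^] k \<otimes> group_commutator G a b = group_commutator G a b \<otimes> a [^] k"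
    using assms by (metis commutator_closed group_commutes_pow)
  then have "a [^] k \<otimes> group_commutator G a b \<otimes> inv (a [^] k) = group_commutator G a b"
    using assms by (simp add: m_assoc)
  then show ?case
    using Suc assms by (simp add: commutator_mult_left nat_pow_Suc2[symmetric] del: nat_pow_Suc)
qed (use assms in simp)

end

context normal
begin

lemma commutator_pow_mem_left:
  assumes ab: "a \<in> carrier G" "b \<in> carrier G" and "group_commutator G a (group_commutator G a b) \<in> H"
    and "group_commutator G (a [^] (k :: nat)) b \<in> H"
  shows "group_commutator G a b [^] k \<in> H"
proof -
  interpret Q: group "G Mod H" by (rule factorgroup_is_group)
  interpret h: group_hom G "G Mod H" "(#>) H"
    by (simp add: group_hom_def group_hom_axioms_def r_coset_hom_Mod)
  note hc = hom_commutator[OF is_group Q.is_group r_coset_hom_Mod, symmetric]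
  have hp: "(H #> x) [^]\<^bsub>G Mod H\<^esub> k = H #> (x [^] k)" if "x \<in> carrier G" for x
    using that h.hom_nat_pow by simp
  have "group_commutator (G Mod H) ((H #> a) [^]\<^bsub>G Mod H\<^esub> k) (H #> b)
      = group_commutator (G Mod H) (H #> a) (H #> b) [^]\<^bsub>G Mod H\<^esub> k"
    by (rule Q.commutator_pow_left)
       (use assms in \<open>simp_all add: hc coset_eq_one_iff del: mult_FactGroup\<close>)
  then have "H #> (group_commutator G a b [^] k) = H #> group_commutator G (a [^] k) b"
    using ab by (simp add: hp hc)
  also have "\<dots> = H" using assms by (simp add: coset_eq_one_iff)
  finally show ?thesis using ab by (simp add: coset_eq_one_iff)
qed

end

context abelian_quotient
begin

text \<open>Since \<open>[a, [a, b]]\<close> is deep enough to lie in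
  \<open>itc (i + j + 1)\<close>, taking the commutator with \<open>b\<close> respects powers of
  \<open>a\<close> modulo that subgroup. So an exponent that kills \<open>a\<close> in its layer
  kills \<open>[a, b]\<close> in the next one.\<close>

lemma commutator_pow_mem_itc_left:
  assumes a: "a \<in> lcs i" "a [^] (k :: nat) \<in> itc i" and b: "b \<in> lcs j"
  shows "group_commutator G a b [^] k \<in> itc (i + j + 1)"
proof (rule normal.commutator_pow_mem_left[OF normal_itc])
  show "a \<in> carrier G" "b \<in> carrier G" using a b lcs_carrier by auto
  have "group_commutator G a (group_commutator G a b) \<in> lcs (i + (i + j + 1) + 1)"
    by (intro commutator_lcs_lcs a b)
  then show "group_commutator G a (group_commutator G a b) \<in> itc (i + j + 1)"
    using lcs_antimono[of "Suc (i + j + 1)" "i + (i + j + 1) + 1"] lcs_Suc_subset_itc[of "i + j + 1"] by auto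
  show "group_commutator G (a [^] k) b \<in> itc (i + j + 1)"
    by (rule commutator_itc_lcs[OF b a(2)])
qed

lemma commutator_pow_mem_itc_right:
  assumes a: "a \<in> lcs i" and b: "b \<in> lcs j" "b [^] (k :: nat) \<in> itc j"
  shows "group_commutator G a b [^] k \<in> itc (i + j + 1)"
proof -
  interpret M: normal "itc (i + j + 1)" G by (rule normal_itc)
  have "group_commutator G b a [^] k \<in> itc (i + j + 1)"
    using commutator_pow_mem_itc_left[OF b a] by (simp add: add.commute)
  then have "inv (group_commutator G b a [^] k) \<in> itc (i + j + 1)" by (rule M.m_inv_closed)
  moreover have "a \<in> carrier G" "b \<in> carrier G" using a b lcs_carrier by auto
  ultimately show ?thesis by (simp add: nat_pow_inv[symmetric] inv_commutator)
qed

end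

text \<open>The \<open>x j\<close> lift generators of the quotient by \<open>N\<close>. They
  generate only together with \<open>N\<close>, because the group itself need not be finitely
  generated.\<close>

locale generated_quotient = abelian_quotient +
  fixes x :: "nat \<Rightarrow> 'a" and d :: nat
  assumes x_closed: "j < d \<Longrightarrow> x j \<in> carrier G"
    and generate_x: "generate G (x ` {..<d} \<union> N) = carrier G"
begin

abbreviation bracket :: "nat list \<Rightarrow> 'a" where
  "bracket w \<equiv> lyndon_bracket x (group_commutator G) w"

lemma bracket_mem:
  assumes "lyndon w" "set w \<subseteq> {..<d}"
  shows "bracket w \<in> lcs (length w - 1)"
  using assms
proof (induction rule: lyndon_induct)
  case (split w)
  have "bracket w \<in> lcs (length (lyndon_left w) - 1 + (length (lyndon_right w) - 1) + 1)"
    unfolding lyndon_bracket_split[OF split(2)]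
    by (rule commutator_lcs_lcs) (use split set_lyndon_left_right in auto)
  moreover have "length (lyndon_left w) - 1 + (length (lyndon_right w) - 1) + 1 = length w - 1"
    using length_lyndon_left_right[OF split(2)] split(3,4) length_lyndon[OF split(3)] length_lyndon[OF split(4)] by linarith
  ultimately show ?case by simp
qed (use x_closed in auto)

lemma bracket_mem': "w \<in> lyndon_words (Suc n) d \<Longrightarrow> bracket w \<in> lcs n"
  using bracket_mem[of w] by (auto simp: lyndon_words_def)

text \<open>The lower bound \<open>w0\<close> records that rewriting a commutator never produces a
  lexicographically smaller word; the induction depends on it. The bound \<open>[]\<close> is no
  restriction.\<close>

definition bracket_span :: "nat \<Rightarrow> nat list \<Rightarrow> 'a set" where
  "bracket_span n w0 = generate G (bracket ` {w \<in> lyndon_words (Suc n) d. w0 \<le> w} \<union> itc n)"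

lemma bracket_span_gens_carrier: "bracket ` {w \<in> lyndon_words (Suc n) d. w0 \<le> w} \<union> itc n \<subseteq> carrier G"
  using bracket_mem' lcs_carrier itc_subset_lcs by blast

lemma subgroup_bracket_span: "subgroup (bracket_span n w0) G"
  unfolding bracket_span_def by (rule generate_is_subgroup[OF bracket_span_gens_carrier])

lemma itc_subset_bracket_span: "itc n \<subseteq> bracket_span n w0"
  unfolding bracket_span_def by (auto intro: generate.incl)

lemma bracket_span_subset_lcs: "bracket_span n w0 \<subseteq> lcs n"
  unfolding bracket_span_def
  by (rule generate_subgroup_incl[OF _ normal_imp_subgroup[OF normal_lcs]])
     (use bracket_mem' itc_subset_lcs in auto)

lemma normal_bracket_span: "bracket_span n w0 \<lhd> G"
  by (rule normal_between[OF subgroup_bracket_span itc_subset_bracket_span bracket_span_subset_lcs])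

lemma bracket_span_antimono: "w0 \<le> w1 \<Longrightarrow> bracket_span n w1 \<subseteq> bracket_span n w0"
  unfolding bracket_span_def by (rule mono_generate) auto

lemma bracket_mem_bracket_span: "w \<in> lyndon_words (Suc n) d \<Longrightarrow> w0 \<le> w \<Longrightarrow> bracket w \<in> bracket_span n w0"
  unfolding bracket_span_def by (auto intro: generate.incl)

lemma commutator_bracket_span:
  assumes a: "a \<in> lcs i" and b: "b \<in> bracket_span m w0"
    and Y: "Y \<lhd> G" "itc (i + m + 1) \<subseteq> Y"
    and br: "\<And>w. w \<in> lyndon_words (Suc m) d \<Longrightarrow> w0 \<le> w \<Longrightarrow> group_commutator G a (bracket w) \<in> Y"
  shows "group_commutator G a b \<in> Y"
proof (rule normal.commutator_generate_right[OF Y(1) bracket_span_gens_carrier _ _ b[unfolded bracket_span_def]])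
  show "a \<in> carrier G" using a lcs_carrier by auto
  fix c assume "c \<in> bracket ` {w \<in> lyndon_words (Suc m) d. w0 \<le> w} \<union> itc m"
  then show "group_commutator G a c \<in> Y"
    using br commutator_lcs_itc[OF a] Y(2) by auto
qed

text \<open>Induction on the length of \<open>uv\<close>, then on \<open>uv\<close> downwards in the lexicographic order,
  then on the length of \<open>u\<close>.  If \<open>(u, v)\<close> is not the standard factorization of \<open>uv\<close>, then
  \<open>u\<close> has a standard factorization \<open>(p, q)\<close> with \<open>q < v\<close>, and the Jacobi identity rewrites
  \<open>[[p, q], v]\<close> by \<open>[p, [q, v]]\<close> and \<open>[q, [p, v]]\<close>.\<close>

lemma commutator_bracket_mem:
  assumes "lyndon u" "lyndon v" "set (u @ v) \<subseteq> {..<d}" "u < v"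
  shows "group_commutator G (bracket u) (bracket v) \<in> bracket_span (length (u @ v) - 1) (u @ v)"
  using assms
proof (induction "(u, v)" arbitrary: u v rule: wf_induct_rule[OF wf_measures[of
    "[\<lambda>(u, v). length (u @ v),
      \<lambda>(u, v). card {y. set y \<subseteq> {..<d} \<and> length y = length (u @ v) \<and> u @ v < y},
      \<lambda>(u, v). length u]"]])
  case (1 u v)
  let ?n = "length (u @ v) - 1" and ?Y = "bracket_span (length (u @ v) - 1) (u @ v)"
  interpret Y: normal ?Y G by (rule normal_bracket_span)
  have uv: "lyndon (u @ v)" using 1 by (intro lyndon_append)
  have pos: "length u > 0" "length v > 0" using 1 length_lyndon by auto
  show ?case
  proof (cases "length u \<ge> 2 \<and> lyndon_right u < v")
    case False
    \<comment> \<open>Here \<open>(u, v)\<close> is the standard factorization of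
      \<open>u @ v\<close>, so the commutator is already a bracket.\<close>
    have "v \<le> lyndon_right u" if "length u \<ge> 2" using False that by auto
    note split = lyndon_right_append[OF 1(2,3) this]
    have "length (u @ v) \<ge> 2" unfolding length_append using pos by linarith
    then have "group_commutator G (bracket u) (bracket v) = bracket (u @ v)"
      using split by (simp add: lyndon_bracket_split)
    also have "\<dots> \<in> ?Y"
      by (rule bracket_mem_bracket_span) (use uv 1 pos in \<open>auto simp: lyndon_words_def\<close>)
    finally show ?thesis .
  next
    case True
    define p q where "p = lyndon_left u" and "q = lyndon_right u"
    have len: "length u \<ge> 2" using True by simp
    have pq: "lyndon p" "lyndon q" "p < q" "u = p @ q" "q < v"
      using True lyndon_lyndon_left[OF len 1(2)] lyndon_lyndon_right[OF len]
        lyndon_left_less_right[OF len 1(2)] lyndon_left_append_right[OF len] by (simp_all add: p_def q_def)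
    have ppos: "length p > 0" "length q > 0" using pq length_lyndon by auto
    have sets: "set p \<subseteq> {..<d}" "set q \<subseteq> {..<d}" "set v \<subseteq> {..<d}"
      using 1 pq by auto
    have bu: "bracket u = group_commutator G (bracket p) (bracket q)"
      using len by (simp add: lyndon_bracket_split p_def q_def)
    have mem: "bracket p \<in> lcs (length p - 1)" "bracket q \<in> lcs (length q - 1)" "bracket v \<in> lcs (length v - 1)"
      using bracket_mem pq 1 sets by auto
    have carr: "bracket p \<in> carrier G" "bracket q \<in> carrier G" "bracket v \<in> carrier G"
      using mem lcs_carrier by auto
    have IH: "group_commutator G (bracket r) (bracket s) \<in> ?Y"
      if rs: "lyndon r" "lyndon s" "r < s" "set r \<subseteq> {..<d}" "set s \<subseteq> {..<d}" "length (r @ s) = length (u @ v)"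
        "u @ v < r @ s \<or> u @ v = r @ s \<and> length r < length u" for r s
    proof -
      \<comment> \<open>There are finitely many words of this length over \<open>{..<d}\<close>, so
        moving up in the lexicographic order lowers the number of words still above.\<close>
      have "((r, s), (u, v)) \<in> measures [\<lambda>(u, v). length (u @ v),
          \<lambda>(u, v). card {y. set y \<subseteq> {..<d} \<and> length y = length (u @ v) \<and> u @ v < y},
          \<lambda>(u, v). length u]"
      proof (cases "u @ v < r @ s")
        case True
        let ?S = "\<lambda>w. {y. set y \<subseteq> {..<d} \<and> length y = length (u @ v) \<and> w < y}"
        have "r @ s \<in> ?S (u @ v) - ?S (r @ s)"
          using True rs by simp
        moreover have "?S (r @ s) \<subseteq> ?S (u @ v)"
          using True by (auto dest: less_trans)
        ultimately have psub: "?S (r @ s) \<subset> ?S (u @ v)" by blast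
        have "finite (?S (u @ v))"
          by (rule finite_subset[OF _ finite_lists_length_eq[of "{..<d}" "length (u @ v)"]]) auto
        then have "card (?S (r @ s)) < card (?S (u @ v))" by (rule psubset_card_mono[OF _ psub])
        then show ?thesis unfolding in_measures prod.case rs(6) by blast
      next
        case False
        then have eq: "u @ v = r @ s" "length r < length u" using rs by auto
        show ?thesis
          unfolding in_measures prod.case eq(1) using eq(2) by blast
      qed
      then have "group_commutator G (bracket r) (bracket s) \<in> bracket_span (length (r @ s) - 1) (r @ s)"
        using 1(1)[of r s] rs by simp
      also have "\<dots> \<subseteq> ?Y" unfolding rs(6) by (rule bracket_span_antimono) (use rs(7) in auto)
      finally show ?thesis .
    qed
    have short: "group_commutator G (bracket r) (bracket v) \<in> bracket_span (length (r @ v) - 1) (r @ v)"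
      if "lyndon r" "r < v" "set r \<subseteq> {..<d}" "length r < length u" for r
      by (rule 1(1)) (use that 1 in auto)
    show ?thesis unfolding bu
    proof (rule jacobi_lcs[OF mem Y.normal_axioms])
      have "length p - 1 + (length q - 1) + (length v - 1) + 2 = ?n"
          unfolding pq(4) length_append using ppos pos by linarith
        then show "itc (length p - 1 + (length q - 1) + (length v - 1) + 2) \<subseteq> ?Y" using itc_subset_bracket_span[of ?n "u @ v"] by metis
    next
      show "group_commutator G (bracket p) (group_commutator G (bracket q) (bracket v)) \<in> ?Y"
      proof (rule commutator_bracket_span[OF mem(1) short Y.normal_axioms])
        show "lyndon q" "q < v" "set q \<subseteq> {..<d}" "length q < length u" using pq sets ppos by simp_all
        have "length p - 1 + (length (q @ v) - 1) + 1 = ?n"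
          unfolding pq(4) length_append using ppos pos by linarith
        then show "itc (length p - 1 + (length (q @ v) - 1) + 1) \<subseteq> ?Y" using itc_subset_bracket_span[of ?n "u @ v"] by metis
        fix w assume w: "w \<in> lyndon_words (Suc (length (q @ v) - 1)) d" "q @ v \<le> w"
        \<comment> \<open>From \<open>p < q < q @ v\<close> and the bound on \<open>w\<close> the
          pair \<open>(p, w)\<close> is in the right order. If \<open>p @ w\<close> equals
          \<open>u @ v\<close>, progress lies in the shorter first factor.\<close>
        have "q < q @ v" by (rule less_append_self) (use pos in simp)
        with pq(3) w(2) have "p < w" by order
        moreover have "p @ (q @ v) \<le> p @ w" using w(2) by (auto simp: order_le_less)
        then have "u @ v < p @ w \<or> u @ v = p @ w" using pq(4) by (auto simp: order_le_less)
        ultimately show "group_commutator G (bracket p) (bracket w) \<in> ?Y"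
          by (intro IH) (use w sets pq ppos pos in \<open>auto simp: lyndon_words_def\<close>)
      qed
    next
      show "group_commutator G (bracket q) (group_commutator G (bracket p) (bracket v)) \<in> ?Y"
      proof (rule commutator_bracket_span[OF mem(2) short Y.normal_axioms])
        show "lyndon p" "p < v" "set p \<subseteq> {..<d}" "length p < length u" using pq sets ppos by simp_all
        have "length q - 1 + (length (p @ v) - 1) + 1 = ?n"
          unfolding pq(4) length_append using ppos pos by linarith
        then show "itc (length q - 1 + (length (p @ v) - 1) + 1) \<subseteq> ?Y" using itc_subset_bracket_span[of ?n "u @ v"] by metis
        fix w assume w: "w \<in> lyndon_words (Suc (length (p @ v) - 1)) d" "p @ v \<le> w"
        then have wl: "lyndon w" "length w = length (p @ v)" "set w \<subseteq> {..<d}"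
          using ppos by (auto simp: lyndon_words_def)
        \<comment> \<open>Nothing is known about the order of \<open>q\<close> and \<open>w\<close>.
          A pair in the wrong order is swapped, which only inverts the commutator.\<close>
        consider "q = w" | "q < w" | "w < q" by (meson linorder_less_linear)
        then show "group_commutator G (bracket q) (bracket w) \<in> ?Y"
        proof cases
          case 1
          then show ?thesis using carr Y.one_closed by simp
        next
          case 2
          have "u < q" using lyndon_less_suffix[of p q] \<open>lyndon u\<close> pq ppos by simp
          then have "u @ v < q @ w" by (rule less_append_of_length_le) (use pq in simp)
          then show ?thesis
            by (intro IH) (use 2 wl pq sets in auto)
        next
          case 3
          \<comment> \<open>The swapped pair is \<open>(w, q)\<close>, and \<open>w @ q\<close> is
            at least \<open>p @ v @ q\<close>. This exceeds \<open>u @ v = p @ q @ v\<close> because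
            \<open>q @ v < v < v @ q\<close>.\<close>
          have "q @ v < v"
            by (rule lyndon_less_suffix[OF lyndon_append]) (use pq 1 ppos pos in auto)
          also have "v < v @ q" by (rule less_append_self) (use ppos in simp)
          finally have "u @ v < (p @ v) @ q" using pq(4) by simp
          also have "(p @ v) @ q \<le> w @ q"
            using w(2) less_append_of_length_le[of "p @ v" w q q] wl(2) by (auto simp: order_le_less)
          finally have "group_commutator G (bracket w) (bracket q) \<in> ?Y"
            by (intro IH) (use 3 wl pq sets in auto)
          moreover have "bracket w \<in> carrier G" using bracket_mem[OF wl(1,3)] lcs_carrier by blast
          ultimately show ?thesis using Y.commutator_mem_swap carr by blast
        qed
      qed
    qed
  qed
qed

text \<open>In the induction step, generators suffice in both arguments: what is left is a letter
  against a bracket. A letter is itself a Lyndon word, so after sorting the two words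
  \<open>commutator_bracket_mem\<close> applies.\<close>

lemma lcs_eq_bracket_span: "lcs n = bracket_span n []"
proof (induction n)
  case 0
  have "[j] \<in> lyndon_words (Suc 0) d" if "j < d" for j
    using that by (simp add: lyndon_words_def lyndon_singleton)
  then have "x j \<in> bracket_span 0 []" if "j < d" for j
    using that bracket_mem_bracket_span[of "[j]" 0 "[]"] by simp
  then have "x ` {..<d} \<union> N \<subseteq> bracket_span 0 []"
    using itc_subset_bracket_span[of 0 "[]"] by auto
  then have "carrier G \<subseteq> bracket_span 0 []"
    using generate_subgroup_incl[OF _ subgroup_bracket_span] generate_x by metis
  then show ?case using bracket_span_subset_lcs[of 0 "[]"] by simp
next
  case (Suc n)
  let ?Y = "bracket_span (Suc n) []"
  interpret Y: normal ?Y G by (rule normal_bracket_span)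
  have "lcs (Suc n) \<subseteq> ?Y" unfolding iterated_commutator_Suc
  proof (rule commutator_subgroup_least[OF subgroup_bracket_span])
    fix a b assume a: "a \<in> lcs n" and b: "b \<in> carrier G"
    have "group_commutator G b a \<in> ?Y"
    proof (rule commutator_bracket_span[OF _ a[unfolded Suc] Y.normal_axioms])
      show "b \<in> lcs 0" using b by simp
      show "itc (0 + n + 1) \<subseteq> ?Y" using itc_subset_bracket_span by simp
      fix w assume w: "w \<in> lyndon_words (Suc n) d"
      then have wl: "lyndon w" "set w \<subseteq> {..<d}" "length w = Suc n" by (auto simp: lyndon_words_def)
      have wc: "bracket w \<in> carrier G" using bracket_mem'[OF w] lcs_carrier by auto
      show "group_commutator G b (bracket w) \<in> ?Y"
      proof (rule Y.commutator_generate_left[OF _ wc _ b[folded generate_x]])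
        show "x ` {..<d} \<union> N \<subseteq> carrier G" using x_closed mem_carrier by auto
        fix c assume "c \<in> x ` {..<d} \<union> N"
        then consider j where "j < d" "c = x j" | "c \<in> N" by auto
        then show "group_commutator G c (bracket w) \<in> ?Y"
        proof cases
          case (1 j)
          have gt: "group_commutator G (bracket u) (bracket v) \<in> ?Y"
            if "u < v" "lyndon u" "lyndon v" "set (u @ v) \<subseteq> {..<d}" "length (u @ v) = Suc (Suc n)" for u v
            using commutator_bracket_mem[OF that(2-4,1)] bracket_span_antimono[of "[]" "u @ v" "Suc n"] that(5)
            by auto
          consider "[j] < w" | "w = [j]" | "w < [j]" by fastforce
          then show ?thesis
          proof cases
            case 2
            then show ?thesis using wc 1 Y.one_closed by simp
          next
            case 3
            then have "group_commutator G (bracket w) (bracket [j]) \<in> ?Y"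
              by (rule gt) (use wl 1 lyndon_singleton in auto)
            then show ?thesis using Y.commutator_mem_swap wc x_closed 1 by simp
          qed (use gt[of "[j]" w] wl 1 lyndon_singleton in simp)
        next
          case 2
          have "group_commutator G c (bracket w) \<in> itc (0 + n + 1)"
            by (rule commutator_itc_lcs[OF bracket_mem'[OF w], of c 0]) (use 2 in simp)
          then show ?thesis using itc_subset_bracket_span by auto
        qed
      qed
    qed
    then show "group_commutator G a b \<in> ?Y"
      using Y.commutator_mem_swap a b lcs_carrier by blast
  qed
  then show ?case using bracket_span_subset_lcs by blast
qed

text \<open>By linearity in each argument, the exponent of any single letter kills the whole
  bracket. Bezout then combines the letters of the word into their gcd.\<close>

lemma bracket_pow_mem:
  assumes "lyndon w" "set w \<subseteq> {..<d}" and "i \<in> set w" "x i [^] (k :: nat) \<in> N"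
  shows "bracket w [^] k \<in> itc (length w - 1)"
  using assms(1-3)
proof (induction rule: lyndon_induct)
  case (singleton a)
  then show ?case using assms by simp
next
  case (split w)
  have sets: "set (lyndon_left w) \<subseteq> {..<d}" "set (lyndon_right w) \<subseteq> {..<d}"
    using split.prems set_lyndon_left_right[OF split(2)] by auto
  note mem = bracket_mem[OF split(3) sets(1)] bracket_mem[OF split(4) sets(2)]
  have len: "length (lyndon_left w) - 1 + (length (lyndon_right w) - 1) + 1 = length w - 1"
    using length_lyndon_left_right[OF split(2)] split(3,4) length_lyndon[OF split(3)] length_lyndon[OF split(4)] by linarith
  from split.prems consider "i \<in> set (lyndon_left w)" | "i \<in> set (lyndon_right w)"
    using set_lyndon_left_right[OF split(2)] by auto
  then show ?case
  proof cases
    case 1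
    then show ?thesis
      using commutator_pow_mem_itc_left[OF mem(1) _ mem(2)] split.IH(1) sets
      unfolding lyndon_bracket_split[OF split(2)] len by blast
  next
    case 2
    then show ?thesis
      using commutator_pow_mem_itc_right[OF mem] split.IH(2) sets
      unfolding lyndon_bracket_split[OF split(2)] len by blast
  qed
qed

lemma bracket_pow_Gcd_mem:
  assumes w: "lyndon w" "set w \<subseteq> {..<d}" and "\<And>i. i < d \<Longrightarrow> x i [^] (k i :: nat) \<in> N"
  shows "bracket w [^] Gcd (k ` set w) \<in> itc (length w - 1)"
  by (rule pow_Gcd_mem[OF _ normal_imp_subgroup[OF normal_itc]])
     (use assms bracket_mem[OF w] lcs_carrier bracket_pow_mem[OF w] in auto)

end

section \<open>The Magnus group\<close>

text \<open>Functions on words are noncommutative integral power series.\<close>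

fun conv :: "(nat list \<Rightarrow> int) \<Rightarrow> (nat list \<Rightarrow> int) \<Rightarrow> nat list \<Rightarrow> int" where
  "conv f g [] = f [] * g []"
| "conv f g (a # w) = f [] * g (a # w) + conv (\<lambda>v. f (a # v)) g w"

lemma conv_eq_sum: "conv f g w = (\<Sum>i\<le>length w. f (take i w) * g (drop i w))"
  by (induction f g w rule: conv.induct) (simp_all add: sum.atMost_Suc_shift del: sum.atMost_Suc)

lemma conv_left_linear: "conv (\<lambda>v. c * f v + f' v) g w = c * conv f g w + conv f' g w"
  by (simp add: conv_eq_sum algebra_simps sum.distrib sum_distrib_left)

lemma conv_assoc: "conv (conv f g) h w = conv f (conv g h) w"
proof (induction w arbitrary: f)
  case (Cons a w)
  then show ?case by (simp add: conv_left_linear algebra_simps)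
qed simp

definition conv_one :: "nat list \<Rightarrow> int" where
  "conv_one w = (if w = [] then 1 else 0)"

lemma conv_one_left: "conv conv_one g w = g w"
proof (cases w)
  case (Cons a v)
  have "conv (\<lambda>v. 0) g v = 0" by (simp add: conv_eq_sum)
  then show ?thesis using Cons by (simp add: conv_one_def)
qed (simp add: conv_one_def)

text \<open>The equation for a left inverse at \<open>w\<close> contains the unknown coefficient at
  \<open>w\<close> with factor \<open>f [] = 1\<close>, and otherwise only coefficients at proper
  prefixes; solving it gives the recursion.\<close>

function conv_inv :: "(nat list \<Rightarrow> int) \<Rightarrow> nat list \<Rightarrow> int" where
  "conv_inv f w = (if w = [] then 1
    else - (\<Sum>i<length w. conv_inv f (take i w) * f (drop i w)))"
  by auto
termination by (relation "measure (\<lambda>(f, w). length w)") auto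

declare conv_inv.simps [simp del]

lemma conv_inv_left:
  assumes "f [] = 1"
  shows "conv (conv_inv f) f w = conv_one w"
proof (cases "w = []")
  case False
  have "conv (conv_inv f) f w = (\<Sum>i<length w. conv_inv f (take i w) * f (drop i w)) + conv_inv f w"
    using assms by (simp add: conv_eq_sum lessThan_Suc_atMost[symmetric])
  then show ?thesis using False by (simp add: conv_inv.simps[of f w] conv_one_def)
qed (use assms in \<open>simp add: conv_inv.simps conv_one_def\<close>)

definition magnus_group :: "(nat list \<Rightarrow> int) monoid" where
  "magnus_group = \<lparr>carrier = {f. f [] = 1}, monoid.mult = conv, one = conv_one\<rparr>"

lemma magnus_group_simps [simp]:
  "f \<in> carrier magnus_group \<longleftrightarrow> f [] = 1" "monoid.mult magnus_group = conv" "one magnus_group = conv_one"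
  by (simp_all add: magnus_group_def)

lemma group_magnus_group: "group magnus_group"
proof (rule groupI)
  fix f assume "f \<in> carrier magnus_group"
  then show "\<exists>g\<in>carrier magnus_group. g \<otimes>\<^bsub>magnus_group\<^esub> f = \<one>\<^bsub>magnus_group\<^esub>"
    by (intro bexI[of _ "conv_inv f"]) (auto simp: conv_inv_left conv_inv.simps)
qed (auto simp: conv_assoc conv_one_left conv_one_def fun_eq_iff)

interpretation magnus: group magnus_group
  by (rule group_magnus_group)

text \<open>If the letters have orders \<open>k\<close>, this is the order of the word as a tensor; order \<open>0\<close>
  means infinite order, and \<open>Gcd {} = 0\<close>.\<close>

definition word_gcd :: "(nat \<Rightarrow> nat) \<Rightarrow> nat list \<Rightarrow> int" where
  "word_gcd k w = int (Gcd (k ` set w))"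

text \<open>This makes the coefficientwise reduction modulo \<open>word_gcd\<close> compatible with
  convolution: both parts of a split word have coarser or equal moduli.\<close>

lemma word_gcd_dvd: "set v \<subseteq> set w \<Longrightarrow> word_gcd k w dvd word_gcd k v"
  unfolding word_gcd_def int_dvd_int_iff by (rule Gcd_greatest) (auto intro: Gcd_dvd)

lemma word_gcd_dvd_take: "word_gcd k w dvd word_gcd k (take i w)"
  and word_gcd_dvd_drop: "word_gcd k w dvd word_gcd k (drop i w)"
  by (simp_all add: word_gcd_dvd set_take_subset set_drop_subset)

text \<open>After reduction modulo the orders of words, these are the series \<open>1 +\<close>
  terms of degree at least \<open>j\<close> in the completed tensor algebra of the sum of cyclic
  groups.\<close>

definition magnus_filtration :: "(nat \<Rightarrow> nat) \<Rightarrow> nat \<Rightarrow> (nat list \<Rightarrow> int) set" where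
  "magnus_filtration k j = {f. f [] = 1 \<and> (\<forall>w. w \<noteq> [] \<and> length w < j \<longrightarrow> word_gcd k w dvd f w)}"

lemma magnus_filtrationD:
  "f \<in> magnus_filtration k j \<Longrightarrow> f [] = 1"
  "f \<in> magnus_filtration k j \<Longrightarrow> w \<noteq> [] \<Longrightarrow> length w < j \<Longrightarrow> word_gcd k w dvd f w"
  by (auto simp: magnus_filtration_def)

lemma magnus_filtration_take:
  assumes "f \<in> magnus_filtration k j" "0 < i" "i < j" "w \<noteq> []"
  shows "word_gcd k w dvd f (take i w)"
proof -
  have "length (take i w) < j" using assms by simp
  then show ?thesis
    using magnus_filtrationD(2)[OF assms(1), of "take i w"] assms
    by (auto intro: dvd_trans[OF word_gcd_dvd_take])
qed

lemma magnus_filtration_drop: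
  assumes "f \<in> magnus_filtration k j" "i < length w" "length w - i < j"
  shows "word_gcd k w dvd f (drop i w)"
  using magnus_filtrationD(2)[OF assms(1), of "drop i w"] assms
  by (auto intro: dvd_trans[OF word_gcd_dvd_drop])

lemma conv_magnus:
  assumes "f [] = 1" "g [] = 1" "w \<noteq> []"
  shows "conv f g w = f w + g w + (\<Sum>i\<in>{0<..<length w}. f (take i w) * g (drop i w))"
proof -
  have "{..length w} = insert 0 (insert (length w) {0<..<length w})" using assms by auto
  then have "conv f g w = (\<Sum>i\<in>insert 0 (insert (length w) {0<..<length w}). f (take i w) * g (drop i w))"
    by (simp only: conv_eq_sum)
  also have "\<dots> = f w + g w + (\<Sum>i\<in>{0<..<length w}. f (take i w) * g (drop i w))"
    using assms by (subst sum.insert; simp)+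
  finally show ?thesis .
qed

text \<open>A split of \<open>w\<close> into two nonempty parts makes both shorter than
  \<open>j\<close>, so the cross terms vanish modulo the gcd. The case \<open>length w = j\<close>
  is the important one: there the product acts as a sum on leading coefficients.\<close>

lemma conv_filtration_cong:
  assumes "f \<in> magnus_filtration k j" "g \<in> magnus_filtration k j" "w \<noteq> []" "length w \<le> j"
  shows "word_gcd k w dvd conv f g w - (f w + g w)"
proof -
  have "word_gcd k w dvd (\<Sum>i\<in>{0<..<length w}. f (take i w) * g (drop i w))"
    by (rule dvd_sum, rule dvd_mult2, rule magnus_filtration_take[OF assms(1)]) (use assms in auto)
  then show ?thesis using assms by (simp add: conv_magnus magnus_filtrationD(1))
qed

lemma inv_magnus_coeff:
  assumes "f [] = 1" "w \<noteq> []"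
  shows "(inv\<^bsub>magnus_group\<^esub> f) w = - (\<Sum>i<length w. (inv\<^bsub>magnus_group\<^esub> f) (take i w) * f (drop i w))"
proof -
  have "conv (inv\<^bsub>magnus_group\<^esub> f) f = conv_one" using magnus.l_inv[of f] assms by simp
  then have "conv (inv\<^bsub>magnus_group\<^esub> f) f w = 0" using assms by (simp add: conv_one_def)
  then show ?thesis using assms by (simp add: conv_eq_sum lessThan_Suc_atMost[symmetric])
qed

lemma subgroup_magnus_filtration: "subgroup (magnus_filtration k j) magnus_group"
proof (rule magnus.subgroupI)
  show "magnus_filtration k j \<subseteq> carrier magnus_group" by (auto simp: magnus_filtration_def)
  have "conv_one \<in> magnus_filtration k j" by (simp add: magnus_filtration_def conv_one_def)
  then show "magnus_filtration k j \<noteq> {}" by blast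
next
  fix f assume f: "f \<in> magnus_filtration k j"
  then have f1: "f [] = 1" by (rule magnus_filtrationD)
  have "(inv\<^bsub>magnus_group\<^esub> f) [] = 1" using magnus.inv_closed[of f] f1 by simp
  moreover have "word_gcd k w dvd (inv\<^bsub>magnus_group\<^esub> f) w" if "w \<noteq> []" "length w < j" for w
    unfolding inv_magnus_coeff[where f = f and w = w, OF f1 that(1)]
    by (subst dvd_minus_iff, rule dvd_sum, rule dvd_mult, rule magnus_filtration_drop[OF f]) (use that in auto)
  ultimately show "inv\<^bsub>magnus_group\<^esub> f \<in> magnus_filtration k j" by (simp add: magnus_filtration_def)
next
  fix f g assume fg: "f \<in> magnus_filtration k j" "g \<in> magnus_filtration k j"
  have "word_gcd k w dvd conv f g w" if "w \<noteq> []" "length w < j" for w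
  proof -
    have "word_gcd k w dvd conv f g w - (f w + g w) + (f w + g w)"
      using conv_filtration_cong[OF fg] magnus_filtrationD(2)[OF fg(1)] magnus_filtrationD(2)[OF fg(2)] that
      by (intro dvd_add) auto
    then show ?thesis by simp
  qed
  then show "f \<otimes>\<^bsub>magnus_group\<^esub> g \<in> magnus_filtration k j"
    using fg by (simp add: magnus_filtration_def)
qed

text \<open>Comparing coefficients in \<open>c g f = f g\<close> for the commutator \<open>c\<close>
  avoids the coefficients of inverses.\<close>

lemma magnus_commutator_diff:
  assumes f: "f [] = 1" and g: "g [] = 1" and w: "w \<noteq> []"
  shows "group_commutator magnus_group f g w = conv f g w - conv g f w
    - (\<Sum>i\<in>{0<..<length w}. group_commutator magnus_group f g (take i w) * conv g f (drop i w))"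
proof -
  let ?c = "group_commutator magnus_group f g"
  have c: "?c [] = 1" using magnus.commutator_closed[of f g] f g by simp
  have gf: "conv g f [] = 1" using f g by simp
  have "?c \<otimes>\<^bsub>magnus_group\<^esub> g \<otimes>\<^bsub>magnus_group\<^esub> f = f \<otimes>\<^bsub>magnus_group\<^esub> g"
    using magnus.commutator_mult_commute[of f g] f g by (simp only: magnus_group_simps)
  then have "conv ?c (conv g f) w = conv f g w"
    by (simp add: conv_assoc fun_eq_iff)
  then show ?thesis using conv_magnus[of ?c "conv g f" w] c gf w by simp
qed

text \<open>The leading part of a commutator is the Lie bracket of the leading parts: at length
  \<open>i + j\<close> only one split of \<open>w\<close> contributes to each of the two products.
  The correction terms of \<open>magnus_commutator_diff\<close> involve the commutator at shorter
  words and vanish by induction.\<close>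

lemma magnus_commutator_cong:
  assumes f: "f \<in> magnus_filtration k i" and g: "g \<in> magnus_filtration k j" and "i > 0" "j > 0"
    and w: "w \<noteq> []" "length w \<le> i + j"
  shows "word_gcd k w dvd group_commutator magnus_group f g w
    - (if length w < i + j then 0
       else f (take i w) * g (drop i w) - g (take j w) * f (drop j w))"
  using w
proof (induction "length w" arbitrary: w rule: less_induct)
  case less
  let ?c = "group_commutator magnus_group f g"
  let ?t = "\<lambda>f g w l. f (take l w) * g (drop l w)"
  have fg1: "f [] = 1" "g [] = 1" using f g magnus_filtrationD by auto
  have sum: "word_gcd k w dvd (\<Sum>l\<in>{0<..<length w}. ?t f g w l) - (if length w < i + j then 0 else ?t f g w i)"
    if f: "f \<in> magnus_filtration k i" and g: "g \<in> magnus_filtration k j" and "i > 0" "j > 0" "length w \<le> i + j"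
      "w \<noteq> []"
    for f g i j
  proof -
    have *: "word_gcd k w dvd ?t f g w l" if "l \<in> {0<..<length w} - (if length w < i + j then {} else {i})" for l
    proof (cases "l < i")
      case True
      then show ?thesis using that \<open>w \<noteq> []\<close> by (intro dvd_mult2 magnus_filtration_take[OF f]) auto
    next
      case False
      then have "length w - l < j" using that \<open>length w \<le> i + j\<close> by (auto split: if_splits)
      then show ?thesis using that by (intro dvd_mult magnus_filtration_drop[OF g]) auto
    qed
    show ?thesis
    proof (cases "length w < i + j")
      case True
      then have "word_gcd k w dvd ?t f g w l" if "l \<in> {0<..<length w}" for l using *[of l] that by simp
      then show ?thesis using True by (auto intro!: dvd_sum)
    next
      case False
      then have "i \<in> {0<..<length w}" using that by auto
      then have "(\<Sum>l\<in>{0<..<length w}. ?t f g w l) = ?t f g w i + (\<Sum>l\<in>{0<..<length w} - {i}. ?t f g w l)"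
        by (simp add: sum.remove)
      moreover have "word_gcd k w dvd (\<Sum>l\<in>{0<..<length w} - {i}. ?t f g w l)"
        by (rule dvd_sum) (use * False in simp)
      ultimately show ?thesis using False by simp
    qed
  qed
  have 1: "word_gcd k w dvd (\<Sum>l\<in>{0<..<length w}. ?c (take l w) * conv g f (drop l w))"
  proof (rule dvd_sum, rule dvd_mult2)
    fix l assume l: "l \<in> {0<..<length w}"
    then have "word_gcd k (take l w) dvd ?c (take l w)"
      using less(1)[of "take l w"] less.prems by auto
    then show "word_gcd k w dvd ?c (take l w)" by (rule dvd_trans[OF word_gcd_dvd_take])
  qed
  have 2: "conv f g w - conv g f w
      = (\<Sum>l\<in>{0<..<length w}. ?t f g w l) - (\<Sum>l\<in>{0<..<length w}. ?t g f w l)"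
    using fg1 less.prems by (simp add: conv_magnus)
  have 3: "word_gcd k w dvd (\<Sum>l\<in>{0<..<length w}. ?t f g w l) - (if length w < i + j then 0 else ?t f g w i)"
    by (rule sum) (use f g assms less.prems in auto)
  have 4: "word_gcd k w dvd (\<Sum>l\<in>{0<..<length w}. ?t g f w l) - (if length w < j + i then 0 else ?t g f w j)"
    by (rule sum) (use f g assms less.prems in auto)
  show ?case
    using dvd_diff[OF dvd_diff[OF 3 4] 1] unfolding magnus_commutator_diff[where f = f and g = g, OF fg1 less.prems(1)] 2
    by (auto simp: algebra_simps split: if_splits)
qed

lemma magnus_commutator_filtration:
  assumes "f \<in> magnus_filtration k i" "g \<in> magnus_filtration k j" "i > 0" "j > 0"
  shows "group_commutator magnus_group f g \<in> magnus_filtration k (i + j)"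
proof -
  have "group_commutator magnus_group f g [] = 1"
    using magnus.commutator_closed[of f g] assms magnus_filtrationD(1) by auto
  moreover have "word_gcd k w dvd group_commutator magnus_group f g w" if "w \<noteq> []" "length w < i + j" for w
    using magnus_commutator_cong[OF assms that(1)] that by simp
  ultimately show ?thesis by (simp add: magnus_filtration_def)
qed

section \<open>Leading terms of the Lie polynomials of Lyndon words\<close>

abbreviation lyndon_polynomial :: "nat list \<Rightarrow> nat list \<Rightarrow> int" where
  "lyndon_polynomial \<equiv> lyndon_bracket (\<lambda>j v. if v = [j] then 1 else 0)
     (\<lambda>f g w. conv f g w - conv g f w)"

text \<open>Both products in a Lie bracket only concatenate words, so the polynomial is homogeneous
  in every letter. All words of its support therefore have the same \<open>word_gcd\<close>.\<close>

lemma lyndon_polynomial_supp: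
  assumes "lyndon w" "lyndon_polynomial w y \<noteq> 0"
  shows "mset y = mset w"
  using assms
proof (induction arbitrary: y rule: lyndon_induct)
  case (split w)
  let ?l = "lyndon_left w" and ?r = "lyndon_right w"
  have conv: "mset y = mset w" if nz: "conv (lyndon_polynomial u) (lyndon_polynomial v) y \<noteq> 0"
    and uv: "\<And>y. lyndon_polynomial u y \<noteq> 0 \<Longrightarrow> mset y = mset u"
      "\<And>y. lyndon_polynomial v y \<noteq> 0 \<Longrightarrow> mset y = mset v" "mset u + mset v = mset w" for u v
  proof -
    obtain i where "lyndon_polynomial u (take i y) * lyndon_polynomial v (drop i y) \<noteq> 0"
      using nz unfolding conv_eq_sum by (meson sum.not_neutral_contains_not_neutral)
    then have "mset (take i y) + mset (drop i y) = mset w" using uv by simp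
    then show ?thesis by (metis append_take_drop_id mset_append)
  qed
  have "mset ?l + mset ?r = mset w"
    using lyndon_left_append_right[OF split(2)] by (metis mset_append)
  then show ?case
    using conv[of ?l ?r] conv[of ?r ?l] split.IH split.prems
    by (fastforce simp: lyndon_bracket_split[OF split(2)] add.commute)
qed (auto split: if_splits)

lemma conv_lyndon_polynomial:
  assumes "lyndon u" "lyndon v" "length y = length u + length v"
  shows "conv (lyndon_polynomial u) (lyndon_polynomial v) y
    = lyndon_polynomial u (take (length u) y) * lyndon_polynomial v (drop (length u) y)"
proof -
  have "lyndon_polynomial u (take i y) * lyndon_polynomial v (drop i y) = 0"
    if "i \<in> {..length y} - {length u}" for i
    using that lyndon_polynomial_supp[OF assms(1), of "take i y"] mset_eq_length[of "take i y" u] by auto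
  then have "(\<Sum>i\<in>{..length y} - {length u}. lyndon_polynomial u (take i y) * lyndon_polynomial v (drop i y)) = 0"
    by (rule sum.neutral[OF ballI])
  then show ?thesis
    unfolding conv_eq_sum using assms by (subst sum.remove[of _ "length u"]) auto
qed

lemma append_le_append:
  fixes a b c d :: "nat list"
  assumes "a \<le> b" "c \<le> d" "length a = length b"
  shows "a @ c \<le> b @ d"
  using assms less_append_of_length_le[of a b c d] by (cases "a = b") (auto simp: order_le_less)

text \<open>Write \<open>w = l @ r\<close>. The product in the order \<open>l\<close>,
  \<open>r\<close> starts with \<open>w\<close> and coefficient 1. The other one has its support at
  or above \<open>r @ l\<close>, which is larger since \<open>w < r < r @ l\<close>, so it cannot
  cancel the leading term.\<close>

lemma lyndon_polynomial_leading:
  assumes "lyndon w"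
  shows "lyndon_polynomial w w = 1 \<and> (\<forall>y. lyndon_polynomial w y \<noteq> 0 \<longrightarrow> w \<le> y)"
  using assms
proof (induction rule: lyndon_induct)
  case (split w)
  let ?l = "lyndon_left w" and ?r = "lyndon_right w"
  have w: "w = ?l @ ?r" using lyndon_left_append_right[OF split(2)] by simp
  have len: "length w = length ?l + length ?r" using w by (metis length_append)
  have lr: "w < ?r @ ?l"
  proof -
    have "?l @ ?r < ?r"
      by (rule lyndon_less_suffix) (use split(1,2) w lyndon_left_not_Nil lyndon_right_not_Nil in auto)
    also have "?r < ?r @ ?l" by (rule less_append_self[OF lyndon_left_not_Nil[OF split(2)]])
    finally show ?thesis using w by simp
  qed
  have P: "lyndon_polynomial w y = lyndon_polynomial ?l (take (length ?l) y) * lyndon_polynomial ?r (drop (length ?l) y)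
      - lyndon_polynomial ?r (take (length ?r) y) * lyndon_polynomial ?l (drop (length ?r) y)"
    if "length y = length w" for y
    using that len by (simp add: lyndon_bracket_split[OF split(2)] conv_lyndon_polynomial split(3,4))
  have rl: "w < y" if y: "length y = length w"
    and nz: "lyndon_polynomial ?r (take (length ?r) y) * lyndon_polynomial ?l (drop (length ?r) y) \<noteq> 0" for y
  proof -
    have "?r @ ?l \<le> take (length ?r) y @ drop (length ?r) y"
      by (rule append_le_append) (use nz split.IH y len in auto)
    then show ?thesis using lr by simp
  qed
  have "lyndon_polynomial ?r (take (length ?r) w) * lyndon_polynomial ?l (drop (length ?r) w) = 0"
    using rl[of w] by auto
  moreover have "take (length ?l) w = ?l" "drop (length ?l) w = ?r"
    using w by (metis append_eq_conv_conj)+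
  ultimately have "lyndon_polynomial w w = 1" using P[of w] split.IH by simp
  moreover have "w \<le> y" if nz: "lyndon_polynomial w y \<noteq> 0" for y
  proof -
    have y: "length y = length w"
      using lyndon_polynomial_supp[OF split(1) nz] by (rule mset_eq_length)
    from nz P[OF y] consider "lyndon_polynomial ?l (take (length ?l) y) * lyndon_polynomial ?r (drop (length ?l) y) \<noteq> 0"
      | "lyndon_polynomial ?r (take (length ?r) y) * lyndon_polynomial ?l (drop (length ?r) y) \<noteq> 0" by linarith
    then show ?thesis
    proof cases
      case 1
      have "?l @ ?r \<le> take (length ?l) y @ drop (length ?l) y"
        by (rule append_le_append) (use 1 split.IH y len in auto)
      then show ?thesis using w by simp
    qed (use rl[OF y] in simp)
  qed
  ultimately show ?case by blast
qed auto

text \<open>Compare coefficients at the smallest \<open>w\<close> that violates the claim: the terms of larger words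
  vanish there, and the terms of smaller words vanish modulo \<open>word_gcd k w\<close> because their
  support consists of rearrangements.\<close>

lemma lyndon_polynomial_independent:
  fixes a :: "nat list \<Rightarrow> int"
  assumes sum: "\<And>y. y \<in> lyndon_words n d \<Longrightarrow>
      word_gcd k y dvd (\<Sum>w\<in>lyndon_words n d. a w * lyndon_polynomial w y)"
    and "w \<in> lyndon_words n d"
  shows "word_gcd k w dvd a w"
proof (rule ccontr)
  let ?B = "{w \<in> lyndon_words n d. \<not> word_gcd k w dvd a w}"
  assume "\<not> word_gcd k w dvd a w"
  then have ne: "?B \<noteq> {}" using assms by auto
  have fin: "finite ?B" using finite_lyndon_words by simp
  define m where "m = Min ?B"
  have m: "m \<in> ?B" unfolding m_def by (rule Min_in[OF fin ne])
  have less: "word_gcd k v dvd a v" if "v \<in> lyndon_words n d" "v < m" for v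
  proof (rule ccontr)
    assume "\<not> word_gcd k v dvd a v"
    then have "m \<le> v" unfolding m_def using that by (intro Min_le[OF fin]) simp
    then show False using that by simp
  qed
  have "word_gcd k m dvd a v * lyndon_polynomial v m" if v: "v \<in> lyndon_words n d - {m}" for v
  proof (cases "lyndon_polynomial v m = 0")
    case False
    have lv: "lyndon v" using v by (simp add: lyndon_words_def)
    have "v \<le> m" using lyndon_polynomial_leading[OF lv] False by blast
    then have "word_gcd k v dvd a v" using less v by auto
    moreover have "set v = set m"
      using lyndon_polynomial_supp[OF lv False] by (metis set_mset_mset)
    ultimately show ?thesis by (simp add: word_gcd_def)
  qed simp
  then have "word_gcd k m dvd (\<Sum>v\<in>lyndon_words n d - {m}. a v * lyndon_polynomial v m)"
    by (rule dvd_sum)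
  moreover have "(\<Sum>w\<in>lyndon_words n d. a w * lyndon_polynomial w m)
      = a m + (\<Sum>v\<in>lyndon_words n d - {m}. a v * lyndon_polynomial v m)"
    using m finite_lyndon_words lyndon_polynomial_leading[of m]
    by (subst sum.remove[of _ m]) (auto simp: lyndon_words_def)
  ultimately have "word_gcd k m dvd a m"
    using sum[of m] m by (metis (no_types, lifting) dvd_add_left_iff mem_Collect_eq)
  then show False using m by simp
qed

text \<open>The conditions on \<open>\<phi>\<close> say that linear coefficients modulo the orders
  are the coordinates in the quotient by \<open>N\<close>: they vanish on \<open>N\<close>, and
  \<open>x j\<close> has the \<open>j\<close>-th unit vector.\<close>

locale magnus_quotient = generated_quotient +
  fixes k :: "nat \<Rightarrow> nat" and \<phi> :: "'a \<Rightarrow> nat list \<Rightarrow> int"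
  assumes magnus_hom: "\<phi> \<in> hom G magnus_group"
    and magnus_N: "n \<in> N \<Longrightarrow> \<phi> n \<in> magnus_filtration k 2"
    and magnus_x: "j < d \<Longrightarrow> int (k i) dvd \<phi> (x j) [i] - (if i = j then 1 else 0)"
    and x_pow: "j < d \<Longrightarrow> x j [^] k j \<in> N"
begin

lemma magnus_closed: "g \<in> carrier G \<Longrightarrow> \<phi> g [] = 1"
  using magnus_hom by (auto simp: hom_def Pi_iff)

lemma magnus_mult: "g \<in> carrier G \<Longrightarrow> h \<in> carrier G \<Longrightarrow> \<phi> (g \<otimes> h) = conv (\<phi> g) (\<phi> h)"
  using magnus_hom by (auto simp: hom_def)

lemma magnus_commutator:
  "g \<in> carrier G \<Longrightarrow> h \<in> carrier G \<Longrightarrow>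
    \<phi> (group_commutator G g h) = group_commutator magnus_group (\<phi> g) (\<phi> h)"
  by (rule hom_commutator[OF is_group group_magnus_group magnus_hom])

lemma subgroup_magnus_vimage: "subgroup {g \<in> carrier G. \<phi> g \<in> magnus_filtration k j} G"
proof -
  interpret h: group_hom G magnus_group \<phi>
    by (simp add: group_hom_def group_hom_axioms_def magnus_hom group_magnus_group)
  interpret s: subgroup "magnus_filtration k j" magnus_group by (rule subgroup_magnus_filtration)
  show ?thesis
    by (rule subgroupI)
       (use s.one_closed s.m_closed s.m_inv_closed in \<open>auto simp: magnus_mult h.hom_one[simplified] intro!: exI[of _ \<one>]\<close>)
qed

lemma magnus_carrier: "g \<in> carrier G \<Longrightarrow> \<phi> g \<in> magnus_filtration k 1"
  by (auto simp: magnus_filtration_def magnus_closed)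

lemma magnus_iterated_commutator:
  assumes "\<And>g. g \<in> B \<Longrightarrow> g \<in> carrier G \<and> \<phi> g \<in> magnus_filtration k i" "i > 0"
    and "g \<in> iterated_commutator G (carrier G) B n"
  shows "g \<in> carrier G \<and> \<phi> g \<in> magnus_filtration k (i + n)"
  using assms(3)
proof (induction n arbitrary: g)
  case (Suc n)
  have "iterated_commutator G (carrier G) B (Suc n) \<subseteq> {g \<in> carrier G. \<phi> g \<in> magnus_filtration k (i + Suc n)}"
    unfolding iterated_commutator_Suc
  proof (rule commutator_subgroup_least[OF subgroup_magnus_vimage])
    fix a b assume "a \<in> iterated_commutator G (carrier G) B n" "b \<in> carrier G"
    then have "a \<in> carrier G" "\<phi> a \<in> magnus_filtration k (i + n)" "b \<in> carrier G" using Suc.IH by auto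
    then show "group_commutator G a b \<in> {g \<in> carrier G. \<phi> g \<in> magnus_filtration k (i + Suc n)}"
      using magnus_commutator_filtration[of "\<phi> a" k "i + n" "\<phi> b" 1] magnus_carrier[of b] assms(2)
      by (simp add: magnus_commutator)
  qed
  then show ?case using Suc.prems by blast
qed (use assms in auto)

lemma magnus_lcs: "g \<in> lcs n \<Longrightarrow> \<phi> g \<in> magnus_filtration k (Suc n)"
  using magnus_iterated_commutator[of "carrier G" 1 g n] magnus_carrier by simp

text \<open>Elements of \<open>N\<close> start in degree 2, so \<open>itc n\<close> is one degree
  deeper than \<open>lcs n\<close>. Hence the coefficients at words of length \<open>n + 1\<close>,
  modulo their gcds, are functions on \<open>lcs n / itc n\<close>.\<close>

lemma magnus_itc: "g \<in> itc n \<Longrightarrow> \<phi> g \<in> magnus_filtration k (n + 2)"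
  using magnus_iterated_commutator[of N 2 g n] magnus_N mem_carrier by (simp add: numeral_2_eq_2)

text \<open>The recursion for leading parts of commutators is the recursion that defines the Lie
  polynomial, and the letters agree modulo their orders.\<close>

lemma magnus_bracket:
  assumes "lyndon w" "set w \<subseteq> {..<d}" "length y = length w"
  shows "word_gcd k y dvd \<phi> (bracket w) y - lyndon_polynomial w y"
  using assms
proof (induction arbitrary: y rule: lyndon_induct)
  case (singleton a)
  then obtain i where "y = [i]" by (auto simp: length_Suc_conv)
  then show ?case using magnus_x[of a i] singleton by (simp add: word_gcd_def)
next
  case (split w)
  let ?l = "lyndon_left w" and ?r = "lyndon_right w"
  have sets: "set ?l \<subseteq> {..<d}" "set ?r \<subseteq> {..<d}"
    using split.prems set_lyndon_left_right[OF split(2)] by auto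
  note mem = bracket_mem[OF split(3) sets(1)] bracket_mem[OF split(4) sets(2)]
  have pos: "length ?l > 0" "length ?r > 0" using split(3,4) length_lyndon by auto
  have len: "length w = length ?l + length ?r" using length_lyndon_left_right[OF split(2)] by simp
  define f g where "f = \<phi> (bracket ?l)" and "g = \<phi> (bracket ?r)"
  have fg: "f \<in> magnus_filtration k (length ?l)" "g \<in> magnus_filtration k (length ?r)"
    using mem[THEN magnus_lcs] pos by (simp_all add: f_def g_def)
  have y: "y \<noteq> []" "length y = length ?l + length ?r" using split.prems len pos by auto
  have 1: "word_gcd k y dvd \<phi> (bracket w) y - (f (take (length ?l) y) * g (drop (length ?l) y)
      - g (take (length ?r) y) * f (drop (length ?r) y))"
    using magnus_commutator_cong[OF fg pos y(1)] y mem[THEN lcs_carrier]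
    by (simp add: lyndon_bracket_split[OF split(2)] magnus_commutator f_def g_def)
  have prod: "m dvd a * b - a' * b'" if "m dvd a - a'" "m dvd b - b'" for m a b a' b' :: int
  proof -
    have "a * b - a' * b' = (a - a') * b + a' * (b - b')" by (simp add: algebra_simps)
    with that show ?thesis by simp
  qed
  have diff: "m dvd (s - t) - (s' - t')" if "m dvd s - s'" "m dvd t - t'" for m s t s' t' :: int
    using dvd_diff[OF that] by (simp add: algebra_simps)
  have trans: "m dvd r - t" if "m dvd r - s" "m dvd s - t" for m r s t :: int
    using dvd_add[OF that] by simp
  have IH: "word_gcd k y dvd f (take (length ?l) y) - lyndon_polynomial ?l (take (length ?l) y)"
    "word_gcd k y dvd g (drop (length ?l) y) - lyndon_polynomial ?r (drop (length ?l) y)"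
    "word_gcd k y dvd g (take (length ?r) y) - lyndon_polynomial ?r (take (length ?r) y)"
    "word_gcd k y dvd f (drop (length ?r) y) - lyndon_polynomial ?l (drop (length ?r) y)"
    unfolding f_def g_def
    by (rule dvd_trans[OF word_gcd_dvd_take split.IH(1)] dvd_trans[OF word_gcd_dvd_drop split.IH(2)]
      dvd_trans[OF word_gcd_dvd_take split.IH(2)] dvd_trans[OF word_gcd_dvd_drop split.IH(1)];
      use y sets in simp)+
  have P: "lyndon_polynomial w y = lyndon_polynomial ?l (take (length ?l) y) * lyndon_polynomial ?r (drop (length ?l) y)
      - lyndon_polynomial ?r (take (length ?r) y) * lyndon_polynomial ?l (drop (length ?r) y)"
    using y by (simp add: lyndon_bracket_split[OF split(2)] conv_lyndon_polynomial split(3,4))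
  have "word_gcd k y dvd (f (take (length ?l) y) * g (drop (length ?l) y)
      - g (take (length ?r) y) * f (drop (length ?r) y)) - lyndon_polynomial w y"
    unfolding P by (rule diff[OF prod[OF IH(1,2)] prod[OF IH(3,4)]])
  then show ?case by (rule trans[OF 1])
qed

end

section \<open>Products of cyclic groups\<close>

text \<open>As \<open>integer_mod_group 0\<close> is the group of integers, exponent 0 yields an
  infinite cyclic factor.\<close>

abbreviation cyclic_product :: "nat \<Rightarrow> (nat \<Rightarrow> nat) \<Rightarrow> (nat \<Rightarrow> int) monoid" where
  "cyclic_product d k \<equiv> product_group {..<d} (\<lambda>j. integer_mod_group (k j))"

lemma group_cyclic_product: "group (cyclic_product d k)"
  by simp

lemma integer_mod_group_mem_iff: "a \<in> carrier (integer_mod_group n) \<longleftrightarrow> a mod int n = a"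
proof (cases "n = 0")
  case False
  then have "0 \<le> a mod int n" "a mod int n < int n" by simp_all
  moreover have "a mod int n = a" if "0 \<le> a" "a < int n" using that by simp
  ultimately show ?thesis using False unfolding carrier_integer_mod_group by fastforce
qed (simp add: carrier_integer_mod_group)

lemma (in group) int_pow_cong:
  assumes "a \<in> carrier G" "a [^] (n :: nat) = \<one>" "int n dvd i - j"
  shows "a [^] i = a [^] j"
proof -
  obtain q where "i = int n * q + j" using assms(3) by (metis diff_eq_eq dvdE)
  then show ?thesis
    using assms by (simp add: int_pow_mult int_pow_pow[symmetric] int_pow_int int_pow_one)
qed

lemma (in comm_group) cyclic_product_iso:
  fixes k :: "nat \<Rightarrow> nat"
  assumes g: "\<And>j. j < d \<Longrightarrow> g j \<in> carrier G"
    and gen: "carrier G \<subseteq> generate G (g ` {..<d})"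
    and pow: "\<And>j. j < d \<Longrightarrow> g j [^] k j = \<one>"
    and indep: "\<And>(a :: nat \<Rightarrow> int) j. (\<Otimes>j\<in>{..<d}. g j [^] a j) = \<one> \<Longrightarrow> j < d \<Longrightarrow> int (k j) dvd a j"
  shows "cyclic_product d k \<cong> G"
proof -
  define h where "h = (\<lambda>v :: nat \<Rightarrow> int. \<Otimes>j\<in>{..<d}. g j [^] v j)"
  have closed: "h v \<in> carrier G" for v
    unfolding h_def by (rule finprod_closed) (use g in auto)
  have hom: "h \<in> hom (cyclic_product d k) G"
  proof (rule homI)
    fix v w
    have "h (v \<otimes>\<^bsub>cyclic_product d k\<^esub> w) = (\<Otimes>j\<in>{..<d}. g j [^] v j \<otimes> g j [^] w j)"
      unfolding h_def
    proof (rule finprod_cong)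
      have "g j [^] ((v j + w j) mod int (k j)) = g j [^] v j \<otimes> g j [^] w j" if "j < d" for j
        using int_pow_cong[OF g pow, of j "(v j + w j) mod int (k j)" "v j + w j"] that g
        by (simp add: int_pow_mult mod_eq_dvd_iff[symmetric])
      then show "\<And>j. j \<in> {..<d} =simp=> g j [^] (v \<otimes>\<^bsub>cyclic_product d k\<^esub> w) j = g j [^] v j \<otimes> g j [^] w j"
        by (simp add: simp_implies_def)
    qed (use g in auto)
    also have "\<dots> = h v \<otimes> h w"
      unfolding h_def by (rule finprod_multf) (use g in auto)
    finally show "h (v \<otimes>\<^bsub>cyclic_product d k\<^esub> w) = h v \<otimes> h w" .
  qed (rule closed)
  interpret h: group_hom "cyclic_product d k" G h
    by (simp add: group_hom_def group_hom_axioms_def hom)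
  have "g ` {..<d} \<subseteq> h ` carrier (cyclic_product d k)"
  proof clarify
    fix i assume i: "i < d"
    define e where "e = (\<lambda>j\<in>{..<d}. if j = i then 1 mod int (k j) else 0)"
    have "h e = (\<Otimes>j\<in>{..<d}. if j = i then g j else \<one>)"
      unfolding h_def
    proof (rule finprod_cong)
      have "g i [^] (1 mod int (k i)) = g i [^] (1 :: int)"
        by (rule int_pow_cong[OF g[OF i] pow[OF i]]) (simp add: mod_eq_dvd_iff[symmetric])
      then show "\<And>j. j \<in> {..<d} =simp=> g j [^] e j = (if j = i then g j else \<one>)"
        using i g by (auto simp: e_def simp_implies_def int_pow_1)
    qed (use g in auto)
    also have "\<dots> = g i" using i g by (intro finprod_singleton_swap) auto
    finally have "g i = h e" by simp
    moreover have "e \<in> carrier (cyclic_product d k)"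
      by (auto simp: e_def integer_mod_group_mem_iff)
    ultimately show "g i \<in> h ` carrier (cyclic_product d k)" by blast
  qed
  then have "carrier G \<subseteq> h ` carrier (cyclic_product d k)"
    using gen generate_subgroup_incl[OF _ h.img_is_subgroup] by blast
  moreover have "v = \<one>\<^bsub>cyclic_product d k\<^esub>" if v: "v \<in> carrier (cyclic_product d k)" "h v = \<one>" for v
  proof
    fix j
    show "v j = \<one>\<^bsub>cyclic_product d k\<^esub> j"
    proof (cases "j < d")
      case True
      then have "int (k j) dvd v j" using indep v by (simp add: h_def)
      moreover have "v j mod int (k j) = v j" using v True by (auto simp: PiE_iff integer_mod_group_mem_iff)
      ultimately show ?thesis using True by simp
    qed (use v in \<open>auto simp: PiE_iff extensional_def\<close>)
  qed
  ultimately have "h \<in> iso (cyclic_product d k) G"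
    unfolding h.iso_iff by blast
  then show ?thesis by (rule is_isoI)
qed

context magnus_quotient
begin

text \<open>Brackets generate by \<open>lcs_eq_bracket_span\<close>, and their orders divide the
  gcds by \<open>bracket_pow_Gcd_mem\<close>. A relation among them becomes, coefficient by
  coefficient, a relation among Lie polynomials modulo gcds, to which
  \<open>lyndon_polynomial_independent\<close> applies.\<close>

lemma cyclic_product_iso_lcs_quotient:
  assumes b: "bij_betw b {..<D} (lyndon_words (Suc n) d)"
  shows "cyclic_product D (\<lambda>j. Gcd (k ` set (b j))) \<cong> (G\<lparr>carrier := lcs n\<rparr> Mod itc n)"
proof -
  let ?A = "G\<lparr>carrier := lcs n\<rparr>"
  let ?Q = "?A Mod itc n"
  have lcs_sub: "subgroup (lcs n) G" by (rule normal_imp_subgroup[OF normal_lcs])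
  interpret L: subgroup "lcs n" G by (rule lcs_sub)
  interpret A: group ?A by (rule subgroup_imp_group[OF lcs_sub])
  interpret N: normal "itc n" ?A
    by (rule normal_restrict_supergroup[OF lcs_sub normal_itc itc_subset_lcs])
  interpret M: normal "itc n" G by (rule normal_itc)
  interpret Q: group ?Q by (rule N.factorgroup_is_group)
  have pi: "(#>\<^bsub>?A\<^esub>) (itc n) \<in> hom ?A ?Q" by (rule N.r_coset_hom_Mod)
  interpret p: group_hom ?A ?Q "(#>\<^bsub>?A\<^esub>) (itc n)"
    by (simp add: group_hom_def group_hom_axioms_def pi)
  interpret Q: comm_group ?Q
  proof (rule Q.group_comm_groupI)
    fix u v assume "u \<in> carrier ?Q" "v \<in> carrier ?Q"
    then obtain a c where ac: "a \<in> lcs n" "c \<in> lcs n" "u = itc n #>\<^bsub>?A\<^esub> a" "v = itc n #>\<^bsub>?A\<^esub> c"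
      by (auto simp: carrier_FactGroup)
    have "group_commutator G a c \<in> lcs (n + n + 1)" by (rule commutator_lcs_lcs[OF ac(1,2)])
    then have mem: "group_commutator G a c \<in> itc n"
      using lcs_antimono[of "Suc n" "n + n + 1"] lcs_Suc_subset_itc[of n] by auto
    note aG = lcs_carrier[OF ac(1)] and cG = lcs_carrier[OF ac(2)]
    have "a \<otimes> c = group_commutator G a c \<otimes> (c \<otimes> a)"
      using commutator_mult_commute[OF aG cG] aG cG by (simp add: m_assoc)
    moreover have "itc n #> (group_commutator G a c \<otimes> (c \<otimes> a)) = itc n #> (c \<otimes> a)"
    proof -
      have carr: "group_commutator G a c \<in> carrier G" "c \<otimes> a \<in> carrier G"
        using aG cG by simp_all
      show ?thesis
        using coset_mult_assoc[OF M.subset carr] coset_join2[OF carr(1) M.subgroup_axioms mem] by simp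
    qed
    ultimately have "itc n #> (a \<otimes> c) = itc n #> (c \<otimes> a)" by simp
    then show "u \<otimes>\<^bsub>?Q\<^esub> v = v \<otimes>\<^bsub>?Q\<^esub> u"
      using p.hom_mult[of a c] p.hom_mult[of c a] ac by simp
  qed
  define g where "g = (\<lambda>j. itc n #>\<^bsub>?A\<^esub> bracket (b j))"
  have bw: "b j \<in> lyndon_words (Suc n) d" if "j < D" for j
    using b that by (auto simp: bij_betw_def)
  then have bm: "bracket (b j) \<in> lcs n" if "j < D" for j using bracket_mem' that by blast
  have g: "g j \<in> carrier ?Q" if "j < D" for j
    using p.hom_closed[of "bracket (b j)"] bm[OF that] by (simp add: g_def)
  show ?thesis
  proof (rule Q.cyclic_product_iso[OF g])
    have gs: "g ` {..<D} \<subseteq> carrier ?Q" using g by auto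
    interpret GS: subgroup "generate ?Q (g ` {..<D})" ?Q by (rule Q.generate_is_subgroup[OF gs])
    let ?S = "{a \<in> lcs n. itc n #>\<^bsub>?A\<^esub> a \<in> generate ?Q (g ` {..<D})}"
    have S1: "subgroup ?S ?A"
    proof (rule A.subgroupI)
      show "?S \<noteq> {}" using p.hom_one GS.one_closed L.one_closed by (auto intro!: exI[of _ \<one>])
      fix a assume "a \<in> ?S"
      then show "inv\<^bsub>?A\<^esub> a \<in> ?S" using GS.m_inv_closed[of "itc n #>\<^bsub>?A\<^esub> a"] p.hom_inv[of a] A.inv_closed[of a] by auto
    next
      fix a c assume "a \<in> ?S" "c \<in> ?S"
      then show "a \<otimes>\<^bsub>?A\<^esub> c \<in> ?S"
        using GS.m_closed[of "itc n #>\<^bsub>?A\<^esub> a" "itc n #>\<^bsub>?A\<^esub> c"] p.hom_mult[of a c] A.m_closed[of a c] by auto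
    qed auto
    have S2: "bracket ` {w \<in> lyndon_words (Suc n) d. [] \<le> w} \<union> itc n \<subseteq> ?S"
    proof
      fix a assume "a \<in> bracket ` {w \<in> lyndon_words (Suc n) d. [] \<le> w} \<union> itc n"
      then consider w where "w \<in> lyndon_words (Suc n) d" "a = bracket w" | "a \<in> itc n" by auto
      then show "a \<in> ?S"
      proof cases
        case 1
        then obtain j where "j < D" "w = b j" using b by (auto simp: bij_betw_def)
        then show ?thesis using 1 bm g_def by (auto intro!: generate.incl)
      next
        case 2
        then have "a \<in> carrier ?A" using itc_subset_lcs[of n] by auto
        then have "itc n #>\<^bsub>?A\<^esub> a = \<one>\<^bsub>?Q\<^esub>" using N.coset_eq_one_iff[of a] 2 by simp
        then show ?thesis using 2 GS.one_closed itc_subset_lcs by auto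
      qed
    qed
    have S3: "lcs n = generate G (bracket ` {w \<in> lyndon_words (Suc n) d. [] \<le> w} \<union> itc n)"
      using lcs_eq_bracket_span[of n] by (simp only: bracket_span_def)
    have S4: "generate G (bracket ` {w \<in> lyndon_words (Suc n) d. [] \<le> w} \<union> itc n)
        = generate ?A (bracket ` {w \<in> lyndon_words (Suc n) d. [] \<le> w} \<union> itc n)"
      by (rule generate_consistent[symmetric]) (use lcs_sub bracket_mem' itc_subset_lcs in auto)
    have "lcs n \<subseteq> ?S"
      by (rule subset_trans[OF equalityD1[OF trans[OF S3 S4]] A.generate_subgroup_incl[OF S2 S1]])
    then show "carrier ?Q \<subseteq> generate ?Q (g ` {..<D})" by (auto simp: carrier_FactGroup)
  next
    fix j assume j: "j < D"
    let ?o = "Gcd (k ` set (b j))"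
    have mem: "bracket (b j) [^] ?o \<in> itc n"
      using bracket_pow_Gcd_mem[of "b j" k] x_pow bw[OF j] by (auto simp: lyndon_words_def)
    have "g j [^]\<^bsub>?Q\<^esub> ?o = itc n #>\<^bsub>?A\<^esub> (bracket (b j) [^] ?o)"
      using p.hom_nat_pow[of "bracket (b j)" ?o] bm[OF j]
      by (simp add: g_def nat_pow_consistent[symmetric])
    moreover have "bracket (b j) [^] ?o \<in> carrier ?A" using mem itc_subset_lcs[of n] by auto
    ultimately show "g j [^]\<^bsub>?Q\<^esub> ?o = \<one>\<^bsub>?Q\<^esub>"
      using N.coset_eq_one_iff mem by simp
  next
    fix a :: "nat \<Rightarrow> int" and j
    assume one: "(\<Otimes>\<^bsub>?Q\<^esub>j\<in>{..<D}. g j [^]\<^bsub>?Q\<^esub> a j) = \<one>\<^bsub>?Q\<^esub>" and j: "j < D"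
    define a' where "a' = a \<circ> inv_into {..<D} b"
    have a': "a' (b j) = a j" if "j < D" for j
      using b that by (simp add: a'_def bij_betw_def)
    have "word_gcd k (b j) dvd a' (b j)"
    proof (rule lyndon_polynomial_independent[OF _ bw[OF j]])
      fix y assume y: "y \<in> lyndon_words (Suc n) d"
      let ?Z = "integer_mod_group (Gcd (k ` set y))"
      have m: "int (Gcd (k ` set y)) = word_gcd k y" by (simp add: word_gcd_def)
      have ylen: "y \<noteq> []" "length y = Suc n" using y by (auto simp: lyndon_words_def)
      \<comment> \<open>The coefficient at \<open>y\<close> is additive on \<open>lcs n\<close>
        modulo the gcd and zero on \<open>itc n\<close>; it descends to a homomorphism
        \<open>\<psi>\<close> from the quotient, which is then applied to the given
        relation.\<close>
      define \<kappa> where "\<kappa> = (\<lambda>c. \<phi> c y mod word_gcd k y)"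
      have "\<kappa> \<in> hom ?A ?Z"
      proof (rule homI)
        fix c assume "c \<in> carrier ?A"
        then show "\<kappa> c \<in> carrier ?Z" by (simp add: \<kappa>_def integer_mod_group_mem_iff m)
      next
        fix c c' assume c: "c \<in> carrier ?A" "c' \<in> carrier ?A"
        then have "word_gcd k y dvd conv (\<phi> c) (\<phi> c') y - (\<phi> c y + \<phi> c' y)"
          using ylen magnus_lcs by (intro conv_filtration_cong) auto
        then show "\<kappa> (c \<otimes>\<^bsub>?A\<^esub> c') = \<kappa> c \<otimes>\<^bsub>?Z\<^esub> \<kappa> c'"
          using c lcs_carrier by (simp add: \<kappa>_def m magnus_mult mod_eq_dvd_iff mod_add_eq)
      qed
      then interpret \<kappa>: group_hom ?A ?Z \<kappa>
        by (simp add: group_hom_def group_hom_axioms_def)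
      have \<kappa>_itc: "\<kappa> c = 0" if "c \<in> itc n" for c
        using magnus_filtrationD(2)[OF magnus_itc[OF that], of y] ylen by (simp add: \<kappa>_def)
      obtain \<psi> where \<psi>: "\<psi> \<in> hom ?Q ?Z" "\<And>c. c \<in> carrier ?A \<Longrightarrow> \<psi> (itc n #>\<^bsub>?A\<^esub> c) = \<kappa> c"
      proof (rule FactGroup_universal[OF \<kappa>.homh N.normal_axioms])
        fix c c' assume c: "c \<in> carrier ?A" "c' \<in> carrier ?A" "itc n #>\<^bsub>?A\<^esub> c = itc n #>\<^bsub>?A\<^esub> c'"
        then have "c \<in> itc n #>\<^bsub>?A\<^esub> c'" using A.rcos_self[OF c(1) N.subgroup_axioms] by simp
        then obtain t where t: "t \<in> itc n" "c = t \<otimes>\<^bsub>?A\<^esub> c'" by (auto simp: r_coset_def)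
        moreover have "t \<in> lcs n" using t(1) itc_subset_lcs[of n] by auto
        ultimately have "\<kappa> c = \<kappa> t \<otimes>\<^bsub>?Z\<^esub> \<kappa> c'" using c \<kappa>.hom_mult[of t c'] by simp
        then show "\<kappa> c = \<kappa> c'" using \<kappa>_itc[OF t(1)] by (simp add: \<kappa>_def m)
      qed blast
      interpret \<psi>: group_hom ?Q ?Z \<psi>
        by (simp add: group_hom_def group_hom_axioms_def \<psi>(1))
      have \<psi>g: "\<psi> (g j) = lyndon_polynomial (b j) y mod word_gcd k y" if "j < D" for j
        using \<psi>(2)[of "bracket (b j)"] magnus_bracket[of "b j" y] bm[OF that] bw[OF that] ylen
        by (auto simp: g_def \<kappa>_def mod_eq_dvd_iff lyndon_words_def)
      have "\<psi> (\<Otimes>\<^bsub>?Q\<^esub>j\<in>S. g j [^]\<^bsub>?Q\<^esub> a j) = (\<Sum>j\<in>S. a j * lyndon_polynomial (b j) y) mod word_gcd k y"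
        if "finite S" "S \<subseteq> {..<D}" for S
        using that
      proof (induction S rule: finite_induct)
        case empty
        then show ?case using \<psi>.hom_one by simp
      next
        case (insert i S)
        then have i: "i < D" by simp
        have "\<psi> (\<Otimes>\<^bsub>?Q\<^esub>j\<in>insert i S. g j [^]\<^bsub>?Q\<^esub> a j)
            = \<psi> (g i [^]\<^bsub>?Q\<^esub> a i \<otimes>\<^bsub>?Q\<^esub> (\<Otimes>\<^bsub>?Q\<^esub>j\<in>S. g j [^]\<^bsub>?Q\<^esub> a j))"
          using insert g by (subst Q.finprod_insert) (auto simp del: mult_FactGroup)
        also have "\<dots> = \<psi> (g i [^]\<^bsub>?Q\<^esub> a i) \<otimes>\<^bsub>?Z\<^esub> \<psi> (\<Otimes>\<^bsub>?Q\<^esub>j\<in>S. g j [^]\<^bsub>?Q\<^esub> a j)"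
          by (rule \<psi>.hom_mult) (use insert g in \<open>auto intro!: Q.finprod_closed Q.int_pow_closed\<close>)
        also have "\<psi> (g i [^]\<^bsub>?Q\<^esub> a i) = a i * lyndon_polynomial (b i) y mod word_gcd k y"
          using \<psi>.hom_int_pow[OF g[OF i], of "a i"] \<psi>g[OF i]
          by (simp add: int_pow_integer_mod_group m mod_mult_right_eq)
        finally show ?case using insert by (simp add: m mod_add_eq)
      qed
      from this[of "{..<D}"] have "(\<Sum>j<D. a j * lyndon_polynomial (b j) y) mod word_gcd k y = 0"
        using one \<psi>.hom_one by simp
      moreover have "(\<Sum>j<D. a j * lyndon_polynomial (b j) y)
          = (\<Sum>w\<in>lyndon_words (Suc n) d. a' w * lyndon_polynomial w y)"
        using sum.reindex_bij_betw[OF b, of "\<lambda>w. a' w * lyndon_polynomial w y"] by (simp add: a')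
      ultimately show "word_gcd k y dvd (\<Sum>w\<in>lyndon_words (Suc n) d. a' w * lyndon_polynomial w y)"
        by (simp add: dvd_eq_mod_eq_0)
    qed
    then show "int (Gcd (k ` set (b j))) dvd a j"
      using a'[OF j] by (simp add: word_gcd_def)
  qed
qed

end

section \<open>Homomorphisms from subgroups of free groups\<close>

definition word_inv :: "'x gword \<Rightarrow> 'x gword" where
  "word_inv w = rev (map (\<lambda>(x, b). (x, \<not> b)) w)"

lemma letters_word_inv [simp]: "fst ` set (word_inv w) = fst ` set w"
  by (force simp: word_inv_def image_iff)

lemma (in group) word_value_closed:
  "(\<And>x. x \<in> fst ` set w \<Longrightarrow> f x \<in> carrier G) \<Longrightarrow> word_value G f w \<in> carrier G"
proof (induction w)
  case (Cons a w)
  then show ?case by (cases a) auto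
qed simp

lemma (in group) word_value_append:
  assumes "\<And>x. x \<in> fst ` set (u @ v) \<Longrightarrow> f x \<in> carrier G"
  shows "word_value G f (u @ v) = word_value G f u \<otimes> word_value G f v"
  using assms
proof (induction u)
  case Nil
  then show ?case by (simp add: word_value_closed)
next
  case (Cons a u)
  obtain x b where a: "a = (x, b)" by (cases a)
  have "f x \<in> carrier G" "word_value G f u \<in> carrier G" "word_value G f v \<in> carrier G"
    using Cons.prems a by (auto intro!: word_value_closed)
  moreover have "word_value G f (u @ v) = word_value G f u \<otimes> word_value G f v"
    using Cons by auto
  ultimately show ?case by (simp add: a m_assoc)
qed

lemma (in group) word_value_inv:
  assumes "\<And>x. x \<in> fst ` set w \<Longrightarrow> f x \<in> carrier G"
  shows "word_value G f (word_inv w) = inv (word_value G f w)"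
  using assms
proof (induction w)
  case (Cons a w)
  obtain x b where a: "a = (x, b)" by (cases a)
  have c: "f x \<in> carrier G" "word_value G f w \<in> carrier G"
    using Cons.prems a by (auto intro!: word_value_closed)
  have "word_value G f (word_inv (a # w)) = word_value G f (word_inv w @ [(x, \<not> b)])"
    by (simp add: word_inv_def a)
  also have "\<dots> = word_value G f (word_inv w) \<otimes> word_value G f [(x, \<not> b)]"
  proof (rule word_value_append)
    fix y assume "y \<in> fst ` set (word_inv w @ [(x, \<not> b)])"
    then have "y \<in> fst ` set (word_inv w) \<or> y = x" by auto
    then show "f y \<in> carrier G" using Cons.prems a unfolding letters_word_inv by auto
  qed
  also have "word_value G f (word_inv w) = inv (word_value G f w)"
    using Cons by auto
  finally show ?case using c by (simp add: a inv_mult_group)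
qed (simp add: word_inv_def)

lemma word_value_cong:
  "(\<And>x. x \<in> fst ` set w \<Longrightarrow> f x = g x) \<Longrightarrow> word_value G f w = word_value G g w"
  by (induction G f w rule: word_value.induct) auto

lemma (in group_hom) hom_word_value:
  "(\<And>x. x \<in> fst ` set w \<Longrightarrow> f x \<in> carrier G) \<Longrightarrow> h (word_value G f w) = word_value H (\<lambda>x. h (f x)) w"
proof (induction w)
  case (Cons a w)
  obtain x b where a: "a = (x, b)" by (cases a)
  have "f x \<in> carrier G" "word_value G f w \<in> carrier G"
    using Cons.prems a by (auto intro!: G.word_value_closed)
  then show ?case using Cons by (simp add: a)
qed simp

lemma (in group) generate_eq_word_values:
  assumes "A \<subseteq> carrier G"
  shows "generate G A = {word_value G (\<lambda>x. x) w | w. fst ` set w \<subseteq> A}"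
proof (intro equalityI subsetI)
  fix g assume "g \<in> generate G A"
  then show "g \<in> {word_value G (\<lambda>x. x) w | w. fst ` set w \<subseteq> A}"
  proof (induction rule: generate.induct)
    case one
    then show ?case by (auto intro!: exI[of _ "[]"])
  next
    case (incl h)
    then show ?case using assms by (auto intro!: exI[of _ "[(h, True)]"])
  next
    case (inv h)
    then show ?case using assms by (auto intro!: exI[of _ "[(h, False)]"])
  next
    case (eng g h)
    then obtain u v where uv: "fst ` set u \<subseteq> A" "g = word_value G (\<lambda>x. x) u"
      "fst ` set v \<subseteq> A" "h = word_value G (\<lambda>x. x) v" by auto
    then have "g \<otimes> h = word_value G (\<lambda>x. x) (u @ v)"
      using assms by (subst word_value_append) auto
    moreover have "fst ` set (u @ v) \<subseteq> A" using uv by auto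
    ultimately show ?case by blast
  qed
next
  fix g assume "g \<in> {word_value G (\<lambda>x. x) w | w. fst ` set w \<subseteq> A}"
  then obtain w where w: "fst ` set w \<subseteq> A" "g = word_value G (\<lambda>x. x) w" by auto
  have "word_value G (\<lambda>x. x) w \<in> generate G A"
    using w(1)
  proof (induction w)
    case (Cons a w)
    then show ?case by (cases a) (auto intro: generate.intros)
  qed (simp add: generate.one)
  then show "g \<in> generate G A" using w by simp
qed

text \<open>Cancelling a letter against its inverse preserves the value in every group. Doing so for
  two groups at once turns triviality of a word in a free group into triviality of its image
  elsewhere.\<close>

lemma reduced_word_exists:
  assumes "group F" "group E"
    and "\<And>x. x \<in> fst ` set w \<Longrightarrow> f x \<in> carrier F" "\<And>x. x \<in> fst ` set w \<Longrightarrow> g x \<in> carrier E"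
  shows "\<exists>w'. reduced w' \<and> fst ` set w' \<subseteq> fst ` set w \<and>
    word_value F f w' = word_value F f w \<and> word_value E g w' = word_value E g w"
  using assms(3,4)
proof (induction w)
  case Nil
  then show ?case by (intro exI[of _ "[]"]) (simp add: reduced_def)
next
  case (Cons a w)
  interpret F: group F by fact
  interpret E: group E by fact
  obtain x b where a: "a = (x, b)" by (cases a)
  obtain w' where w': "reduced w'" "fst ` set w' \<subseteq> fst ` set w"
    "word_value F f w' = word_value F f w" "word_value E g w' = word_value E g w"
    using Cons by auto
  show ?case
  proof (cases "\<exists>v. w' = (x, \<not> b) # v")
    case True
    then obtain v where v: "w' = (x, \<not> b) # v" by blast
    have letters: "fst ` set v \<subseteq> fst ` set (a # w)" "x \<in> fst ` set (a # w)" using w' v a by auto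
    have "word_value F f v \<in> carrier F" "word_value E g v \<in> carrier E" "f x \<in> carrier F" "g x \<in> carrier E"
      by (rule F.word_value_closed E.word_value_closed Cons.prems subsetD[OF letters(1)] letters(2);
          assumption?)+
    then have "word_value F f v = word_value F f (a # w)" "word_value E g v = word_value E g (a # w)"
      using w'(3,4)[symmetric] by (auto simp: v a F.inv_cancel_left F.inv_cancel_left' E.inv_cancel_left E.inv_cancel_left')
    moreover have "reduced v" using w'(1) v by (cases v) (auto simp: reduced_def)
    ultimately show ?thesis using letters by blast
  next
    case False
    then have "reduced (a # w')" using w'(1) a by (cases w') (auto simp: reduced_def)
    then show ?thesis using w' by (intro exI[of _ "a # w'"]) (auto simp: a)
  qed
qed

text \<open>An element is evaluated through an arbitrary word representing it. The choice is
  irrelevant: a word with trivial value in \<open>F\<close> reduces to the empty word, so its value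
  in \<open>E\<close> is trivial too.\<close>

lemma free_group_hom_exists:
  assumes free: "free_group_on F S" and "group E" and f: "f \<in> S \<rightarrow> carrier E"
  obtains \<phi> where "\<phi> \<in> hom F E" "\<And>s. s \<in> S \<Longrightarrow> \<phi> s = f s"
proof -
  interpret F: group F using free by (simp add: free_group_on_def)
  interpret E: group E by fact
  have S: "S \<subseteq> carrier F" and gen: "generate F S = carrier F"
    using free by (simp_all add: free_group_on_def)
  let ?v = "word_value F (\<lambda>x. x)" and ?e = "word_value E f"
  have Fc: "\<And>w x. fst ` set w \<subseteq> S \<Longrightarrow> x \<in> fst ` set w \<Longrightarrow> x \<in> carrier F"
    and Ec: "\<And>w x. fst ` set w \<subseteq> S \<Longrightarrow> x \<in> fst ` set w \<Longrightarrow> f x \<in> carrier E"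
    using S f by auto
  have one: "?e w = \<one>\<^bsub>E\<^esub>" if w: "fst ` set w \<subseteq> S" "?v w = \<one>\<^bsub>F\<^esub>" for w
  proof -
    obtain w' where w': "reduced w'" "fst ` set w' \<subseteq> fst ` set w" "?v w' = ?v w" "?e w' = ?e w"
      using reduced_word_exists[OF F.is_group E.is_group, of w "\<lambda>x. x" f] Fc[OF w(1)] Ec[OF w(1)] by blast
    have "w' = []"
      using free w' w unfolding free_group_on_def by (metis (no_types, lifting) subset_trans)
    then show ?thesis using w' by simp
  qed
  have uniq: "?e u = ?e w" if "fst ` set u \<subseteq> S" "fst ` set w \<subseteq> S" "?v u = ?v w" for u w
  proof -
    have letters: "fst ` set (u @ word_inv w) \<subseteq> S" using that letters_word_inv[of w] by (metis image_Un set_append Un_least)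
    have "?v (u @ word_inv w) = ?v u \<otimes>\<^bsub>F\<^esub> ?v (word_inv w)"
      by (rule F.word_value_append) (rule Fc[OF letters])
    also have "\<dots> = \<one>\<^bsub>F\<^esub>"
      using that(3) F.word_value_inv[of w "\<lambda>x. x", OF Fc[OF that(2)]]
        F.word_value_closed[of w "\<lambda>x. x", OF Fc[OF that(2)]] by simp
    finally have "?e (u @ word_inv w) = \<one>\<^bsub>E\<^esub>" by (rule one[OF letters])
    moreover have "?e (u @ word_inv w) = ?e u \<otimes>\<^bsub>E\<^esub> ?e (word_inv w)"
      by (rule E.word_value_append) (rule Ec[OF letters])
    ultimately show ?thesis
      using E.word_value_inv[of w f, OF Ec[OF that(2)]] E.word_value_closed[of w f, OF Ec[OF that(2)]]
        E.word_value_closed[of u f, OF Ec[OF that(1)]]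
      by (metis E.inv_closed E.inv_equality E.inv_inv)
  qed
  have ex: "\<exists>w. fst ` set w \<subseteq> S \<and> ?v w = g" if "g \<in> carrier F" for g
    using that F.generate_eq_word_values[OF S] gen by auto
  define \<phi> where "\<phi> = (\<lambda>g. ?e (SOME w. fst ` set w \<subseteq> S \<and> ?v w = g))"
  have \<phi>: "\<phi> (?v w) = ?e w" if "fst ` set w \<subseteq> S" for w
  proof -
    have "\<exists>u. fst ` set u \<subseteq> S \<and> ?v u = ?v w" using that by blast
    from someI_ex[OF this] show ?thesis unfolding \<phi>_def using uniq that by blast
  qed
  show thesis
  proof
    show "\<phi> \<in> hom F E"
    proof (rule homI)
      fix g assume "g \<in> carrier F"
      then obtain w where w: "fst ` set w \<subseteq> S" "?v w = g" using ex by blast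
      then show "\<phi> g \<in> carrier E" using \<phi>[OF w(1)] E.word_value_closed[OF Ec[OF w(1)]] by simp
    next
      fix g h assume "g \<in> carrier F" "h \<in> carrier F"
      then obtain u w where uw: "fst ` set u \<subseteq> S" "?v u = g" "fst ` set w \<subseteq> S" "?v w = h" using ex by metis
      then have letters: "fst ` set (u @ w) \<subseteq> S" by auto
      have "g \<otimes>\<^bsub>F\<^esub> h = ?v (u @ w)"
        using F.word_value_append[of u w "\<lambda>x. x", OF Fc[OF letters]] uw by simp
      then show "\<phi> (g \<otimes>\<^bsub>F\<^esub> h) = \<phi> g \<otimes>\<^bsub>E\<^esub> \<phi> h"
        using \<phi>[OF letters] \<phi>[OF uw(1)] \<phi>[OF uw(3)] uw E.word_value_append[of u w f, OF Ec[OF letters]] by simp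
    qed
    fix s assume s: "s \<in> S"
    then have "s \<in> carrier F" "f s \<in> carrier E" using S f by auto
    then have "?v [(s, True)] = s" "?e [(s, True)] = f s" by simp_all
    then show "\<phi> s = f s" using \<phi>[of "[(s, True)]"] s by simp
  qed
qed

text \<open>This replaces the theorem of Nielsen and Schreier.  The group \<open>W\<close> of the proof is a
  subgroup of the wreath product of \<open>E\<close> with the permutation group on the cosets of \<open>H\<close>: it
  lies over the cocycle \<open>T\<close> of \<open>F\<close> with values in \<open>H\<close>, \<open>F\<close> lifts to it by freeness, and the
  component at the trivial coset is a homomorphism on \<open>H\<close>.\<close>

lemma free_group_subgroup_lift:
  assumes free: "free_group_on F S" and H: "subgroup H F" and E: "group E" and Q: "group Q"
    and p: "p \<in> hom E Q" "carrier Q \<subseteq> p ` carrier E" and \<theta>: "\<theta> \<in> hom (F\<lparr>carrier := H\<rparr>) Q"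
  obtains \<phi> where "\<phi> \<in> hom (F\<lparr>carrier := H\<rparr>) E" "\<And>h. h \<in> H \<Longrightarrow> p (\<phi> h) = \<theta> h"
proof -
  interpret F: group F using free by (simp add: free_group_on_def)
  have S: "S \<subseteq> carrier F" and gen: "generate F S = carrier F"
    using free by (simp_all add: free_group_on_def)
  interpret H: subgroup H F by fact
  interpret E: group E by fact
  interpret Q: group Q by fact
  interpret p: group_hom E Q p by (simp add: group_hom_def group_hom_axioms_def p E Q)
  interpret HG: group "F\<lparr>carrier := H\<rparr>" by (rule F.subgroup_imp_group[OF H])
  interpret \<theta>: group_hom "F\<lparr>carrier := H\<rparr>" Q \<theta>
    by (simp add: group_hom_def group_hom_axioms_def \<theta> Q HG.is_group)
  \<comment> \<open>A transversal of the left cosets, normalized to the unit on \<open>H\<close> so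
    that \<open>T h \<one> = h\<close> holds for \<open>h\<close> in \<open>H\<close>.\<close>
  define \<tau> where "\<tau> = (\<lambda>x. if x \<in> H then \<one>\<^bsub>F\<^esub> else (SOME y. y \<in> x <#\<^bsub>F\<^esub> H))"
  have \<tau>_coset: "\<tau> x \<in> x <#\<^bsub>F\<^esub> H" if "x \<in> carrier F" for x
  proof (cases "x \<in> H")
    case True
    then have "x \<otimes>\<^bsub>F\<^esub> inv\<^bsub>F\<^esub> x \<in> x <#\<^bsub>F\<^esub> H" unfolding l_coset_def using H.m_inv_closed by blast
    then show ?thesis using True that by (simp add: \<tau>_def)
  next
    case False
    have "x \<otimes>\<^bsub>F\<^esub> \<one>\<^bsub>F\<^esub> \<in> x <#\<^bsub>F\<^esub> H" using H.one_closed unfolding l_coset_def by blast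
    then show ?thesis using False by (auto simp: \<tau>_def intro: someI)
  qed
  have \<tau>_closed: "\<tau> x \<in> carrier F" if "x \<in> carrier F" for x
    using \<tau>_coset[OF that] that by (auto simp: l_coset_def)
  have \<tau>_inv: "inv\<^bsub>F\<^esub> x \<otimes>\<^bsub>F\<^esub> \<tau> x \<in> H" if "x \<in> carrier F" for x
    using \<tau>_coset[OF that] that by (auto simp: l_coset_def F.inv_cancel_left)
  have \<tau>_mult: "\<tau> (x \<otimes>\<^bsub>F\<^esub> h) = \<tau> x" if "x \<in> carrier F" "h \<in> H" for x h
  proof -
    have "x \<otimes>\<^bsub>F\<^esub> h \<in> H \<longleftrightarrow> x \<in> H"
    proof
      assume "x \<otimes>\<^bsub>F\<^esub> h \<in> H"
      then have "x \<otimes>\<^bsub>F\<^esub> h \<otimes>\<^bsub>F\<^esub> inv\<^bsub>F\<^esub> h \<in> H" by (rule H.m_closed[OF _ H.m_inv_closed[OF that(2)]])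
      moreover have "x \<otimes>\<^bsub>F\<^esub> h \<otimes>\<^bsub>F\<^esub> inv\<^bsub>F\<^esub> h = x"
        using that(1) H.mem_carrier[OF that(2)] by (simp add: F.m_assoc)
      ultimately show "x \<in> H" by metis
    qed (use that in auto)
    moreover have "(x \<otimes>\<^bsub>F\<^esub> h) <#\<^bsub>F\<^esub> H = x <#\<^bsub>F\<^esub> H"
      using that F.l_repr_independence[of "x \<otimes>\<^bsub>F\<^esub> h" x H] H by (force simp: l_coset_def)
    ultimately show ?thesis by (simp add: \<tau>_def)
  qed
  \<comment> \<open>Left multiplication by \<open>g\<close> permutes the left cosets of
    \<open>H\<close>; \<open>T g x\<close> measures how far the transversal is from following
    it.\<close>
  define T where "T = (\<lambda>g x. inv\<^bsub>F\<^esub> (\<tau> (g \<otimes>\<^bsub>F\<^esub> x)) \<otimes>\<^bsub>F\<^esub> g \<otimes>\<^bsub>F\<^esub> \<tau> x)"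
  have T_mem: "T g x \<in> H" if "g \<in> carrier F" "x \<in> carrier F" for g x
  proof -
    have "T g x = inv\<^bsub>F\<^esub> (inv\<^bsub>F\<^esub> (g \<otimes>\<^bsub>F\<^esub> x) \<otimes>\<^bsub>F\<^esub> \<tau> (g \<otimes>\<^bsub>F\<^esub> x)) \<otimes>\<^bsub>F\<^esub> (inv\<^bsub>F\<^esub> x \<otimes>\<^bsub>F\<^esub> \<tau> x)"
      using that \<tau>_closed by (simp add: T_def F.group_normalize)
    then show ?thesis using that \<tau>_inv by (simp add: H.m_closed H.m_inv_closed)
  qed
  have T_mult: "T (g \<otimes>\<^bsub>F\<^esub> g') x = T g (g' \<otimes>\<^bsub>F\<^esub> x) \<otimes>\<^bsub>F\<^esub> T g' x"
    if "g \<in> carrier F" "g' \<in> carrier F" "x \<in> carrier F" for g g' x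
    using that \<tau>_closed by (simp add: T_def F.group_normalize)
  have T_one: "T \<one>\<^bsub>F\<^esub> x = \<one>\<^bsub>F\<^esub>" if "x \<in> carrier F" for x
    using that \<tau>_closed by (simp add: T_def)
  have T_inv: "T g (inv\<^bsub>F\<^esub> g \<otimes>\<^bsub>F\<^esub> x) \<otimes>\<^bsub>F\<^esub> T (inv\<^bsub>F\<^esub> g) x = \<one>\<^bsub>F\<^esub>"
    if "g \<in> carrier F" "x \<in> carrier F" for g x
    using T_mult[of g "inv\<^bsub>F\<^esub> g" x] T_one[of x] that by simp
  have T_H: "T g (x \<otimes>\<^bsub>F\<^esub> h) = T g x" if "g \<in> carrier F" "x \<in> carrier F" "h \<in> H" for g x h
    using that \<tau>_mult[of "g \<otimes>\<^bsub>F\<^esub> x" h] \<tau>_mult[of x h] by (simp add: T_def F.m_assoc)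
  have T_id: "T h \<one>\<^bsub>F\<^esub> = h" if "h \<in> H" for h
    using that by (simp add: T_def \<tau>_def)
  \<comment> \<open>Families indexed by cosets are encoded as functions on \<open>F\<close> that are
    constant on left cosets. The last condition says that they lie over the cocycle.\<close>
  define P where "P = (\<lambda>g (\<alpha> :: 'a \<Rightarrow> 'c). g \<in> carrier F \<and> \<alpha> \<in> carrier F \<rightarrow>\<^sub>E carrier E \<and>
    (\<forall>x\<in>carrier F. \<forall>h\<in>H. \<alpha> (x \<otimes>\<^bsub>F\<^esub> h) = \<alpha> x) \<and> (\<forall>x\<in>carrier F. p (\<alpha> x) = \<theta> (T g x)))"
  define W where "W = \<lparr>carrier = {(g, \<alpha>). P g \<alpha>},
    monoid.mult = (\<lambda>(g, \<alpha>) (g', \<beta>). (g \<otimes>\<^bsub>F\<^esub> g', \<lambda>x\<in>carrier F. \<alpha> (g' \<otimes>\<^bsub>F\<^esub> x) \<otimes>\<^bsub>E\<^esub> \<beta> x)),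
    one = (\<one>\<^bsub>F\<^esub>, \<lambda>x\<in>carrier F. \<one>\<^bsub>E\<^esub>)\<rparr>"
  have PE: "\<alpha> x \<in> carrier E" if "P g \<alpha>" "x \<in> carrier F" for g \<alpha> x
    using that by (auto simp: P_def)
  have W_mult: "(g, \<alpha>) \<otimes>\<^bsub>W\<^esub> (g', \<beta>) = (g \<otimes>\<^bsub>F\<^esub> g', \<lambda>x\<in>carrier F. \<alpha> (g' \<otimes>\<^bsub>F\<^esub> x) \<otimes>\<^bsub>E\<^esub> \<beta> x)" for g \<alpha> g' \<beta>
    by (simp add: W_def)
  have W_carrier: "(g, \<alpha>) \<in> carrier W \<longleftrightarrow> P g \<alpha>" for g \<alpha> by (simp add: W_def)
  have W_one: "\<one>\<^bsub>W\<^esub> = (\<one>\<^bsub>F\<^esub>, \<lambda>x\<in>carrier F. \<one>\<^bsub>E\<^esub>)" by (simp add: W_def)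
  have W: "group W"
  proof (rule groupI)
    fix a b assume "a \<in> carrier W" "b \<in> carrier W"
    then obtain g \<alpha> g' \<beta> where ab: "a = (g, \<alpha>)" "b = (g', \<beta>)" "P g \<alpha>" "P g' \<beta>"
      by (cases a; cases b) (auto simp: W_carrier)
    have "P (g \<otimes>\<^bsub>F\<^esub> g') (\<lambda>x\<in>carrier F. \<alpha> (g' \<otimes>\<^bsub>F\<^esub> x) \<otimes>\<^bsub>E\<^esub> \<beta> x)"
      unfolding P_def
    proof (intro conjI ballI)
      fix x h assume x: "x \<in> carrier F" "h \<in> H"
      then have "\<alpha> (g' \<otimes>\<^bsub>F\<^esub> (x \<otimes>\<^bsub>F\<^esub> h)) = \<alpha> (g' \<otimes>\<^bsub>F\<^esub> x)" "\<beta> (x \<otimes>\<^bsub>F\<^esub> h) = \<beta> x"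
        using ab by (auto simp: P_def F.m_assoc[symmetric])
      then show "(\<lambda>x\<in>carrier F. \<alpha> (g' \<otimes>\<^bsub>F\<^esub> x) \<otimes>\<^bsub>E\<^esub> \<beta> x) (x \<otimes>\<^bsub>F\<^esub> h)
          = (\<lambda>x\<in>carrier F. \<alpha> (g' \<otimes>\<^bsub>F\<^esub> x) \<otimes>\<^bsub>E\<^esub> \<beta> x) x"
        using x by simp
    next
      fix x assume x: "x \<in> carrier F"
      have gc: "g \<in> carrier F" "g' \<in> carrier F" using ab by (auto simp: P_def)
      have "p (\<alpha> (g' \<otimes>\<^bsub>F\<^esub> x) \<otimes>\<^bsub>E\<^esub> \<beta> x) = \<theta> (T g (g' \<otimes>\<^bsub>F\<^esub> x)) \<otimes>\<^bsub>Q\<^esub> \<theta> (T g' x)"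
        using ab x gc PE[OF ab(3)] PE[OF ab(4)] by (simp add: P_def)
      also have "\<dots> = \<theta> (T (g \<otimes>\<^bsub>F\<^esub> g') x)"
        using \<theta>.hom_mult[of "T g (g' \<otimes>\<^bsub>F\<^esub> x)" "T g' x"] T_mem x gc by (simp add: T_mult)
      finally show "p ((\<lambda>x\<in>carrier F. \<alpha> (g' \<otimes>\<^bsub>F\<^esub> x) \<otimes>\<^bsub>E\<^esub> \<beta> x) x) = \<theta> (T (g \<otimes>\<^bsub>F\<^esub> g') x)" using x by simp
    qed (use ab PE[OF ab(3)] PE[OF ab(4)] in \<open>auto simp: P_def\<close>)
    then show "a \<otimes>\<^bsub>W\<^esub> b \<in> carrier W" by (simp add: ab W_mult W_carrier)
  next
    show "\<one>\<^bsub>W\<^esub> \<in> carrier W"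
      using T_one \<theta>.hom_one by (auto simp: W_one W_carrier P_def)
  next
    fix a b c assume "a \<in> carrier W" "b \<in> carrier W" "c \<in> carrier W"
    then obtain g \<alpha> g' \<beta> g'' \<gamma> where abc: "a = (g, \<alpha>)" "b = (g', \<beta>)" "c = (g'', \<gamma>)" "P g \<alpha>" "P g' \<beta>" "P g'' \<gamma>"
      by (cases a; cases b; cases c) (auto simp: W_carrier)
    then have gc: "g \<in> carrier F" "g' \<in> carrier F" "g'' \<in> carrier F" by (auto simp: P_def)
    show "a \<otimes>\<^bsub>W\<^esub> b \<otimes>\<^bsub>W\<^esub> c = a \<otimes>\<^bsub>W\<^esub> (b \<otimes>\<^bsub>W\<^esub> c)"
      using gc PE[OF abc(4)] PE[OF abc(5)] PE[OF abc(6)]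
      by (auto simp: abc W_mult F.m_assoc E.m_assoc intro!: restrict_ext)
  next
    fix a assume "a \<in> carrier W"
    then obtain g \<alpha> where a: "a = (g, \<alpha>)" "P g \<alpha>" by (cases a) (auto simp: W_carrier)
    then have gc: "g \<in> carrier F" and ext: "\<alpha> \<in> extensional (carrier F)" by (auto simp: P_def PiE_def)
    show "\<one>\<^bsub>W\<^esub> \<otimes>\<^bsub>W\<^esub> a = a"
    proof -
      have "(\<lambda>x\<in>carrier F. \<one>\<^bsub>E\<^esub> \<otimes>\<^bsub>E\<^esub> \<alpha> x) = restrict \<alpha> (carrier F)"
        by (rule restrict_ext) (simp add: PE[OF a(2)])
      moreover have "(\<lambda>x\<in>carrier F. (\<lambda>x\<in>carrier F. \<one>\<^bsub>E\<^esub>) (g \<otimes>\<^bsub>F\<^esub> x) \<otimes>\<^bsub>E\<^esub> \<alpha> x)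
          = (\<lambda>x\<in>carrier F. \<one>\<^bsub>E\<^esub> \<otimes>\<^bsub>E\<^esub> \<alpha> x)"
        using gc by (intro restrict_ext) simp
      ultimately show ?thesis using gc ext by (simp add: a W_one W_mult extensional_restrict)
    qed
    let ?i = "inv\<^bsub>F\<^esub> g" and ?\<beta> = "\<lambda>x\<in>carrier F. inv\<^bsub>E\<^esub> (\<alpha> (inv\<^bsub>F\<^esub> g \<otimes>\<^bsub>F\<^esub> x))"
    have "P ?i ?\<beta>"
      unfolding P_def
    proof (intro conjI ballI)
      fix x h assume x: "x \<in> carrier F" "h \<in> H"
      then have "\<alpha> (?i \<otimes>\<^bsub>F\<^esub> (x \<otimes>\<^bsub>F\<^esub> h)) = \<alpha> (?i \<otimes>\<^bsub>F\<^esub> x)"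
        using a gc by (auto simp: P_def F.m_assoc[symmetric])
      then show "?\<beta> (x \<otimes>\<^bsub>F\<^esub> h) = ?\<beta> x" using x by simp
    next
      fix x assume x: "x \<in> carrier F"
      have "p (inv\<^bsub>E\<^esub> (\<alpha> (?i \<otimes>\<^bsub>F\<^esub> x))) = inv\<^bsub>Q\<^esub> (\<theta> (T g (?i \<otimes>\<^bsub>F\<^esub> x)))"
        using a gc x PE[OF a(2)] by (simp add: P_def)
      also have "\<dots> = \<theta> (T ?i x)"
      proof -
        have "\<theta> (T g (?i \<otimes>\<^bsub>F\<^esub> x)) \<otimes>\<^bsub>Q\<^esub> \<theta> (T ?i x) = \<one>\<^bsub>Q\<^esub>"
          using \<theta>.hom_mult[of "T g (?i \<otimes>\<^bsub>F\<^esub> x)" "T ?i x"] T_inv[OF gc x] T_mem gc x \<theta>.hom_one by simp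
        moreover have "\<theta> (T g (?i \<otimes>\<^bsub>F\<^esub> x)) \<in> carrier Q" "\<theta> (T ?i x) \<in> carrier Q"
          using T_mem gc x \<theta>.hom_closed by simp_all
        ultimately show ?thesis by (metis Q.inv_equality Q.inv_inv)
      qed
      finally show "p (?\<beta> x) = \<theta> (T ?i x)" using x by simp
    qed (use gc PE[OF a(2)] in auto)
    moreover have "(?i, ?\<beta>) \<otimes>\<^bsub>W\<^esub> a = \<one>\<^bsub>W\<^esub>"
      using gc PE[OF a(2)] by (auto simp: a W_mult W_one F.inv_cancel_left intro!: restrict_ext)
    ultimately show "\<exists>b\<in>carrier W. b \<otimes>\<^bsub>W\<^esub> a = \<one>\<^bsub>W\<^esub>"
      using W_carrier by blast
  qed
  \<comment> \<open>Arbitrary preimages under \<open>p\<close> are good enough, since a homomorphism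
    from a free group can be prescribed on the basis. They respect cosets because \<open>T s\<close>
    does.\<close>
  define l where "l = (\<lambda>q. SOME e. e \<in> carrier E \<and> p e = q)"
  have l: "l q \<in> carrier E" "p (l q) = q" if "q \<in> carrier Q" for q
  proof -
    have "\<exists>e. e \<in> carrier E \<and> p e = q" using p(2) that by auto
    from someI_ex[OF this] show "l q \<in> carrier E" "p (l q) = q" by (auto simp: l_def)
  qed
  have "(\<lambda>s. (s, \<lambda>x\<in>carrier F. l (\<theta> (T s x)))) \<in> S \<rightarrow> carrier W"
  proof
    fix s assume "s \<in> S"
    then have s: "s \<in> carrier F" using S by auto
    show "(s, \<lambda>x\<in>carrier F. l (\<theta> (T s x))) \<in> carrier W"
      unfolding W_carrier P_def using s l T_mem[OF s] \<theta>.hom_closed by (auto simp: T_H)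
  qed
  from free_group_hom_exists[OF free W this]
  obtain \<Phi> where \<Phi>: "\<Phi> \<in> hom F W" "\<And>s. s \<in> S \<Longrightarrow> \<Phi> s = (s, \<lambda>x\<in>carrier F. l (\<theta> (T s x)))" by blast
  interpret \<Phi>: group_hom F W \<Phi> by (simp add: group_hom_def group_hom_axioms_def \<Phi>(1) W)
  have "fst \<in> hom W F" by (rule homI) (auto simp: W_def P_def)
  then interpret f: group_hom W F fst by (simp add: group_hom_def group_hom_axioms_def W)
  have fst: "fst (\<Phi> g) = g" if "g \<in> carrier F" for g
  proof -
    have "g \<in> generate F S" using that gen by simp
    then show ?thesis
    proof (induction rule: generate.induct)
      case (inv h)
      then show ?case using S \<Phi>(2)[of h] \<Phi>.hom_inv[of h] f.hom_inv[of "\<Phi> h"] \<Phi>.hom_closed[of h] by auto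
    next
      case (eng g h)
      then have "g \<in> carrier F" "h \<in> carrier F" using gen by auto
      then show ?case using eng f.hom_mult[of "\<Phi> g" "\<Phi> h"] \<Phi>.hom_closed by simp
    qed (use \<Phi>(2) \<Phi>.hom_one f.hom_one in auto)
  qed
  have \<Phi>P: "\<Phi> g = (g, snd (\<Phi> g))" "P g (snd (\<Phi> g))" if "g \<in> carrier F" for g
    using fst[OF that] \<Phi>.hom_closed[OF that] W_carrier[of g "snd (\<Phi> g)"] by (metis prod.collapse)+
  show thesis
  proof
    show "(\<lambda>h. snd (\<Phi> h) \<one>\<^bsub>F\<^esub>) \<in> hom (F\<lparr>carrier := H\<rparr>) E"
    proof (rule homI)
      fix h assume "h \<in> carrier (F\<lparr>carrier := H\<rparr>)"
      then show "snd (\<Phi> h) \<one>\<^bsub>F\<^esub> \<in> carrier E" using PE[OF \<Phi>P(2)] by simp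
    next
      fix h h' assume "h \<in> carrier (F\<lparr>carrier := H\<rparr>)" "h' \<in> carrier (F\<lparr>carrier := H\<rparr>)"
      then have h: "h \<in> H" "h' \<in> H" "h \<in> carrier F" "h' \<in> carrier F" by auto
      have "\<Phi> (h \<otimes>\<^bsub>F\<^esub> h') = (h, snd (\<Phi> h)) \<otimes>\<^bsub>W\<^esub> (h', snd (\<Phi> h'))"
        using \<Phi>.hom_mult[OF h(3,4)] \<Phi>P(1)[OF h(3)] \<Phi>P(1)[OF h(4)] by simp
      then have "snd (\<Phi> (h \<otimes>\<^bsub>F\<^esub> h')) \<one>\<^bsub>F\<^esub> = snd (\<Phi> h) h' \<otimes>\<^bsub>E\<^esub> snd (\<Phi> h') \<one>\<^bsub>F\<^esub>"
        using h by (simp add: W_mult)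
      \<comment> \<open>The product in \<open>W\<close> shifts the argument of the first component
        to \<open>h'\<close>, which lies in the coset of the unit, where this component is
        constant.\<close>
      also have "snd (\<Phi> h) h' = snd (\<Phi> h) (\<one>\<^bsub>F\<^esub> \<otimes>\<^bsub>F\<^esub> h')" using h by simp
      also have "\<dots> = snd (\<Phi> h) \<one>\<^bsub>F\<^esub>"
        using \<Phi>P(2)[OF h(3)] h(2) unfolding P_def by blast
      finally show "snd (\<Phi> (h \<otimes>\<^bsub>F\<lparr>carrier := H\<rparr>\<^esub> h')) \<one>\<^bsub>F\<^esub> = snd (\<Phi> h) \<one>\<^bsub>F\<^esub> \<otimes>\<^bsub>E\<^esub> snd (\<Phi> h') \<one>\<^bsub>F\<^esub>"
        by simp
    qed
  next
    fix h assume h: "h \<in> H"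
    then show "p (snd (\<Phi> h) \<one>\<^bsub>F\<^esub>) = \<theta> h"
      using \<Phi>P(2)[of h] T_id[OF h] by (auto simp: P_def)
  qed
qed

section \<open>Verbal and marginal subgroups of polynilpotent varieties\<close>

text \<open>\<open>words_of_variety\<close> only tests countable groups; polynilpotency is reduced to them because
  an element of a term of the series already lies in that term of a countable subgroup.\<close>

definition countably_local :: "('a, 'b) monoid_scheme \<Rightarrow> ('a set \<Rightarrow> 'a set) \<Rightarrow> bool" where
  "countably_local G A \<longleftrightarrow> mono A \<and>
    (\<forall>z \<in> A (carrier G). \<exists>C. countable C \<and> C \<subseteq> carrier G \<and> z \<in> A (generate G C))"

context group
begin

lemma poly_lower_central_foldl:
  "poly_lower_central G cs = foldl (\<lambda>H c. iterated_commutator G H H c) (carrier G) cs"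
  unfolding poly_lower_central_def lower_central_eq ..

lemma countable_generate:
  assumes "countable C" "C \<subseteq> carrier G"
  shows "countable (generate G C)"
proof -
  have "generate G C \<subseteq> (\<lambda>w. word_value G (\<lambda>x. x) w) ` lists (C \<times> UNIV)"
    unfolding generate_eq_word_values[OF assms(2)] by (force simp: lists_eq_set)
  then show ?thesis
    using assms(1) by (meson countable_SIGMA countable_image countable_lists countable_subset uncountable_def
        countableI_type)
qed

lemma countably_local_id: "countably_local G (\<lambda>Y. Y)"
  unfolding countably_local_def by (auto simp: mono_def intro!: exI[of _ "{_}"] generate.incl)

lemma countably_local_commutator_subgroup:
  assumes A: "countably_local G A" and B: "countably_local G B"
  shows "countably_local G (\<lambda>Y. commutator_subgroup G (A Y) (B Y))"
  unfolding countably_local_def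
proof (intro conjI ballI)
  have mA: "mono A" and mB: "mono B" using A B by (simp_all add: countably_local_def)
  then have mono: "commutator_subgroup G (A Y) (B Y) \<subseteq> commutator_subgroup G (A Z) (B Z)" if "Y \<subseteq> Z" for Y Z
    using that by (intro commutator_subgroup_mono) (auto dest: monoD)
  then show "mono (\<lambda>Y. commutator_subgroup G (A Y) (B Y))" by (auto simp: mono_def)
  have gens: "\<exists>C. countable C \<and> C \<subseteq> carrier G \<and> group_commutator G a b \<in> commutator_subgroup G (A (generate G C)) (B (generate G C))"
    if "a \<in> A (carrier G)" "b \<in> B (carrier G)" for a b
  proof -
    obtain C D where CD: "countable C" "C \<subseteq> carrier G" "a \<in> A (generate G C)"
      "countable D" "D \<subseteq> carrier G" "b \<in> B (generate G D)"
      using A B \<open>a \<in> A (carrier G)\<close> \<open>b \<in> B (carrier G)\<close> unfolding countably_local_def by meson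
    have "A (generate G C) \<subseteq> A (generate G (C \<union> D))" "B (generate G D) \<subseteq> B (generate G (C \<union> D))"
      using monoD[OF mA mono_generate[of C "C \<union> D"]] monoD[OF mB mono_generate[of D "C \<union> D"]] by auto
    then have "group_commutator G a b \<in> commutator_subgroup G (A (generate G (C \<union> D))) (B (generate G (C \<union> D)))"
      using CD by (intro commutator_in_commutator_subgroup) auto
    then show ?thesis using CD by (intro exI[of _ "C \<union> D"]) auto
  qed
  fix z assume "z \<in> commutator_subgroup G (A (carrier G)) (B (carrier G))"
  then have "z \<in> generate G {group_commutator G a b | a b. a \<in> A (carrier G) \<and> b \<in> B (carrier G)}"
    by (simp add: commutator_subgroup_alt)
  then show "\<exists>C. countable C \<and> C \<subseteq> carrier G \<and> z \<in> commutator_subgroup G (A (generate G C)) (B (generate G C))"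
  proof (induction rule: generate.induct)
    case one
    show ?case by (rule exI[of _ "{}"]) (simp add: commutator_subgroup_def generate.one)
  next
    case (incl h)
    then show ?case using gens by auto
  next
    case (inv h)
    then obtain a b where ab: "h = group_commutator G a b" "a \<in> A (carrier G)" "b \<in> B (carrier G)" by auto
    obtain C D where CD: "countable C" "C \<subseteq> carrier G" "a \<in> A (generate G C)"
      "countable D" "D \<subseteq> carrier G" "b \<in> B (generate G D)"
      using A B ab unfolding countably_local_def by meson
    have "A (generate G C) \<subseteq> A (generate G (C \<union> D))" "B (generate G D) \<subseteq> B (generate G (C \<union> D))"
      using monoD[OF mA mono_generate[of C "C \<union> D"]] monoD[OF mB mono_generate[of D "C \<union> D"]] by auto
    then have "a \<in> A (generate G (C \<union> D))" "b \<in> B (generate G (C \<union> D))" using CD by auto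
    then have "inv h \<in> commutator_subgroup G (A (generate G (C \<union> D))) (B (generate G (C \<union> D)))"
      unfolding commutator_subgroup_alt ab(1) by (intro generate.inv) blast
    then show ?case using CD by (intro exI[of _ "C \<union> D"]) auto
  next
    case (eng g h)
    then obtain C D where CD: "countable C" "C \<subseteq> carrier G"
      "g \<in> commutator_subgroup G (A (generate G C)) (B (generate G C))"
      "countable D" "D \<subseteq> carrier G" "h \<in> commutator_subgroup G (A (generate G D)) (B (generate G D))"
      by meson
    have "g \<in> commutator_subgroup G (A (generate G (C \<union> D))) (B (generate G (C \<union> D)))"
      "h \<in> commutator_subgroup G (A (generate G (C \<union> D))) (B (generate G (C \<union> D)))"
      using CD mono[OF mono_generate[of C "C \<union> D"]] mono[OF mono_generate[of D "C \<union> D"]] by auto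
    then have "g \<otimes> h \<in> commutator_subgroup G (A (generate G (C \<union> D))) (B (generate G (C \<union> D)))"
      unfolding commutator_subgroup_def by (rule generate.eng)
    then show ?case using CD by (intro exI[of _ "C \<union> D"]) auto
  qed
qed

lemma countably_local_iterated_commutator:
  assumes "countably_local G A" "countably_local G B"
  shows "countably_local G (\<lambda>Y. iterated_commutator G (B Y) (A Y) j)"
  by (induction j) (simp_all add: assms iterated_commutator_Suc countably_local_commutator_subgroup)

lemma countably_local_foldl:
  assumes "countably_local G A"
  shows "countably_local G (\<lambda>Y. foldl (\<lambda>H c. iterated_commutator G H H c) (A Y) cs)"
  using assms by (induction cs arbitrary: A) (simp_all add: countably_local_iterated_commutator)

lemma foldl_consistent:
  assumes K: "subgroup K G" and "subgroup H G" "H \<subseteq> K"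
  shows "foldl (\<lambda>H c. iterated_commutator (G\<lparr>carrier := K\<rparr>) H H c) H cs
    = foldl (\<lambda>H c. iterated_commutator G H H c) H cs"
  using assms(2,3)
proof (induction cs arbitrary: H)
  case (Cons c cs)
  have "iterated_commutator (G\<lparr>carrier := K\<rparr>) H H c = iterated_commutator G H H c"
    using iterated_commutator_consistent[OF K] Cons.prems by simp
  moreover have "iterated_commutator G H H c \<subseteq> K"
    using iterated_commutator_subset[OF Cons.prems(1), of H c] Cons.prems by auto
  ultimately show ?case using Cons by (simp add: subgroup_iterated_commutator)
qed simp

lemma poly_lower_central_consistent:
  assumes "subgroup K G"
  shows "poly_lower_central (G\<lparr>carrier := K\<rparr>) cs = foldl (\<lambda>H c. iterated_commutator G H H c) K cs"
proof -
  interpret K: group "G\<lparr>carrier := K\<rparr>" by (rule subgroup_imp_group[OF assms])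
  show ?thesis using foldl_consistent[OF assms assms] by (simp add: K.poly_lower_central_foldl)
qed

lemma normal_foldl:
  assumes "H \<lhd> G"
  shows "foldl (\<lambda>H c. iterated_commutator G H H c) H cs \<lhd> G"
proof -
  have *: "iterated_commutator G K N j \<lhd> G" if "K \<lhd> G" "N \<lhd> G" for K N j
    by (induction j) (simp_all add: that iterated_commutator_Suc normal_commutator_subgroup)
  show ?thesis using assms by (induction cs arbitrary: H) (simp_all add: *)
qed

lemma normal_poly_lower_central: "poly_lower_central G cs \<lhd> G"
  unfolding poly_lower_central_foldl by (rule normal_foldl[OF normal_self])

end

context group_hom
begin

lemma commutator_subgroup_image:
  assumes "A \<subseteq> carrier G" "B \<subseteq> carrier G"
  shows "h ` commutator_subgroup G A B = commutator_subgroup H (h ` A) (h ` B)"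
proof -
  have hc: "h (group_commutator G a b) = group_commutator H (h a) (h b)" if "a \<in> A" "b \<in> B" for a b
    using that assms by (intro hom_commutator homh) auto
  have "{group_commutator H a b |a b. a \<in> h ` A \<and> b \<in> h ` B}
      = h ` {group_commutator G a b |a b. a \<in> A \<and> b \<in> B}"
  proof (intro equalityI subsetI)
    fix z assume "z \<in> {group_commutator H a b |a b. a \<in> h ` A \<and> b \<in> h ` B}"
    then obtain a b where "a \<in> A" "b \<in> B" "z = group_commutator H (h a) (h b)" by auto
    moreover from this have "z = h (group_commutator G a b)" using hc by simp
    ultimately show "z \<in> h ` {group_commutator G a b |a b. a \<in> A \<and> b \<in> B}" by blast
  qed (use hc in auto)
  moreover have "{group_commutator G a b |a b. a \<in> A \<and> b \<in> B} \<subseteq> carrier G"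
    using assms by (auto intro!: G.commutator_closed)
  ultimately show ?thesis
    by (simp add: G.commutator_subgroup_alt H.commutator_subgroup_alt generate_img)
qed

lemma iterated_commutator_image:
  assumes "subgroup K G" "N \<subseteq> K"
  shows "h ` iterated_commutator G K N j = iterated_commutator H (h ` K) (h ` N) j"
proof (induction j)
  case (Suc j)
  have "iterated_commutator G K N j \<subseteq> carrier G" "K \<subseteq> carrier G"
    using G.iterated_commutator_subset[OF assms] subgroup.subset[OF assms(1)] by auto
  then show ?case using Suc by (simp add: iterated_commutator_Suc commutator_subgroup_image)
qed simp

lemma foldl_image:
  assumes "subgroup K G"
  shows "h ` foldl (\<lambda>H c. iterated_commutator G H H c) K cs
    = foldl (\<lambda>K c. iterated_commutator H K K c) (h ` K) cs"
  using assms
proof (induction cs arbitrary: K)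
  case (Cons c cs)
  then show ?case
    using Cons.IH[OF G.subgroup_iterated_commutator[OF Cons.prems Cons.prems]]
    by (simp add: iterated_commutator_image[OF Cons.prems])
qed simp

lemma poly_lower_central_image:
  assumes "h ` carrier G = carrier H"
  shows "h ` poly_lower_central G cs = poly_lower_central H cs"
  using foldl_image[OF G.subgroup_self] assms
  by (simp add: G.poly_lower_central_foldl H.poly_lower_central_foldl)

lemma polynilpotent_image:
  assumes "h ` carrier G = carrier H" "polynilpotent cs G"
  shows "polynilpotent cs H"
  using poly_lower_central_image[OF assms(1), of cs] assms(2) H.is_group by (simp add: polynilpotent_def)

lemma word_value_lift:
  assumes "h ` carrier G = carrier H" and f: "f \<in> UNIV \<rightarrow> carrier H"
  obtains f' where "f' \<in> UNIV \<rightarrow> carrier G" "\<And>v. word_value H f v = h (word_value G f' v)"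
proof -
  have "\<forall>i. \<exists>x. x \<in> carrier G \<and> h x = f i" using assms by (metis (no_types, lifting) Pi_iff UNIV_I imageE)
  then obtain f' where f': "\<And>i. f' i \<in> carrier G" "\<And>i. h (f' i) = f i" by metis
  then have "word_value H f v = h (word_value G f' v)" for v
    using hom_word_value[of v f'] f' by simp
  with f' that show ?thesis by blast
qed

lemma satisfies_laws_image:
  assumes "h ` carrier G = carrier H" "satisfies_laws G V"
  shows "satisfies_laws H V"
  unfolding satisfies_laws_def
proof (intro ballI)
  fix v f assume v: "v \<in> V" and "f \<in> (UNIV :: nat set) \<rightarrow> carrier H"
  then obtain f' where "f' \<in> UNIV \<rightarrow> carrier G" "word_value H f v = h (word_value G f' v)"
    using word_value_lift[OF assms(1)] by metis
  then show "word_value H f v = \<one>\<^bsub>H\<^esub>" using assms(2) v by (simp add: satisfies_laws_def)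
qed

end

text \<open>An injection into \<open>nat\<close> transports the group structure, and both properties
  pass to homomorphic images, hence in both directions along the isomorphism.\<close>

lemma (in group) countable_laws_iff_polynilpotent:
  assumes V: "words_of_variety V (polynilpotent cs)" and cnt: "countable (carrier G)"
  shows "satisfies_laws G V \<longleftrightarrow> polynilpotent cs G"
proof -
  let ?e = "to_nat_on (carrier G)"
  have inj: "inj_on ?e (carrier G)" using cnt by (rule inj_on_to_nat_on)
  have weak: "weak_group_morphism ?e {\<one>} G"
  proof (intro weak_group_morphism.intro weak_group_morphism_axioms.intro one_is_normal)
    fix a b assume "a \<in> carrier G" "b \<in> carrier G"
    then show "?e a = ?e b \<longleftrightarrow> a \<otimes> inv b \<in> {\<one>}"
      using inj by (metis inj_onD inv_closed inv_equality inv_inv r_inv singleton_iff)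
  qed
  let ?N = "image_group ?e G"
  have N: "group ?N" by (rule image_group_is_group[OF weak])
  interpret e: group_hom G ?N ?e
    using weak_group_morphism_is_hom[OF weak] N by (simp add: group_hom_def group_hom_axioms_def)
  have carr: "?e ` carrier G = carrier ?N" by (simp add: image_group_carrier)
  then have iso: "?e \<in> iso G ?N" using inj e.homh by (simp add: iso_def bij_betw_def)
  obtain g where g: "g \<in> iso ?N G" using iso_set_sym[OF iso] by blast
  interpret g: group_hom ?N G g
    using g N by (simp add: group_hom_def group_hom_axioms_def iso_def)
  have carr': "g ` carrier ?N = carrier G" using g by (simp add: iso_def bij_betw_def)
  have "satisfies_laws ?N V \<longleftrightarrow> polynilpotent cs ?N"
    using V N by (simp add: words_of_variety_def)
  then show ?thesis
    using e.satisfies_laws_image[OF carr] g.satisfies_laws_image[OF carr']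
      e.polynilpotent_image[OF carr] g.polynilpotent_image[OF carr'] by blast
qed

lemma (in group) word_value_consistent:
  assumes "subgroup K G" "f \<in> UNIV \<rightarrow> K"
  shows "word_value (G\<lparr>carrier := K\<rparr>) f v = word_value G f v"
  using assms by (induction v) (auto simp: m_inv_consistent Pi_iff)

text \<open>If the laws hold, an element of the last term lies in the last term of a countable
  subgroup, which is trivial. Conversely, an assignment \<open>f\<close> takes its values in the
  countable subgroup generated by \<open>range f\<close>.\<close>

lemma (in group) laws_iff_polynilpotent:
  assumes V: "words_of_variety V (polynilpotent cs)"
  shows "satisfies_laws G V \<longleftrightarrow> polynilpotent cs G"
proof
  assume G: "satisfies_laws G V"
  have "z = \<one>" if "z \<in> poly_lower_central G cs" for z
  proof -
    have "z \<in> foldl (\<lambda>H c. iterated_commutator G H H c) (carrier G) cs"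
      using that by (simp add: poly_lower_central_foldl)
    then obtain C where C: "countable C" "C \<subseteq> carrier G"
      "z \<in> foldl (\<lambda>H c. iterated_commutator G H H c) (generate G C) cs"
      using countably_local_foldl[OF countably_local_id, of cs] unfolding countably_local_def by blast
    let ?Y = "generate G C"
    have Y: "subgroup ?Y G" by (rule generate_is_subgroup[OF C(2)])
    interpret Y: group "G\<lparr>carrier := ?Y\<rparr>" by (rule subgroup_imp_group[OF Y])
    have "satisfies_laws (G\<lparr>carrier := ?Y\<rparr>) V"
      unfolding satisfies_laws_def
    proof (intro ballI)
      fix v f assume "v \<in> V" and f: "f \<in> (UNIV :: nat set) \<rightarrow> carrier (G\<lparr>carrier := ?Y\<rparr>)"
      then show "word_value (G\<lparr>carrier := ?Y\<rparr>) f v = \<one>\<^bsub>G\<lparr>carrier := ?Y\<rparr>\<^esub>"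
        using G word_value_consistent[OF Y, of f v] subgroup.subset[OF Y]
        by (auto simp: satisfies_laws_def Pi_iff subset_iff)
    qed
    then have "polynilpotent cs (G\<lparr>carrier := ?Y\<rparr>)"
      using Y.countable_laws_iff_polynilpotent[OF V] countable_generate[OF C(1,2)] by simp
    then show ?thesis
      using C(3) by (simp add: polynilpotent_def poly_lower_central_consistent[OF Y])
  qed
  moreover have "\<one> \<in> poly_lower_central G cs"
    by (rule subgroup.one_closed[OF normal_imp_subgroup[OF normal_poly_lower_central]])
  ultimately have "poly_lower_central G cs = {\<one>}" by blast
  then show "polynilpotent cs G" using is_group by (simp add: polynilpotent_def)
next
  assume G: "polynilpotent cs G"
  show "satisfies_laws G V"
    unfolding satisfies_laws_def
  proof (intro ballI)
    fix v f assume v: "v \<in> V" and f: "f \<in> (UNIV :: nat set) \<rightarrow> carrier G"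
    let ?Y = "generate G (range f)"
    have rf: "range f \<subseteq> carrier G" using f by auto
    have Y: "subgroup ?Y G" by (rule generate_is_subgroup[OF rf])
    interpret Y: group "G\<lparr>carrier := ?Y\<rparr>" by (rule subgroup_imp_group[OF Y])
    have "mono (\<lambda>Y. foldl (\<lambda>H c. iterated_commutator G H H c) Y cs)"
      using countably_local_foldl[OF countably_local_id, of cs] by (simp add: countably_local_def)
    from monoD[OF this subgroup.subset[OF Y]]
    have "poly_lower_central (G\<lparr>carrier := ?Y\<rparr>) cs \<subseteq> {\<one>}"
      using G unfolding poly_lower_central_consistent[OF Y] polynilpotent_def poly_lower_central_foldl by simp
    moreover have "\<one> \<in> poly_lower_central (G\<lparr>carrier := ?Y\<rparr>) cs"
      using subgroup.one_closed[OF normal_imp_subgroup[OF Y.normal_poly_lower_central]] by simp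
    ultimately have "poly_lower_central (G\<lparr>carrier := ?Y\<rparr>) cs = {\<one>}" by blast
    then have "polynilpotent cs (G\<lparr>carrier := ?Y\<rparr>)"
      using Y.is_group by (simp add: polynilpotent_def)
    then have "satisfies_laws (G\<lparr>carrier := ?Y\<rparr>) V"
      using Y.countable_laws_iff_polynilpotent[OF V] countable_generate[of "range f"] rf by simp
    moreover have "f \<in> UNIV \<rightarrow> ?Y" by (auto intro: generate.incl)
    ultimately show "word_value G f v = \<one>"
      using v word_value_consistent[OF Y, of f v] by (simp add: satisfies_laws_def)
  qed
qed

section \<open>Verbal subgroups and the polynilpotent series\<close>

context group
begin

lemma verbal_gens_carrier:
  "{word_value G f v | v f. v \<in> V \<and> f \<in> (UNIV :: nat set) \<rightarrow> carrier G} \<subseteq> carrier G"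
  by (auto intro!: word_value_closed)

lemma conj_hom: "g \<in> carrier G \<Longrightarrow> (\<lambda>x. g \<otimes> x \<otimes> inv g) \<in> hom G G"
  by (rule homI) (simp_all add: group_normalize)

lemma conj_word_value:
  assumes "g \<in> carrier G" "f \<in> UNIV \<rightarrow> carrier G"
  shows "g \<otimes> word_value G f v \<otimes> inv g = word_value G (\<lambda>i. g \<otimes> f i \<otimes> inv g) v"
proof -
  interpret c: group_hom G G "\<lambda>x. g \<otimes> x \<otimes> inv g"
    using conj_hom[OF assms(1)] by (simp add: group_hom_def group_hom_axioms_def)
  show ?thesis by (rule c.hom_word_value) (use assms in auto)
qed

lemma normal_verbal_subgroup: "verbal_subgroup G V \<lhd> G"
  unfolding verbal_subgroup_def
proof (rule normal_generateI[OF verbal_gens_carrier])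
  fix h g assume "h \<in> {word_value G f v | v f. v \<in> V \<and> f \<in> (UNIV :: nat set) \<rightarrow> carrier G}"
    and g: "g \<in> carrier G"
  then obtain v f where vf: "h = word_value G f v" "v \<in> V" "f \<in> UNIV \<rightarrow> carrier G" by auto
  then have "g \<otimes> h \<otimes> inv g = word_value G (\<lambda>i. g \<otimes> f i \<otimes> inv g) v"
    using conj_word_value[OF g] by simp
  moreover have "(\<lambda>i. g \<otimes> f i \<otimes> inv g) \<in> UNIV \<rightarrow> carrier G" using vf g by auto
  ultimately show "g \<otimes> h \<otimes> inv g \<in> {word_value G f v | v f. v \<in> V \<and> f \<in> UNIV \<rightarrow> carrier G}"
    using vf(2) by blast
qed

text \<open>Both are the smallest normal subgroup with quotient in the variety, one described by
  laws and the other by the series. So each inclusion tests one description on the quotient by the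
  other subgroup.\<close>

lemma verbal_subgroup_eq_poly_lower_central:
  assumes V: "words_of_variety V (polynilpotent cs)"
  shows "verbal_subgroup G V = poly_lower_central G cs"
proof
  interpret N: normal "verbal_subgroup G V" G by (rule normal_verbal_subgroup)
  interpret Q: group "G Mod verbal_subgroup G V" by (rule N.factorgroup_is_group)
  interpret p: group_hom G "G Mod verbal_subgroup G V" "(#>) (verbal_subgroup G V)"
    by (simp add: group_hom_def group_hom_axioms_def N.r_coset_hom_Mod)
  have surj: "(#>) (verbal_subgroup G V) ` carrier G = carrier (G Mod verbal_subgroup G V)"
    by (simp add: carrier_FactGroup)
  have "satisfies_laws (G Mod verbal_subgroup G V) V"
    unfolding satisfies_laws_def
  proof (intro ballI)
    fix v f assume v: "v \<in> V" and "f \<in> (UNIV :: nat set) \<rightarrow> carrier (G Mod verbal_subgroup G V)"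
    then obtain f' where f': "f' \<in> UNIV \<rightarrow> carrier G"
      "word_value (G Mod verbal_subgroup G V) f v = verbal_subgroup G V #> word_value G f' v"
      using p.word_value_lift[OF surj] by metis
    have "word_value G f' v \<in> verbal_subgroup G V"
      unfolding verbal_subgroup_def using f' v by (intro generate.incl) blast
    then show "word_value (G Mod verbal_subgroup G V) f v = \<one>\<^bsub>G Mod verbal_subgroup G V\<^esub>"
      using f' N.coset_eq_one_iff[of "word_value G f' v"] N.mem_carrier by simp
  qed
  then have "polynilpotent cs (G Mod verbal_subgroup G V)"
    using Q.laws_iff_polynilpotent[OF V] by simp
  then have "(#>) (verbal_subgroup G V) ` poly_lower_central G cs = {verbal_subgroup G V}"
    using p.poly_lower_central_image[OF surj, of cs] by (simp add: polynilpotent_def)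
  then have "verbal_subgroup G V #> z = verbal_subgroup G V" if "z \<in> poly_lower_central G cs" for z
    using that by blast
  then show "poly_lower_central G cs \<subseteq> verbal_subgroup G V"
    using N.coset_eq_one_iff subgroup.mem_carrier[OF normal_imp_subgroup[OF normal_poly_lower_central]]
    by blast
next
  interpret N: normal "poly_lower_central G cs" G by (rule normal_poly_lower_central)
  interpret Q: group "G Mod poly_lower_central G cs" by (rule N.factorgroup_is_group)
  interpret p: group_hom G "G Mod poly_lower_central G cs" "(#>) (poly_lower_central G cs)"
    by (simp add: group_hom_def group_hom_axioms_def N.r_coset_hom_Mod)
  have surj: "(#>) (poly_lower_central G cs) ` carrier G = carrier (G Mod poly_lower_central G cs)"
    by (simp add: carrier_FactGroup)
  have coset: "poly_lower_central G cs #> z = poly_lower_central G cs" if "z \<in> poly_lower_central G cs" for z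
    using that N.coset_eq_one_iff[of z] N.mem_carrier[of z] by simp
  have "(#>) (poly_lower_central G cs) ` poly_lower_central G cs = {poly_lower_central G cs}"
  proof (intro equalityI subsetI)
    fix K assume "K \<in> {poly_lower_central G cs}"
    then have "K = poly_lower_central G cs #> \<one>"
      using coset[OF subgroup.one_closed[OF N.subgroup_axioms]] by simp
    then show "K \<in> (#>) (poly_lower_central G cs) ` poly_lower_central G cs"
      using subgroup.one_closed[OF N.subgroup_axioms] by (rule image_eqI)
  qed (use coset in blast)
  then have "polynilpotent cs (G Mod poly_lower_central G cs)"
    using p.poly_lower_central_image[OF surj, of cs] Q.is_group by (simp add: polynilpotent_def)
  then have laws: "satisfies_laws (G Mod poly_lower_central G cs) V"
    using Q.laws_iff_polynilpotent[OF V] by simp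
  show "verbal_subgroup G V \<subseteq> poly_lower_central G cs"
    unfolding verbal_subgroup_def
  proof (rule generate_subgroup_incl[OF _ N.subgroup_axioms], clarify)
    fix v f assume v: "v \<in> V" and f: "f \<in> (UNIV :: nat set) \<rightarrow> carrier G"
    have wc: "word_value G f v \<in> carrier G" using f by (auto intro!: word_value_closed)
    have "poly_lower_central G cs #> word_value G f v
        = word_value (G Mod poly_lower_central G cs) (\<lambda>i. poly_lower_central G cs #> f i) v"
      by (rule p.hom_word_value) (use f in auto)
    also have "\<dots> = \<one>\<^bsub>G Mod poly_lower_central G cs\<^esub>"
      using laws v f p.hom_closed by (auto simp: satisfies_laws_def Pi_iff)
    finally show "word_value G f v \<in> poly_lower_central G cs"
      using N.coset_eq_one_iff[OF wc] by simp
  qed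
qed

end

text \<open>A pair \<open>(B, N)\<close> stands for the section \<open>B / N\<close>. Starting from
  \<open>(F, R)\<close>, the first components run through the polynilpotent series and the second
  ones through the left-normed denominators.\<close>

abbreviation poly_step :: "('a, 'b) monoid_scheme \<Rightarrow> 'a set \<times> 'a set \<Rightarrow> nat \<Rightarrow> 'a set \<times> 'a set" where
  "poly_step G \<equiv> \<lambda>(B, N) c. (iterated_commutator G B B c, iterated_commutator G B N c)"

lemma fst_foldl_poly_step:
  "fst (foldl (poly_step G) (B, N) cs) = foldl (\<lambda>H c. iterated_commutator G H H c) B cs"
  by (induction cs arbitrary: B N) simp_all

text \<open>A quotient \<open>v(\<dots>, f\<^sub>i r, \<dots>) v(f)\<^sup>-\<^sup>1\<close> compares the two components of a value of \<open>v\<close> in the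
  group of pairs that are congruent modulo \<open>R\<close>.  So \<open>[R V\<^sup>* F]\<close> is determined by the verbal
  subgroup of that group, hence by the variety alone.\<close>

definition congruent_pairs :: "('a, 'b) monoid_scheme \<Rightarrow> 'a set \<Rightarrow> 'a set \<Rightarrow> ('a \<times> 'a) set" where
  "congruent_pairs G B N = {(a, b). a \<in> B \<and> b \<in> B \<and> a \<otimes>\<^bsub>G\<^esub> inv\<^bsub>G\<^esub> b \<in> N}"

lemma congruent_pairs_iff:
  "(a, b) \<in> congruent_pairs G B N \<longleftrightarrow> a \<in> B \<and> b \<in> B \<and> a \<otimes>\<^bsub>G\<^esub> inv\<^bsub>G\<^esub> b \<in> N"
  by (simp add: congruent_pairs_def)

context group
begin

lemma group_DirProd: "group (G \<times>\<times> G)"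
  by (rule DirProd_group) (rule is_group)+

lemma commutator_DirProd:
  assumes "a \<in> carrier G" "b \<in> carrier G" "c \<in> carrier G" "d \<in> carrier G"
  shows "group_commutator (G \<times>\<times> G) (a, b) (c, d) = (group_commutator G a c, group_commutator G b d)"
  using assms by (simp add: group_commutator_def inv_DirProd[OF is_group is_group])

lemma subgroup_congruent_pairs:
  assumes B: "subgroup B G" and N: "N \<lhd> (G\<lparr>carrier := B\<rparr>)"
  shows "subgroup (congruent_pairs G B N) (G \<times>\<times> G)"
proof -
  interpret B: subgroup B G by fact
  interpret N: normal N "G\<lparr>carrier := B\<rparr>" by fact
  interpret P: group "G \<times>\<times> G" by (rule group_DirProd)
  have conj: "b \<otimes> n \<otimes> inv b \<in> N" if "b \<in> B" "n \<in> N" for b n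
    using N.inv_op_closed2[of b n] that B by (simp add: m_inv_consistent)
  have NB: "n \<in> B" "n \<in> carrier G" if "n \<in> N" for n
    using N.mem_carrier[OF that] B.mem_carrier by simp_all
  have Nm: "m \<otimes> n \<in> N" if "m \<in> N" "n \<in> N" for m n
    using N.subgroup_axioms that by (simp add: subgroup_def)
  have Ni: "inv n \<in> N" if "n \<in> N" for n
    using subgroup.m_inv_closed[OF N.subgroup_axioms that] NB[OF that] B by (simp add: m_inv_consistent)
  show ?thesis
  proof (rule P.subgroupI)
    show "congruent_pairs G B N \<subseteq> carrier (G \<times>\<times> G)"
      using B.mem_carrier by (auto simp: congruent_pairs_def)
    have "\<one> \<in> N" using subgroup.one_closed[OF N.subgroup_axioms] by simp
    then have "(\<one>, \<one>) \<in> congruent_pairs G B N" using B.one_closed by (simp add: congruent_pairs_iff)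
    then show "congruent_pairs G B N \<noteq> {}" by blast
  next
    fix u assume u: "u \<in> congruent_pairs G B N"
    obtain a b where ab: "u = (a, b)" "a \<in> B" "b \<in> B" "a \<otimes> inv b \<in> N"
      using u by (cases u) (auto simp: congruent_pairs_iff)
    then have c: "a \<in> carrier G" "b \<in> carrier G" using B.mem_carrier by auto
    have "inv b \<otimes> inv (a \<otimes> inv b) \<otimes> inv (inv b) \<in> N"
      using ab by (intro conj Ni) auto
    also have "inv b \<otimes> inv (a \<otimes> inv b) \<otimes> inv (inv b) = inv a \<otimes> inv (inv b)"
      using c by (simp add: group_normalize)
    finally show "inv\<^bsub>G \<times>\<times> G\<^esub> u \<in> congruent_pairs G B N"
      using ab c by (simp add: inv_DirProd[OF is_group is_group] congruent_pairs_iff)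
  next
    fix u v assume u: "u \<in> congruent_pairs G B N" and v: "v \<in> congruent_pairs G B N"
    obtain a b where ab: "u = (a, b)" "a \<in> B" "b \<in> B" "a \<otimes> inv b \<in> N"
      using u by (cases u) (auto simp: congruent_pairs_iff)
    obtain a' b' where ab': "v = (a', b')" "a' \<in> B" "b' \<in> B" "a' \<otimes> inv b' \<in> N"
      using v by (cases v) (auto simp: congruent_pairs_iff)
    have c: "a \<in> carrier G" "b \<in> carrier G" "a' \<in> carrier G" "b' \<in> carrier G"
      using ab ab' B.mem_carrier by auto
    have "(a \<otimes> (a' \<otimes> inv b') \<otimes> inv a) \<otimes> (a \<otimes> inv b) \<in> N"
      by (rule Nm[OF conj[OF ab(2) ab'(4)] ab(4)])
    also have "(a \<otimes> (a' \<otimes> inv b') \<otimes> inv a) \<otimes> (a \<otimes> inv b) = a \<otimes> a' \<otimes> inv (b \<otimes> b')"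
      using c by (simp add: group_normalize)
    finally show "u \<otimes>\<^bsub>G \<times>\<times> G\<^esub> v \<in> congruent_pairs G B N"
      using ab ab' by (simp add: congruent_pairs_iff)
  qed
qed

end

text \<open>One inclusion expands \<open>[n b, n' b']\<close> around \<open>[b, b']\<close>. For the
  other, a congruent pair is a pair \<open>(n, \<one>)\<close> times a diagonal pair, and both kinds
  arise from commutators with diagonal elements.\<close>

lemma (in normal) iterated_commutator_congruent_pairs:
  "iterated_commutator (G \<times>\<times> G) (congruent_pairs G (carrier G) H) (congruent_pairs G (carrier G) H) j
    = congruent_pairs G (lcs j) (iterated_commutator G (carrier G) H j)"
proof (induction j)
  case (Suc j)
  let ?itc = "iterated_commutator G (carrier G) H"
  interpret P: group "G \<times>\<times> G" by (rule group_DirProd)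
  have nitc: "?itc i \<lhd> G" for i by (rule normal_iterated_commutator[OF normal_axioms])
  interpret M: normal "?itc (Suc j)" G by (rule nitc)
  interpret M0: normal "?itc j" G by (rule nitc)
  interpret C: normal "lcs (Suc j)" G by (rule normal_lcs)
  interpret C0: normal "lcs j" G by (rule normal_lcs)
  have sub: "?itc i \<subseteq> lcs i" for i
    by (rule iterated_commutator_mono) (auto intro: mem_carrier)
  have nres: "?itc i \<lhd> (G\<lparr>carrier := lcs i\<rparr>)" for i
    by (rule normal_restrict_supergroup[OF normal_imp_subgroup[OF normal_lcs] nitc sub])
  have sP: "subgroup (congruent_pairs G (lcs i) (?itc i)) (G \<times>\<times> G)" for i
    by (rule subgroup_congruent_pairs[OF normal_imp_subgroup[OF normal_lcs] nres])
  have base: "congruent_pairs G (carrier G) H = congruent_pairs G (lcs 0) (?itc 0)" by simp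
  have comm: "group_commutator G n g \<in> ?itc (Suc i)" "group_commutator G g n \<in> ?itc (Suc i)"
    if "n \<in> ?itc i" "g \<in> carrier G" for n g i
  proof -
    show 1: "group_commutator G n g \<in> ?itc (Suc i)"
      using that by (simp add: iterated_commutator_Suc commutator_in_commutator_subgroup)
    show "group_commutator G g n \<in> ?itc (Suc i)"
      using 1 normal.commutator_mem_swap[OF nitc] that subgroup.mem_carrier[OF normal_imp_subgroup[OF nitc]]
      by blast
  qed
  let ?K = "commutator_subgroup (G \<times>\<times> G) (congruent_pairs G (lcs j) (?itc j)) (congruent_pairs G (carrier G) H)"
  have K: "subgroup ?K (G \<times>\<times> G)"
    unfolding base by (intro P.subgroup_commutator_subgroup subgroup.subset[OF sP])
  interpret K: subgroup ?K "G \<times>\<times> G" by (rule K)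
  have "?K \<subseteq> congruent_pairs G (lcs (Suc j)) (?itc (Suc j))"
  proof (rule P.commutator_subgroup_least[OF sP])
    fix u u' assume "u \<in> congruent_pairs G (lcs j) (?itc j)" "u' \<in> congruent_pairs G (carrier G) H"
    then obtain a b a' b' where u: "u = (a, b)" "a \<in> lcs j" "b \<in> lcs j" "a \<otimes> inv b \<in> ?itc j"
      "u' = (a', b')" "a' \<in> carrier G" "b' \<in> carrier G" "a' \<otimes> inv b' \<in> H"
      by (cases u; cases u') (auto simp: congruent_pairs_iff)
    define n n' where "n = a \<otimes> inv b" and "n' = a' \<otimes> inv b'"
    have carr: "a \<in> carrier G" "b \<in> carrier G" using u C0.mem_carrier by auto
    have nc: "n \<in> carrier G" "n' \<in> carrier G" using carr u by (simp_all add: n_def n'_def)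
    have n: "n \<in> ?itc j" "n' \<in> ?itc 0" using u by (simp_all add: n_def n'_def)
    have a: "a = n \<otimes> b" "a' = n' \<otimes> b'" using carr u by (simp_all add: n_def n'_def group_normalize)
    have bb: "group_commutator G b b' \<in> lcs (Suc j)"
      using u by (simp add: iterated_commutator_Suc commutator_in_commutator_subgroup)
    then have bbc: "group_commutator G b b' \<in> carrier G" using C.mem_carrier by blast
    have m1: "group_commutator G n (group_commutator G b a') \<in> ?itc (Suc j)"
      by (rule comm[OF n(1)]) (use carr u in simp)
    have m2: "group_commutator G n a' \<in> ?itc (Suc j)" by (rule comm[OF n(1) u(6)])
    have m3: "group_commutator G b n' \<in> ?itc (Suc j)"
      using lcs_commutator_mem[OF normal_axioms u(3) n(2)] by simp
    have "group_commutator G (group_commutator G b b') n' \<in> ?itc (Suc j + 0 + 1)"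
      by (rule lcs_commutator_mem[OF normal_axioms bb n(2)])
    then have "group_commutator G (group_commutator G b b') n' \<in> ?itc (Suc j)"
      using iterated_commutator_Suc_subset[OF normal_axioms, of "Suc j"] by auto
    then have m4: "group_commutator G n' (group_commutator G b b') \<in> ?itc (Suc j)"
      using M.commutator_mem_swap nc bbc by blast
    \<comment> \<open>Although \<open>n'\<close> only lies in \<open>H\<close>, its commutators with
      \<open>b\<close> and with \<open>[b, b']\<close> gain the full depth of the lower central
      terms that contain those elements; this is \<open>m3\<close> and \<open>m4\<close>.\<close>
    have "group_commutator G a a' \<otimes> inv (group_commutator G b b')
        = group_commutator G n (group_commutator G b a') \<otimes> (group_commutator G b n' \<otimes>
          (group_commutator G n' (group_commutator G b b') \<otimes>
          (group_commutator G b b' \<otimes> group_commutator G n a' \<otimes> inv (group_commutator G b b'))))"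
      unfolding a using nc carr u(7) by (simp add: group_commutator_def group_normalize)
    also have "\<dots> \<in> ?itc (Suc j)"
      by (intro subgroup.m_closed[OF M.subgroup_axioms] M.inv_op_closed2 m1 m2 m3 m4 bbc)
    finally have "group_commutator G a a' \<otimes> inv (group_commutator G b b') \<in> ?itc (Suc j)" .
    moreover have "group_commutator G a a' \<in> lcs (Suc j)"
      using u by (simp add: iterated_commutator_Suc commutator_in_commutator_subgroup)
    ultimately show "group_commutator (G \<times>\<times> G) u u' \<in> congruent_pairs G (lcs (Suc j)) (?itc (Suc j))"
      using bb carr u by (simp add: commutator_DirProd congruent_pairs_iff)
  qed
  moreover have "congruent_pairs G (lcs (Suc j)) (?itc (Suc j)) \<subseteq> ?K"
  proof clarify
    fix a b assume ab: "(a, b) \<in> congruent_pairs G (lcs (Suc j)) (?itc (Suc j))"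
    have diag: "(c, c) \<in> ?K" if "c \<in> lcs (Suc j)" for c
    proof -
      have "subgroup {c \<in> carrier G. (c, c) \<in> ?K} G"
      proof (rule subgroupI)
        show "{c \<in> carrier G. (c, c) \<in> ?K} \<noteq> {}" using K.one_closed by auto
        fix x assume x: "x \<in> {c \<in> carrier G. (c, c) \<in> ?K}"
        then show "inv x \<in> {c \<in> carrier G. (c, c) \<in> ?K}"
          using K.m_inv_closed[of "(x, x)"] by (simp add: inv_DirProd[OF is_group is_group])
        fix y assume "y \<in> {c \<in> carrier G. (c, c) \<in> ?K}"
        then show "x \<otimes> y \<in> {c \<in> carrier G. (c, c) \<in> ?K}"
          using x K.m_closed[of "(x, x)" "(y, y)"] by simp
      qed auto
      moreover have "group_commutator G c g \<in> {c \<in> carrier G. (c, c) \<in> ?K}"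
        if c: "c \<in> lcs j" "g \<in> carrier G" for c g
      proof -
        have cc: "c \<in> carrier G" using c C0.mem_carrier by blast
        have "(c, c) \<in> congruent_pairs G (lcs j) (?itc j)" "(g, g) \<in> congruent_pairs G (carrier G) H"
          using c cc subgroup.one_closed[OF M0.subgroup_axioms] subgroup.one_closed[OF subgroup_axioms]
          by (simp_all add: congruent_pairs_iff)
        then have "group_commutator (G \<times>\<times> G) (c, c) (g, g) \<in> ?K"
          by (rule P.commutator_in_commutator_subgroup)
        then show ?thesis using c cc by (simp add: commutator_DirProd)
      qed
      ultimately have "lcs (Suc j) \<subseteq> {c \<in> carrier G. (c, c) \<in> ?K}"
        unfolding iterated_commutator_Suc[of G "carrier G" "carrier G"] by (rule commutator_subgroup_least)
      then show ?thesis using that by blast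
    qed
    have left: "(r, \<one>) \<in> ?K" if "r \<in> ?itc (Suc j)" for r
    proof -
      have "subgroup {c \<in> carrier G. (c, \<one>) \<in> ?K} G"
      proof (rule subgroupI)
        show "{c \<in> carrier G. (c, \<one>) \<in> ?K} \<noteq> {}" using K.one_closed by auto
        fix x assume x: "x \<in> {c \<in> carrier G. (c, \<one>) \<in> ?K}"
        then show "inv x \<in> {c \<in> carrier G. (c, \<one>) \<in> ?K}"
          using K.m_inv_closed[of "(x, \<one>)"] by (simp add: inv_DirProd[OF is_group is_group])
        fix y assume "y \<in> {c \<in> carrier G. (c, \<one>) \<in> ?K}"
        then show "x \<otimes> y \<in> {c \<in> carrier G. (c, \<one>) \<in> ?K}"
          using x K.m_closed[of "(x, \<one>)" "(y, \<one>)"] by simp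
      qed auto
      moreover have "group_commutator G n g \<in> {c \<in> carrier G. (c, \<one>) \<in> ?K}"
        if c: "n \<in> ?itc j" "g \<in> carrier G" for n g
      proof -
        have cc: "n \<in> carrier G" using c M0.mem_carrier by blast
        have "(n, \<one>) \<in> congruent_pairs G (lcs j) (?itc j)" "(g, g) \<in> congruent_pairs G (carrier G) H"
          using c cc sub[of j] subgroup.one_closed[OF C0.subgroup_axioms] subgroup.one_closed[OF subgroup_axioms]
          by (auto simp add: congruent_pairs_iff)
        then have "group_commutator (G \<times>\<times> G) (n, \<one>) (g, g) \<in> ?K"
          by (rule P.commutator_in_commutator_subgroup)
        then show ?thesis using c cc by (simp add: commutator_DirProd)
      qed
      ultimately have "?itc (Suc j) \<subseteq> {c \<in> carrier G. (c, \<one>) \<in> ?K}"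
        unfolding iterated_commutator_Suc[of G "carrier G" H] by (rule commutator_subgroup_least)
      then show ?thesis using that by blast
    qed
    have "(a \<otimes> inv b, \<one>) \<otimes>\<^bsub>G \<times>\<times> G\<^esub> (b, b) \<in> ?K"
      by (intro K.m_closed left diag) (use ab in \<open>simp_all add: congruent_pairs_iff\<close>)
    moreover have "a \<in> carrier G" "b \<in> carrier G" using ab C.mem_carrier by (auto simp: congruent_pairs_iff)
    ultimately show "(a, b) \<in> ?K" by (simp add: m_assoc)
  qed
  ultimately have "?K = congruent_pairs G (lcs (Suc j)) (?itc (Suc j))" by blast
  then show ?case by (simp only: iterated_commutator_Suc[of "G \<times>\<times> G"] Suc.IH)
qed simp

context group
begin

lemma congruent_pairs_step:
  assumes B: "subgroup B G" and N: "N \<lhd> (G\<lparr>carrier := B\<rparr>)"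
  shows "iterated_commutator (G \<times>\<times> G) (congruent_pairs G B N) (congruent_pairs G B N) c
    = congruent_pairs G (iterated_commutator G B B c) (iterated_commutator G B N c)"
proof -
  let ?B = "G\<lparr>carrier := B\<rparr>"
  interpret N: normal N ?B by fact
  interpret P: group "G \<times>\<times> G" by (rule group_DirProd)
  have NB: "N \<subseteq> B" using N.subset by simp
  have cp: "congruent_pairs ?B C M = congruent_pairs G C M" if "C \<subseteq> B" for C M
    using that B by (auto simp: congruent_pairs_def subset_iff)
  have BB: "?B \<times>\<times> ?B = (G \<times>\<times> G)\<lparr>carrier := B \<times> B\<rparr>" by (simp add: DirProd_def)
  have sBB: "subgroup (B \<times> B) (G \<times>\<times> G)" by (rule DirProd_subgroups[OF is_group B is_group B])
  have "iterated_commutator (G \<times>\<times> G) (congruent_pairs G B N) (congruent_pairs G B N) c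
      = iterated_commutator (?B \<times>\<times> ?B) (congruent_pairs G B N) (congruent_pairs G B N) c"
    unfolding BB
    by (rule P.iterated_commutator_consistent[symmetric])
       (use sBB subgroup_congruent_pairs[OF B N] in \<open>auto simp: congruent_pairs_def\<close>)
  also have "\<dots> = congruent_pairs ?B (N.lcs c) (iterated_commutator ?B (carrier ?B) N c)"
    using N.iterated_commutator_congruent_pairs[of c] cp[of B N] by simp
  also have "N.lcs c = iterated_commutator G B B c"
    using iterated_commutator_consistent[OF B _ B] by simp
  also have "iterated_commutator ?B (carrier ?B) N c = iterated_commutator G B N c"
    using iterated_commutator_consistent[OF B _ B NB] by simp
  finally show ?thesis using cp iterated_commutator_subset[OF B] by simp
qed

lemma poly_step_normal:
  assumes B: "subgroup B G" and N: "N \<lhd> (G\<lparr>carrier := B\<rparr>)"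
  shows "subgroup (iterated_commutator G B B c) G"
    "iterated_commutator G B N c \<lhd> (G\<lparr>carrier := iterated_commutator G B B c\<rparr>)"
proof -
  let ?B = "G\<lparr>carrier := B\<rparr>"
  interpret N: normal N ?B by fact
  have NB: "N \<subseteq> B" using N.subset by simp
  show "subgroup (iterated_commutator G B B c) G" by (rule subgroup_iterated_commutator[OF B B])
  have eq: "N.lcs c = iterated_commutator G B B c" "iterated_commutator ?B (carrier ?B) N c = iterated_commutator G B N c"
    using iterated_commutator_consistent[OF B _ B] NB by simp_all
  have "iterated_commutator G B N c \<lhd> ?B\<lparr>carrier := iterated_commutator G B B c\<rparr>"
    unfolding eq[symmetric]
    by (rule N.normal_restrict_supergroup[OF normal_imp_subgroup[OF N.normal_lcs]
          N.normal_iterated_commutator[OF N.normal_axioms] N.iterated_commutator_mono])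
       (use NB in auto)
  then show "iterated_commutator G B N c \<lhd> (G\<lparr>carrier := iterated_commutator G B B c\<rparr>)" by simp
qed

lemma foldl_congruent_pairs:
  assumes "subgroup B G" "N \<lhd> (G\<lparr>carrier := B\<rparr>)" "foldl (poly_step G) (B, N) cs = (B', N')"
  shows "foldl (\<lambda>H c. iterated_commutator (G \<times>\<times> G) H H c) (congruent_pairs G B N) cs = congruent_pairs G B' N'
    \<and> subgroup B' G \<and> N' \<lhd> (G\<lparr>carrier := B'\<rparr>)"
  using assms
proof (induction cs arbitrary: B N)
  case (Cons c cs)
  show ?case
    using Cons.IH[OF poly_step_normal[OF Cons.prems(1,2)], of c] Cons.prems
    by (simp add: congruent_pairs_step)
qed simp

text \<open>Change the values from \<open>g\<close> to \<open>f\<close> one variable at a time; a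
  word has finitely many variables, so this ends at the value for \<open>f\<close>. The factor
  \<open>inv (g n) \<otimes> f n\<close> lies in \<open>N\<close> as a conjugate of
  \<open>f n \<otimes> inv (g n)\<close>.\<close>

lemma telescope_marginal:
  assumes N: "N \<lhd> G" and T: "subgroup T G" and f: "f \<in> UNIV \<rightarrow> carrier G" and g: "g \<in> UNIV \<rightarrow> carrier G"
    and fg: "\<And>i. f i \<otimes> inv (g i) \<in> N"
    and single: "\<And>f i r. f \<in> (UNIV :: nat set) \<rightarrow> carrier G \<Longrightarrow> r \<in> N \<Longrightarrow>
      word_value G (f(i := f i \<otimes> r)) v \<otimes> inv (word_value G f v) \<in> T"
  shows "word_value G f v \<otimes> inv (word_value G g v) \<in> T"
proof -
  interpret N: normal N G by fact
  interpret T: subgroup T G by fact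
  define h where "h = (\<lambda>n i. if i < n then f i else g i)"
  have hc: "h n \<in> UNIV \<rightarrow> carrier G" for n using f g unfolding h_def Pi_iff by simp
  have wc: "word_value G u v \<in> carrier G" if "u \<in> (UNIV :: nat set) \<rightarrow> carrier G" for u
    using that by (auto intro!: word_value_closed)
  have "word_value G (h n) v \<otimes> inv (word_value G g v) \<in> T" for n
  proof (induction n)
    case 0
    have "h 0 = g" by (simp add: h_def)
    then show ?case using wc[OF g] T.one_closed by simp
  next
    case (Suc n)
    have c: "f n \<in> carrier G" "g n \<in> carrier G" using f g by auto
    let ?r = "inv (g n) \<otimes> f n"
    have "inv (g n) \<otimes> (f n \<otimes> inv (g n)) \<otimes> g n \<in> N" by (rule N.inv_op_closed1) (use fg c in auto)
    then have r: "?r \<in> N" using c by (simp add: group_normalize)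
    have "(h n)(n := h n n \<otimes> ?r) = h (Suc n)"
      using c by (auto simp: h_def fun_eq_iff inv_cancel_left')
    then have "word_value G (h (Suc n)) v \<otimes> inv (word_value G (h n) v) \<in> T"
      using single[OF hc r, of n n] by simp
    then have "(word_value G (h (Suc n)) v \<otimes> inv (word_value G (h n) v)) \<otimes>
        (word_value G (h n) v \<otimes> inv (word_value G g v)) \<in> T"
      using Suc by (rule T.m_closed)
    then show ?case using wc[OF hc] wc[OF g] by (simp add: group_normalize)
  qed
  moreover obtain n where n: "\<And>i. i \<in> fst ` set v \<Longrightarrow> i < n"
    using finite_nat_set_iff_bounded[of "fst ` set v"] by auto
  have "word_value G (h n) v = word_value G f v"
    by (rule word_value_cong) (simp add: h_def n)
  ultimately show ?thesis by metis
qed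

lemma normal_marginal_commutator:
  assumes N: "N \<lhd> G"
  shows "marginal_commutator G N V \<lhd> G"
  unfolding marginal_commutator_def
proof (rule normal_generateI)
  interpret N: normal N G by fact
  let ?gen = "{word_value G (f(i := f i \<otimes> r)) v \<otimes> inv (word_value G f v) | v f i r.
        v \<in> V \<and> f \<in> (UNIV :: nat set) \<rightarrow> carrier G \<and> r \<in> N}"
  have upd: "f(i := f i \<otimes> r) \<in> UNIV \<rightarrow> carrier G" if "f \<in> (UNIV :: nat set) \<rightarrow> carrier G" "r \<in> N" for f i r
    using that N.mem_carrier by (auto simp: Pi_iff)
  have wc: "word_value G u v \<in> carrier G" if "u \<in> (UNIV :: nat set) \<rightarrow> carrier G" for u v
    using that by (auto intro!: word_value_closed)
  show "?gen \<subseteq> carrier G" using wc upd by (auto intro!: m_closed inv_closed simp del: fun_upd_apply)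
  fix h g assume "h \<in> ?gen" and g: "g \<in> carrier G"
  then obtain v f i r where h: "h = word_value G (f(i := f i \<otimes> r)) v \<otimes> inv (word_value G f v)"
    "v \<in> V" "f \<in> (UNIV :: nat set) \<rightarrow> carrier G" "r \<in> N" by blast
  let ?c = "\<lambda>x. g \<otimes> x \<otimes> inv g"
  have fc: "f j \<in> carrier G" for j using h by auto
  have rc: "r \<in> carrier G" using h N.mem_carrier by auto
  have "?c h = ?c (word_value G (f(i := f i \<otimes> r)) v) \<otimes> inv (?c (word_value G f v))"
    using g wc[OF upd[OF h(3,4)]] wc[OF h(3)] unfolding h(1) by (simp add: group_normalize)
  also have "\<dots> = word_value G (\<lambda>j. ?c ((f(i := f i \<otimes> r)) j)) v \<otimes> inv (word_value G (\<lambda>j. ?c (f j)) v)"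
    using conj_word_value[OF g upd[OF h(3,4)]] conj_word_value[OF g h(3)] by (simp only:)
  also have "(\<lambda>j. ?c ((f(i := f i \<otimes> r)) j)) = (\<lambda>j. ?c (f j))(i := ?c (f i) \<otimes> ?c r)"
    using g fc rc by (auto simp: fun_eq_iff group_normalize)
  finally show "?c h \<in> ?gen"
    using h(2) N.inv_op_closed2[OF g h(4)] fc g by blast
qed

text \<open>A generator of the left side compares the components of a verbal value in the group of
  pairs, whose verbal subgroup is \<open>congruent_pairs G B' N'\<close>. Conversely, by telescoping
  all verbal values there are congruent modulo the left side; this is applied to
  \<open>(r, \<one>)\<close> for \<open>r\<close> in \<open>N'\<close>.\<close>

lemma marginal_commutator_eq_poly_step:
  assumes V: "words_of_variety V (polynilpotent cs)" and N: "N \<lhd> G"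
    and fold: "foldl (poly_step G) (carrier G, N) cs = (B', N')"
  shows "marginal_commutator G N V = N'"
proof -
  interpret N: normal N G by fact
  interpret P: group "G \<times>\<times> G" by (rule group_DirProd)
  have N1: "N \<lhd> (G\<lparr>carrier := carrier G\<rparr>)" using N by simp
  have NG: "subgroup (congruent_pairs G (carrier G) N) (G \<times>\<times> G)"
    by (rule subgroup_congruent_pairs[OF subgroup_self N1])
  let ?D = "(G \<times>\<times> G)\<lparr>carrier := congruent_pairs G (carrier G) N\<rparr>"
  interpret D: group ?D by (rule P.subgroup_imp_group[OF NG])
  note fold' = foldl_congruent_pairs[OF subgroup_self N1 fold]
  have VD: "verbal_subgroup ?D V = congruent_pairs G B' N'"
    using D.verbal_subgroup_eq_poly_lower_central[OF V] fold'
    by (simp add: P.poly_lower_central_consistent[OF NG])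
  have "fst \<in> hom ?D G" "snd \<in> hom ?D G"
    by (auto simp: hom_def congruent_pairs_def)
  then interpret f: group_hom ?D G fst + s: group_hom ?D G snd
    by (simp_all add: group_hom_def group_hom_axioms_def)
  have wv: "word_value ?D u v = (word_value G (\<lambda>i. fst (u i)) v, word_value G (\<lambda>i. snd (u i)) v)"
    if "u \<in> (UNIV :: nat set) \<rightarrow> carrier ?D" for u v
  proof -
    have "\<And>i. i \<in> fst ` set v \<Longrightarrow> u i \<in> carrier ?D" using that by auto
    then show ?thesis using f.hom_word_value[of v u] s.hom_word_value[of v u] by (metis prod.collapse)
  qed
  let ?T = "marginal_commutator G N V"
  interpret T: normal ?T G by (rule normal_marginal_commutator[OF N])
  interpret B': subgroup B' G using fold' by simp
  interpret N': normal N' "G\<lparr>carrier := B'\<rparr>" using fold' by simp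
  have N'B: "N' \<subseteq> B'" using N'.subset by simp
  have sN': "subgroup N' G"
    using incl_subgroup[OF B'.subgroup_axioms N'.subgroup_axioms] .
  show ?thesis
  proof
    show "?T \<subseteq> N'"
      unfolding marginal_commutator_def
    proof (rule generate_subgroup_incl[OF _ sN'], clarify)
      fix v f i r assume v: "v \<in> V" and f: "f \<in> (UNIV :: nat set) \<rightarrow> carrier G" and r: "r \<in> N"
      let ?u = "\<lambda>j. ((f(i := f i \<otimes> r)) j, f j)"
      have fc: "f j \<in> carrier G" for j using f by auto
      have "f i \<otimes> r \<otimes> inv (f i) \<in> N" by (rule N.inv_op_closed2[OF fc r])
      then have u: "?u \<in> UNIV \<rightarrow> carrier ?D"
        using fc r N.mem_carrier subgroup.one_closed[OF N.subgroup_axioms] by (auto simp: congruent_pairs_iff)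
      have "word_value ?D ?u v \<in> verbal_subgroup ?D V"
        unfolding verbal_subgroup_def using v u by (intro generate.incl) blast
      then show "word_value G (f(i := f i \<otimes> r)) v \<otimes> inv (word_value G f v) \<in> N'"
        unfolding VD wv[OF u] by (simp add: congruent_pairs_iff del: fun_upd_apply)
    qed
  next
    have T1: "?T \<lhd> (G\<lparr>carrier := carrier G\<rparr>)" using T.normal_axioms by simp
    have U: "subgroup (congruent_pairs G (carrier G) ?T) (G \<times>\<times> G)"
      by (rule subgroup_congruent_pairs[OF subgroup_self T1])
    have gens: "{word_value ?D u v | v u. v \<in> V \<and> u \<in> (UNIV :: nat set) \<rightarrow> carrier ?D}
        \<subseteq> congruent_pairs G (carrier G) ?T"
    proof
      fix w assume "w \<in> {word_value ?D u v | v u. v \<in> V \<and> u \<in> (UNIV :: nat set) \<rightarrow> carrier ?D}"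
      then obtain v u where v: "v \<in> V" and u: "u \<in> (UNIV :: nat set) \<rightarrow> carrier ?D" and w: "w = word_value ?D u v"
        by blast
      have uc: "fst (u i) \<in> carrier G" "snd (u i) \<in> carrier G" "fst (u i) \<otimes> inv (snd (u i)) \<in> N" for i
        using u by (auto simp: Pi_iff congruent_pairs_def split: prod.splits)
      have "word_value G (\<lambda>i. fst (u i)) v \<otimes> inv (word_value G (\<lambda>i. snd (u i)) v) \<in> ?T"
      proof (rule telescope_marginal[OF N T.subgroup_axioms])
        fix f i r assume "f \<in> (UNIV :: nat set) \<rightarrow> carrier G" "r \<in> N"
        then show "word_value G (f(i := f i \<otimes> r)) v \<otimes> inv (word_value G f v) \<in> ?T"
          unfolding marginal_commutator_def using v by (intro generate.incl) blast
      qed (use uc in auto)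
      then show "w \<in> congruent_pairs G (carrier G) ?T"
        unfolding w wv[OF u] congruent_pairs_iff using uc by (auto intro!: word_value_closed)
    qed
    have sub: "verbal_subgroup ?D V \<subseteq> congruent_pairs G (carrier G) ?T"
    proof -
      let ?g = "{word_value ?D u v | v u. v \<in> V \<and> u \<in> (UNIV :: nat set) \<rightarrow> carrier ?D}"
      have "?g \<subseteq> congruent_pairs G (carrier G) N" using D.verbal_gens_carrier[of V] by simp
      then have "generate ?D ?g = generate (G \<times>\<times> G) ?g" by (rule P.generate_consistent[OF _ NG])
      also have "\<dots> \<subseteq> congruent_pairs G (carrier G) ?T" by (rule P.generate_subgroup_incl[OF gens U])
      finally show ?thesis unfolding verbal_subgroup_def .
    qed
    show "N' \<subseteq> ?T"
    proof
      fix r assume r: "r \<in> N'"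
      have rc: "r \<in> carrier G" using r N'B B'.mem_carrier by auto
      have "(r, \<one>) \<in> congruent_pairs G B' N'"
        using r N'B B'.one_closed rc by (auto simp: congruent_pairs_iff)
      then have "(r, \<one>) \<in> congruent_pairs G (carrier G) ?T" using sub VD by blast
      then show "r \<in> ?T" using rc by (simp add: congruent_pairs_iff)
    qed
  qed
qed

lemma baer_invariant_eq:
  assumes V: "words_of_variety V (polynilpotent cs)" and N: "N \<lhd> G"
    and fold: "foldl (poly_step G) (carrier G, N) cs = (B', N')"
  shows "baer_invariant G N V = (G\<lparr>carrier := N \<inter> B'\<rparr> Mod N')"
proof -
  have "verbal_subgroup G V = B'"
    using verbal_subgroup_eq_poly_lower_central[OF V] fst_foldl_poly_step[of G "carrier G" N cs] fold
    by (simp add: poly_lower_central_foldl)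
  then show ?thesis
    using marginal_commutator_eq_poly_step[OF V N fold] by (simp add: baer_invariant_def)
qed

end

section \<open>The polynilpotent multiplier\<close>

lemma int_pow_cyclic_product:
  assumes "v \<in> carrier (cyclic_product d k)" "i < d"
  shows "(v [^]\<^bsub>cyclic_product d k\<^esub> (a :: int)) i = (a * v i) mod int (k i)"
proof -
  have "(\<lambda>v. v i) \<in> hom (cyclic_product d k) (integer_mod_group (k i))"
    by (rule homI) (use assms(2) in \<open>auto simp: PiE_iff\<close>)
  then interpret h: group_hom "cyclic_product d k" "integer_mod_group (k i)" "\<lambda>v. v i"
    by (simp add: group_hom_def group_hom_axioms_def)
  show ?thesis using h.hom_int_pow[OF assms(1)] by (simp add: int_pow_integer_mod_group)
qed

lemma cyclic_product_cong:
  "(\<And>j. j < d \<Longrightarrow> k j = k' j) \<Longrightarrow> cyclic_product d k = cyclic_product d k'"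
  by (auto simp: product_group_def fun_eq_iff restrict_def intro!: PiE_cong)

lemma magnus_abelianization_hom:
  "(\<lambda>f. \<lambda>j\<in>{..<d}. f [j] mod int (k j)) \<in> hom magnus_group (cyclic_product d k)"
  by (rule homI) (auto simp: integer_mod_group_mem_iff mod_add_eq add.commute intro!: restrict_ext)

lemma magnus_abelianization_surj:
  assumes "v \<in> carrier (cyclic_product d k)"
  obtains f where "f \<in> carrier magnus_group" "(\<lambda>j\<in>{..<d}. f [j] mod int (k j)) = v"
proof -
  let ?f = "\<lambda>w. if w = [] then 1 else v (hd w)"
  have "(\<lambda>j\<in>{..<d}. ?f [j] mod int (k j)) = v"
    using assms by (auto simp: PiE_iff integer_mod_group_mem_iff extensional_def fun_eq_iff)
  then show ?thesis using that[of ?f] by simp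
qed

text \<open>Induction on \<open>m\<close> shows that vectors supported on the first \<open>m\<close>
  coordinates are images of generated elements, by clearing the last coordinate with a power of
  \<open>x m\<close>. The remaining discrepancy lies in the kernel.\<close>

lemma generate_of_cyclic_quotient:
  fixes G (structure)
  assumes h: "group_hom G (cyclic_product d k) h" and ker: "kernel G (cyclic_product d k) h \<subseteq> generate G Y" and Y: "Y \<subseteq> carrier G"
    and x: "\<And>j. j < d \<Longrightarrow> x j \<in> Y" "\<And>j. j < d \<Longrightarrow> h (x j) = (\<lambda>i\<in>{..<d}. (if i = j then 1 else 0) mod int (k i))"
  shows "generate G Y = carrier G"
proof
  let ?C = "cyclic_product d k"
  interpret group_hom G ?C h by (rule h)
  show "generate G Y \<subseteq> carrier G" by (rule G.generate_incl[OF Y])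
  interpret gY: subgroup "generate G Y" G by (rule G.generate_is_subgroup[OF Y])
  have *: "\<forall>v\<in>carrier ?C. (\<forall>j. m \<le> j \<and> j < d \<longrightarrow> v j = 0) \<longrightarrow> v \<in> h ` generate G Y" if "m \<le> d" for m
    using that
  proof (induction m)
    case 0
    have "v = \<one>\<^bsub>?C\<^esub>" if "v \<in> carrier ?C" "\<forall>j<d. v j = 0" for v
      using that by (auto simp: PiE_iff extensional_def fun_eq_iff)
    moreover have "\<one>\<^bsub>?C\<^esub> \<in> h ` generate G Y" using gY.one_closed hom_one by (metis image_eqI)
    ultimately show ?case by auto
  next
    case (Suc m)
    then have m: "m < d" by simp
    show ?case
    proof (intro ballI impI)
      fix v assume v: "v \<in> carrier ?C" "\<forall>j. Suc m \<le> j \<and> j < d \<longrightarrow> v j = 0"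
      have v': "v(m := 0) \<in> carrier ?C" using v(1) m by (auto simp: PiE_iff extensional_def)
      moreover have "\<forall>j. m \<le> j \<and> j < d \<longrightarrow> (v(m := 0)) j = 0" using v(2) by auto
      ultimately obtain s where s: "s \<in> generate G Y" "v(m := 0) = h s" using Suc by fastforce
      have xG: "x m \<in> carrier G" "x m \<in> generate G Y" using x(1)[OF m] Y by (auto intro: generate.incl)
      have hx: "h (x m) \<in> carrier (cyclic_product d k)" using hom_closed[OF xG(1)] .
      have "h (s \<otimes> x m [^] v m) = v(m := 0) \<otimes>\<^bsub>?C\<^esub> h (x m) [^]\<^bsub>?C\<^esub> v m"
        using s xG hom_int_pow gY.mem_carrier by simp
      also have "\<dots> = v"
      proof
        fix i
        show "(v(m := 0) \<otimes>\<^bsub>?C\<^esub> h (x m) [^]\<^bsub>?C\<^esub> v m) i = v i"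
        proof (cases "i < d")
          case True
          have "v i mod int (k i) = v i" using v(1) True by (auto simp: PiE_iff integer_mod_group_mem_iff)
          then show ?thesis
            using int_pow_cyclic_product[OF hx True, of "v m"] True
            by (cases "i = m") (simp_all add: x(2)[OF m] mod_mult_right_eq mod_add_right_eq)
        qed (use v(1) in \<open>auto simp: PiE_iff extensional_def\<close>)
      qed
      finally have "v = h (s \<otimes> x m [^] v m)" by simp
      moreover have "s \<otimes> x m [^] v m \<in> generate G Y"
        using s xG by (intro gY.m_closed G.subgroup_int_pow_closed[OF gY.subgroup_axioms])
      ultimately show "v \<in> h ` generate G Y" by blast
    qed
  qed
  show "carrier G \<subseteq> generate G Y"
  proof
    fix g assume g: "g \<in> carrier G"
    then obtain s where s: "s \<in> generate G Y" "h g = h s" using *[of d] hom_closed[OF g] by auto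
    have sG: "s \<in> carrier G" using s gY.mem_carrier by simp
    have "h (g \<otimes> inv s) = \<one>\<^bsub>?C\<^esub>"      using g sG s(2) hom_mult[of g "inv s"] hom_inv[OF sG] H.r_inv[OF hom_closed[OF sG]]
      by (simp del: mult_product_group one_product_group)
    then have "g \<otimes> inv s \<in> generate G Y" using g sG ker by (auto simp: kernel_def)
    then have "g \<otimes> inv s \<otimes> s \<in> generate G Y" using s gY.m_closed by blast
    then show "g \<in> generate G Y" using g sG by (simp add: G.m_assoc)
  qed
qed

text \<open>The projection of \<open>B\<close> to the sum of cyclic groups and the map reading off
  linear coefficients of power series have the same target. Lifting the first through the second
  gives the \<open>\<phi>\<close> required by \<open>magnus_quotient\<close>.\<close>

lemma free_subgroup_lcs_quotient:
  assumes free: "free_group_on F S" and B: "subgroup B F" and N: "N \<lhd> (F\<lparr>carrier := B\<rparr>)"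
    and der: "commutator_subgroup F B B \<subseteq> N"
    and iso: "cyclic_product d k \<cong> (F\<lparr>carrier := B\<rparr> Mod N)"
    and b: "bij_betw b {..<D} (lyndon_words (Suc c) d)"
  shows "cyclic_product D (\<lambda>j. Gcd (k ` set (b j))) \<cong>
    (F\<lparr>carrier := iterated_commutator F B B c\<rparr> Mod iterated_commutator F B N c)"
proof -
  interpret F: group F using free by (simp add: free_group_on_def)
  let ?B = "F\<lparr>carrier := B\<rparr>" and ?C = "cyclic_product d k"
  interpret N: normal N ?B by fact
  interpret Q: group "?B Mod N" by (rule N.factorgroup_is_group)
  have NB: "N \<subseteq> B" using N.subset by simp
  have C: "group ?C" by simp
  obtain \<iota> where \<iota>: "\<iota> \<in> iso (?B Mod N) ?C"
    using group.iso_sym[OF C iso] by (auto simp: is_iso_def)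
  define \<theta> where "\<theta> = \<iota> \<circ> (#>\<^bsub>?B\<^esub>) N"
  have \<theta>: "\<theta> \<in> hom ?B ?C"
    unfolding \<theta>_def by (rule hom_compose[OF N.r_coset_hom_Mod]) (use \<iota> in \<open>simp add: iso_def\<close>)
  interpret \<theta>: group_hom ?B ?C \<theta>
    using \<theta> C N.is_group by (simp add: group_hom_def group_hom_axioms_def)
  have \<theta>_surj: "\<theta> ` B = carrier ?C"
  proof -
    have "\<iota> ` carrier (?B Mod N) = carrier ?C" using \<iota> by (simp add: iso_def bij_betw_def)
    then show ?thesis by (simp add: \<theta>_def carrier_FactGroup image_comp)
  qed
  have ker: "\<theta> g = \<one>\<^bsub>?C\<^esub> \<longleftrightarrow> g \<in> N" if "g \<in> B" for g
  proof -
    have i: "inj_on \<iota> (carrier (?B Mod N))" "\<iota> \<in> hom (?B Mod N) ?C" using \<iota> by (simp_all add: iso_def bij_betw_def)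
    have "\<iota> \<one>\<^bsub>?B Mod N\<^esub> = \<one>\<^bsub>?C\<^esub>" by (rule hom_one[OF i(2) Q.is_group C])
    moreover have "N #>\<^bsub>?B\<^esub> g \<in> carrier (?B Mod N)"
      using that unfolding carrier_FactGroup by (intro imageI) simp
    ultimately have "\<theta> g = \<one>\<^bsub>?C\<^esub> \<longleftrightarrow> N #>\<^bsub>?B\<^esub> g = \<one>\<^bsub>?B Mod N\<^esub>"
      unfolding \<theta>_def comp_def using inj_on_eq_iff[OF i(1) _ Q.one_closed] by metis
    also have "\<dots> \<longleftrightarrow> g \<in> N" using N.coset_eq_one_iff[of g] that by simp
    finally show ?thesis .
  qed
  let ?p = "\<lambda>f :: nat list \<Rightarrow> int. \<lambda>j\<in>{..<d}. f [j] mod int (k j)"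
  have psurj: "carrier ?C \<subseteq> ?p ` carrier magnus_group"
    using magnus_abelianization_surj by blast
  obtain \<phi> where \<phi>: "\<phi> \<in> hom ?B magnus_group" "\<And>h. h \<in> B \<Longrightarrow> ?p (\<phi> h) = \<theta> h"
    by (rule free_group_subgroup_lift[OF free B group_magnus_group C magnus_abelianization_hom psurj \<theta>]) blast
  have \<phi>_coeff: "\<phi> h [i] mod int (k i) = \<theta> h i" if "h \<in> B" "i < d" for h i
    using fun_cong[OF \<phi>(2)[OF that(1)], of i] that by simp
  define e where "e = (\<lambda>j. \<lambda>i\<in>{..<d}. (if i = j then 1 else 0) mod int (k i))"
  have e: "e j \<in> carrier ?C" for j by (auto simp: e_def integer_mod_group_mem_iff)
  then have "\<forall>j. \<exists>x. x \<in> B \<and> \<theta> x = e j" using \<theta>_surj by (metis imageE)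
  then obtain x where x: "\<And>j. x j \<in> B" "\<And>j. \<theta> (x j) = e j" by metis
  \<comment> \<open>Power series use every natural number as a letter. Modulus 1 outside
    \<open>{..<d}\<close> makes all congruences for the surplus letters trivial;
    \<open>\<theta>\<close> gives no information there.\<close>
  define k' where "k' = (\<lambda>i. if i < d then k i else 1)"
  have gen: "generate ?B (x ` {..<d} \<union> N) = carrier ?B"
  proof (rule generate_of_cyclic_quotient[OF \<theta>.group_hom_axioms])
    show "kernel ?B ?C \<theta> \<subseteq> generate ?B (x ` {..<d} \<union> N)"
      using ker by (auto simp: kernel_def intro!: generate.incl simp del: one_product_group)
    show "x ` {..<d} \<union> N \<subseteq> carrier ?B" using x(1) NB by auto
    fix j assume "j < d"
    then show "x j \<in> x ` {..<d} \<union> N" by simp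
    show "\<theta> (x j) = (\<lambda>i\<in>{..<d}. (if i = j then 1 else 0) mod int (k i))" using x(2) by (simp add: e_def)
  qed
  have pow: "x j [^]\<^bsub>?B\<^esub> k' j \<in> N" if "j < d" for j
  proof -
    have "\<theta> (x j [^]\<^bsub>?B\<^esub> k j) = e j [^]\<^bsub>?C\<^esub> int (k j)"
      using \<theta>.hom_nat_pow[of "x j" "k j"] x by (simp add: int_pow_int)
    also have "\<dots> = \<one>\<^bsub>?C\<^esub>"
    proof
      fix i
      show "(e j [^]\<^bsub>?C\<^esub> int (k j)) i = \<one>\<^bsub>?C\<^esub> i"
      proof (cases "i < d")
        case True
        show ?thesis unfolding int_pow_cyclic_product[OF e True] using True by (simp add: e_def)
      next
        case False
        have "e j [^]\<^bsub>?C\<^esub> int (k j) \<in> carrier ?C" by (rule group.int_pow_closed[OF C e])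
        then show ?thesis using False by (auto simp: PiE_iff extensional_def)
      qed
    qed
    finally have "\<theta> (x j [^]\<^bsub>?B\<^esub> k j) = \<one>\<^bsub>?C\<^esub>" .
    moreover have "x j [^]\<^bsub>?B\<^esub> k j \<in> carrier ?B" by (rule N.nat_pow_closed) (use x in simp)
    ultimately show ?thesis using ker[of "x j [^]\<^bsub>?B\<^esub> k j"] that by (simp add: k'_def)
  qed
  interpret magnus_quotient N ?B x d k' \<phi>
  proof unfold_locales
    show "commutator_subgroup ?B (carrier ?B) (carrier ?B) \<subseteq> N"
      using der F.commutator_subgroup_consistent[OF B, of B B] by simp
    show "x j \<in> carrier ?B" if "j < d" for j using x by simp
    show "generate ?B (x ` {..<d} \<union> N) = carrier ?B" by (rule gen)
    show "\<phi> \<in> hom ?B magnus_group" by (rule \<phi>)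
    show "\<phi> n \<in> magnus_filtration k' 2" if n: "n \<in> N" for n
    proof -
      have "\<phi> n [] = 1" using \<phi>(1) n NB by (auto simp: hom_def Pi_iff)
      moreover have "word_gcd k' w dvd \<phi> n w" if w0: "w \<noteq> []" "length w < 2" for w
      proof -
        obtain i where w: "w = [i]" using w0 by (cases w) auto
        show ?thesis
        proof (cases "i < d")
          case True
          have "\<phi> n [i] mod int (k i) = 0"
            using \<phi>_coeff[of n i] ker[of n] n NB True by auto
          then show ?thesis using True w by (auto simp: word_gcd_def k'_def)
        qed (simp add: w word_gcd_def k'_def)
      qed
      ultimately show ?thesis by (simp add: magnus_filtration_def)
    qed
    show "int (k' i) dvd \<phi> (x j) [i] - (if i = j then 1 else 0)" if "j < d" for i j
    proof (cases "i < d")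
      case True
      have "\<phi> (x j) [i] mod int (k i) = (if i = j then 1 else 0) mod int (k i)"
        using \<phi>_coeff[OF x(1) True, of j] x(2)[of j] True by (simp add: e_def)
      then show ?thesis using True unfolding mod_eq_dvd_iff by (simp add: k'_def)
    qed (simp add: k'_def)
    show "x j [^]\<^bsub>?B\<^esub> k' j \<in> N" if "j < d" for j by (rule pow[OF that])
  qed
  have "cyclic_product D (\<lambda>j. Gcd (k ` set (b j))) = cyclic_product D (\<lambda>j. Gcd (k' ` set (b j)))"
  proof (rule cyclic_product_cong)
    fix j assume "j < D"
    then have "set (b j) \<subseteq> {..<d}" using b by (auto simp: bij_betw_def lyndon_words_def)
    then have "k ` set (b j) = k' ` set (b j)" by (intro image_cong) (auto simp: k'_def)
    then show "Gcd (k ` set (b j)) = Gcd (k' ` set (b j))" by simp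
  qed
  moreover have "iterated_commutator ?B (carrier ?B) (carrier ?B) c = iterated_commutator F B B c"
    "iterated_commutator ?B (carrier ?B) N c = iterated_commutator F B N c"
    using F.iterated_commutator_consistent[OF B _ B subset_refl, of c]
      F.iterated_commutator_consistent[OF B _ B NB, of c] by simp_all
  ultimately show ?thesis using cyclic_product_iso_lcs_quotient[OF b] by simp
qed

section \<open>Enumerations adapted to growing alphabets, and the iteration\<close>

lemma lyndon_words_mono: "i \<le> d \<Longrightarrow> lyndon_words n i \<subseteq> lyndon_words n d"
  by (auto simp: lyndon_words_def)

lemma witt_mono: "n > 0 \<Longrightarrow> i \<le> d \<Longrightarrow> witt n i \<le> witt n d"
  by (simp add: witt_eq_card_lyndon_words card_mono finite_lyndon_words lyndon_words_mono)

text \<open>One enumeration serves all alphabets at once, because the words that use a new letter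
  are appended at the end. So the generators of the next step are sorted in the same way as the
  letters of this one.\<close>

lemma lyndon_words_enumeration:
  assumes "n > 0"
  obtains b where "\<And>i. i \<le> d \<Longrightarrow> bij_betw b {..<witt n i} (lyndon_words n i)"
proof -
  have "\<exists>b. \<forall>i\<le>d. bij_betw b {..<witt n i} (lyndon_words n i)"
  proof (induction d)
    case 0
    have "card {..<witt n 0} = card (lyndon_words n 0)" using assms by (simp add: witt_eq_card_lyndon_words)
    then obtain b where "bij_betw b {..<witt n 0} (lyndon_words n 0)"
      using finite_same_card_bij[OF _ finite_lyndon_words] by blast
    then show ?case by auto
  next
    case (Suc d)
    then obtain b where b: "\<And>i. i \<le> d \<Longrightarrow> bij_betw b {..<witt n i} (lyndon_words n i)" by blast
    have le: "witt n d \<le> witt n (Suc d)" by (rule witt_mono[OF assms]) simp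
    have "card {witt n d..<witt n (Suc d)} = card (lyndon_words n (Suc d) - lyndon_words n d)"
      using assms card_Diff_subset[OF finite_lyndon_words lyndon_words_mono[of d "Suc d" n]]
      by (simp add: witt_eq_card_lyndon_words)
    then obtain c where c: "bij_betw c {witt n d..<witt n (Suc d)} (lyndon_words n (Suc d) - lyndon_words n d)"
      using finite_same_card_bij[of "{witt n d..<witt n (Suc d)}"] finite_lyndon_words by blast
    define b' where "b' = (\<lambda>j. if j < witt n d then b j else c j)"
    have old: "bij_betw b' {..<witt n i} (lyndon_words n i)" if "i \<le> d" for i
    proof -
      have "bij_betw b' {..<witt n i} (lyndon_words n i) = bij_betw b {..<witt n i} (lyndon_words n i)"
        by (rule bij_betw_cong) (use witt_mono[OF assms that] in \<open>auto simp: b'_def\<close>)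
      then show ?thesis using b[OF that] by simp
    qed
    have "bij_betw b' {witt n d..<witt n (Suc d)} (lyndon_words n (Suc d) - lyndon_words n d)
        = bij_betw c {witt n d..<witt n (Suc d)} (lyndon_words n (Suc d) - lyndon_words n d)"
      by (rule bij_betw_cong) (auto simp: b'_def)
    with c have "bij_betw b' ({..<witt n d} \<union> {witt n d..<witt n (Suc d)})
        (lyndon_words n d \<union> (lyndon_words n (Suc d) - lyndon_words n d))"
      by (intro bij_betw_combine[OF old]) auto
    moreover have "{..<witt n d} \<union> {witt n d..<witt n (Suc d)} = {..<witt n (Suc d)}" using le by auto
    moreover have "lyndon_words n d \<union> (lyndon_words n (Suc d) - lyndon_words n d) = lyndon_words n (Suc d)"
      using lyndon_words_mono[of d "Suc d" n] by auto
    ultimately have "bij_betw b' {..<witt n (Suc d)} (lyndon_words n (Suc d))" by simp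
    with old show ?case by (metis le_Suc_eq)
  qed
  then show ?thesis using that by blast
qed

lemma enumeration_less_iff:
  assumes "n > 0" and b: "\<And>i. i \<le> d \<Longrightarrow> bij_betw b {..<witt n i} (lyndon_words n i)"
    and "i \<le> d" "j < witt n d"
  shows "j < witt n i \<longleftrightarrow> set (b j) \<subseteq> {..<i}"
proof
  assume "j < witt n i"
  then show "set (b j) \<subseteq> {..<i}" using b[OF assms(3)] by (auto simp: bij_betw_def lyndon_words_def)
next
  assume s: "set (b j) \<subseteq> {..<i}"
  have "b j \<in> lyndon_words n d" using b[of d] assms by (auto simp: bij_betw_def)
  then have "b j \<in> b ` {..<witt n i}"
    using s b[OF assms(3)] by (auto simp: bij_betw_def lyndon_words_def)
  then obtain j' where j': "j' < witt n i" "b j' = b j" by auto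
  have "j' < witt n d" using j' witt_mono[OF assms(1,3)] by simp
  then have "j' = j" using b[of d] j' assms(4) by (auto simp: bij_betw_def inj_on_def)
  then show "j < witt n i" using j' by simp
qed

text \<open>The invariant of the iteration: generator \<open>j\<close> has order
  \<open>k (r j)\<close>, with \<open>r j\<close> the index of an original summand, and the
  generators of index below \<open>i\<close> are exactly the first \<open>f i\<close> ones. A step
  replaces \<open>f i\<close> by \<open>witt (Suc c) (f i)\<close>, the number of Lyndon words in
  those generators.\<close>

lemma free_subgroup_poly_quotient:
  fixes k :: "nat \<Rightarrow> nat"
  assumes free: "free_group_on F S" and "subgroup B F" "N \<lhd> (F\<lparr>carrier := B\<rparr>)"
    and "commutator_subgroup F B B \<subseteq> N"
    and "cyclic_product (f d) (\<lambda>j. k (r j)) \<cong> (F\<lparr>carrier := B\<rparr> Mod N)"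
    and "\<And>i. i \<le> d \<Longrightarrow> f i \<le> f d"
    and "\<And>i j. i \<le> d \<Longrightarrow> j < f d \<Longrightarrow> r j < i \<longleftrightarrow> j < f i"
    and chain: "\<And>i j. i \<le> j \<Longrightarrow> j < d \<Longrightarrow> k j dvd k i"
    and "\<forall>c \<in> set cs. c \<ge> 1" and "foldl (poly_step F) (B, N) cs = (B', N')"
  shows "\<exists>r'. cyclic_product (poly_witt cs (f d)) (\<lambda>j. k (r' j)) \<cong> (F\<lparr>carrier := B'\<rparr> Mod N')
    \<and> (\<forall>i\<le>d. poly_witt cs (f i) \<le> poly_witt cs (f d))
    \<and> (\<forall>i j. i \<le> d \<longrightarrow> j < poly_witt cs (f d) \<longrightarrow> (r' j < i \<longleftrightarrow> j < poly_witt cs (f i)))"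
  using assms(2-7,9,10)
proof (induction cs arbitrary: B N f r)
  case Nil
  then show ?case by (auto simp: poly_witt_def)
next
  case (Cons c cs)
  interpret F: group F using free by (simp add: free_group_on_def)
  note B = Cons.prems(1) and N = Cons.prems(2)
  interpret N: normal N "F\<lparr>carrier := B\<rparr>" by fact
  have NB: "N \<subseteq> B" using N.subset by simp
  obtain b where b: "\<And>i. i \<le> f d \<Longrightarrow> bij_betw b {..<witt (Suc c) i} (lyndon_words (Suc c) i)"
    using lyndon_words_enumeration[of "Suc c" "f d"] by auto
  \<comment> \<open>Along the chain \<open>k\<close>, a larger index means an order that divides the
    earlier ones. So the gcd over the letters of a word is the order at the largest index.\<close>
  define r1 where "r1 = (\<lambda>j. Max (r ` set (b j)))"
  have bj: "b j \<noteq> []" "set (b j) \<subseteq> {..<f d}" if "j < witt (Suc c) (f d)" for j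
    using bij_betw_apply[OF b[of "f d"], of j] that lyndon_not_Nil by (auto simp: lyndon_words_def)
  have r1_less: "r1 j < i \<longleftrightarrow> j < witt (Suc c) (f i)" if "i \<le> d" "j < witt (Suc c) (f d)" for i j
  proof -
    have "r1 j < i \<longleftrightarrow> (\<forall>l\<in>set (b j). r l < i)"
      using bj[OF that(2)] by (simp add: r1_def)
    also have "\<dots> \<longleftrightarrow> (\<forall>l\<in>set (b j). l < f i)"
      using bj[OF that(2)] Cons.prems(6)[OF that(1)] by (intro ball_cong) auto
    also have "\<dots> \<longleftrightarrow> j < witt (Suc c) (f i)"
      using enumeration_less_iff[OF _ b Cons.prems(5)[OF that(1)] that(2)] by auto
    finally show ?thesis .
  qed
  have "cyclic_product (witt (Suc c) (f d)) (\<lambda>j. Gcd ((\<lambda>j. k (r j)) ` set (b j))) \<cong>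
      (F\<lparr>carrier := iterated_commutator F B B c\<rparr> Mod iterated_commutator F B N c)"
    by (rule free_subgroup_lcs_quotient[OF free B N Cons.prems(3,4) b]) simp
  moreover have "Gcd ((\<lambda>j. k (r j)) ` set (b j)) = k (r1 j)" if j: "j < witt (Suc c) (f d)" for j
  proof (rule dvd_antisym)
    have "r1 j \<in> r ` set (b j)" unfolding r1_def using bj[OF j] by (intro Max_in) auto
    then show "Gcd ((\<lambda>j. k (r j)) ` set (b j)) dvd k (r1 j)" by (auto intro: Gcd_dvd)
    show "k (r1 j) dvd Gcd ((\<lambda>j. k (r j)) ` set (b j))"
    proof (rule Gcd_greatest)
      fix a assume "a \<in> (\<lambda>j. k (r j)) ` set (b j)"
      then obtain l where l: "l \<in> set (b j)" "a = k (r l)" by auto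
      have "r l \<le> r1 j" unfolding r1_def using l by (intro Max_ge) auto
      moreover have "r1 j < d" using r1_less[of d j] j by simp
      ultimately show "k (r1 j) dvd a" using l chain by simp
    qed
  qed
  ultimately have iso: "cyclic_product (witt (Suc c) (f d)) (\<lambda>j. k (r1 j)) \<cong>
      (F\<lparr>carrier := iterated_commutator F B B c\<rparr> Mod iterated_commutator F B N c)"
    by (subst cyclic_product_cong[of _ _ "\<lambda>j. Gcd ((\<lambda>j. k (r j)) ` set (b j))"]) auto
  have sub: "iterated_commutator F B B c \<subseteq> B" by (rule F.iterated_commutator_subset[OF B]) simp
  \<comment> \<open>Enlarging the second factor to \<open>B\<close> gives the next lower central
    term of \<open>B\<close>, which is \<open>[[B, B], _c B]\<close>; now \<open>[B, B]\<close> lies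
    in \<open>N\<close>.\<close>
  have "commutator_subgroup F (iterated_commutator F B B c) (iterated_commutator F B B c)
      \<subseteq> commutator_subgroup F (iterated_commutator F B B c) B"
    by (rule F.commutator_subgroup_mono) (use sub in auto)
  also have "\<dots> = iterated_commutator F B (commutator_subgroup F B B) c"
    by (simp only: iterated_commutator_Suc[symmetric] iterated_commutator_Suc')
  also have "\<dots> \<subseteq> iterated_commutator F B N c"
    by (rule F.iterated_commutator_mono[OF Cons.prems(3)]) simp
  finally have der: "commutator_subgroup F (iterated_commutator F B B c) (iterated_commutator F B B c)
      \<subseteq> iterated_commutator F B N c" .
  have mono: "witt (Suc c) (f i) \<le> witt (Suc c) (f d)" if "i \<le> d" for i
    using Cons.prems(5)[OF that] by (intro witt_mono) auto
  have pw: "poly_witt (c # cs) i = poly_witt cs (witt (Suc c) i)" for i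
    by (simp add: poly_witt_def)
  show ?case
    unfolding pw
    by (rule Cons.IH[where f = "\<lambda>i. witt (Suc c) (f i)" and r = r1, OF F.poly_step_normal[OF B N] der iso])
       (use mono r1_less Cons.prems in auto)
qed

section \<open>Regrouping direct sums of cyclic groups\<close>

lemma carrier_finite_sum_group:
  assumes "finite I" "\<And>i. i \<in> I \<Longrightarrow> group (G i)"
  shows "carrier (sum_group I G) = (\<Pi>\<^sub>E i\<in>I. carrier (G i))"
  using assms by (auto simp: carrier_sum_group)

lemma group_direct_copies: "group A \<Longrightarrow> group (direct_copies A r)"
  unfolding direct_copies_def by (rule sum_group)

lemma carrier_direct_copies: "group A \<Longrightarrow> carrier (direct_copies A r) = {..<r} \<rightarrow>\<^sub>E carrier A"
  unfolding direct_copies_def by (rule carrier_finite_sum_group) auto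

lemma mult_direct_copies: "v \<otimes>\<^bsub>direct_copies A r\<^esub> w = (\<lambda>j\<in>{..<r}. v j \<otimes>\<^bsub>A\<^esub> w j)"
  by (simp add: direct_copies_def)

lemma isoI_inverse:
  assumes "h \<in> hom G H" "\<And>y. y \<in> carrier H \<Longrightarrow> g y \<in> carrier G \<and> h (g y) = y"
    and "\<And>x. x \<in> carrier G \<Longrightarrow> g (h x) = x"
  shows "G \<cong> H"
proof -
  have "bij_betw h (carrier G) (carrier H)"
    by (rule bij_betw_byWitness[of _ g]) (use assms in \<open>auto simp: hom_def\<close>)
  with assms(1) show ?thesis by (auto simp: is_iso_def iso_def)
qed

text \<open>The values of \<open>p\<close> cut the indices into consecutive, possibly empty, blocks.
  The block of \<open>j\<close> is recovered as the least \<open>i\<close> with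
  \<open>j < p i\<close>, and its offset by subtracting \<open>p (i - 1)\<close>.\<close>

lemma cyclic_product_regroup:
  fixes p :: "nat \<Rightarrow> nat"
  assumes mono: "\<And>i. i < k \<Longrightarrow> p i \<le> p (Suc i)"
    and free: "\<And>j. j < p 0 \<Longrightarrow> q j = 0"
    and tors: "\<And>i j. i \<in> {1..k} \<Longrightarrow> p (i - 1) \<le> j \<Longrightarrow> j < p i \<Longrightarrow> q j = n i"
  shows "cyclic_product (p k) q \<cong> direct_copies integer_group (p 0) \<times>\<times>
    sum_group {1..k} (\<lambda>i. direct_copies (integer_mod_group (n i)) (p i - p (i - 1)))"
proof -
  let ?T = "\<lambda>i. direct_copies (integer_mod_group (n i)) (p i - p (i - 1))"
  let ?R = "direct_copies integer_group (p 0) \<times>\<times> sum_group {1..k} ?T"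
  have carrT: "carrier (sum_group {1..k} ?T) = (\<Pi>\<^sub>E i\<in>{1..k}. {..<p i - p (i - 1)} \<rightarrow>\<^sub>E carrier (integer_mod_group (n i)))"
    by (subst carrier_finite_sum_group) (auto simp: group_direct_copies carrier_direct_copies)
  have carrZ: "carrier (direct_copies integer_group (p 0)) = {..<p 0} \<rightarrow>\<^sub>E UNIV"
    by (simp add: carrier_direct_copies)
  have mono': "p i \<le> p j" if "i \<le> j" "j \<le> k" for i j
    using that by (induction rule: dec_induct) (use mono in \<open>auto intro: le_trans\<close>)
  have idx: "p (i - 1) + l < p i" "p (i - 1) + l < p k" "q (p (i - 1) + l) = n i"
    if "i \<in> {1..k}" "l < p i - p (i - 1)" for i l
  proof -
    show 1: "p (i - 1) + l < p i" using that by simp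
    show "p (i - 1) + l < p k" using 1 mono'[of i k] that by simp
    show "q (p (i - 1) + l) = n i" using tors[of i "p (i - 1) + l"] that 1 by simp
  qed
  define blk where "blk = (\<lambda>j. LEAST i. j < p i)"
  have blk: "blk j \<in> {1..k}" "p (blk j - 1) \<le> j" "j < p (blk j)" if j: "p 0 \<le> j" "j < p k" for j
  proof -
    show 1: "j < p (blk j)" unfolding blk_def by (rule LeastI[of _ k]) fact
    have "blk j \<le> k" unfolding blk_def by (rule Least_le) fact
    moreover have "blk j \<noteq> 0" using 1 j by (metis leD)
    ultimately show 2: "blk j \<in> {1..k}" by simp
    show "p (blk j - 1) \<le> j"
    proof (rule ccontr)
      assume "\<not> p (blk j - 1) \<le> j"
      then have "blk j \<le> blk j - 1" by (subst blk_def, intro Least_le) simp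
      moreover have "1 \<le> blk j" using 2 by simp
      ultimately show False by linarith
    qed
  qed
  have blk_eq: "blk (p (i - 1) + l) = i" if "i \<in> {1..k}" "l < p i - p (i - 1)" for i l
    unfolding blk_def
  proof (rule Least_equality)
    show "p (i - 1) + l < p i" by (rule idx[OF that])
    fix i' assume "p (i - 1) + l < p i'"
    moreover have "i - 1 \<le> k" "1 \<le> i" using that by auto
    ultimately show "i \<le> i'" using mono'[of i' "i - 1"] by (cases "i' \<le> i - 1") auto
  qed
  define h where "h = (\<lambda>v :: nat \<Rightarrow> int. (\<lambda>j\<in>{..<p 0}. v j, \<lambda>i\<in>{1..k}. \<lambda>l\<in>{..<p i - p (i - 1)}. v (p (i - 1) + l)))"
  define g where "g = (\<lambda>(a :: nat \<Rightarrow> int, b). \<lambda>j\<in>{..<p k}. if j < p 0 then a j else b (blk j) (j - p (blk j - 1)))"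
  show ?thesis
  proof (rule isoI_inverse[of h _ _ g])
    show "h \<in> hom (cyclic_product (p k) q) ?R"
    proof (rule homI)
      fix v assume v: "v \<in> carrier (cyclic_product (p k) q)"
      then have "v (p (i - 1) + l) \<in> carrier (integer_mod_group (n i))" if "i \<in> {1..k}" "l < p i - p (i - 1)" for i l
        using idx[OF that] by (auto simp: PiE_iff dest!: bspec[of _ _ "p (i - 1) + l"])
      then show "h v \<in> carrier ?R"
        unfolding h_def carrier_DirProd carrT carrZ by auto
    next
      fix v w
      have "q j = 0" "j < p k" if "j < p 0" for j using free that mono'[of 0 k] by auto
      then show "h (v \<otimes>\<^bsub>cyclic_product (p k) q\<^esub> w) = h v \<otimes>\<^bsub>?R\<^esub> h w"
        using idx by (auto simp: h_def mult_direct_copies intro!: restrict_ext)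
    qed
  next
    fix y assume y: "y \<in> carrier ?R"
    obtain a b where ab: "y = (a, b)" by (cases y)
    have a: "a \<in> {..<p 0} \<rightarrow>\<^sub>E UNIV" using y unfolding ab carrier_DirProd carrZ by simp
    have b: "b \<in> (\<Pi>\<^sub>E i\<in>{1..k}. {..<p i - p (i - 1)} \<rightarrow>\<^sub>E carrier (integer_mod_group (n i)))"
      using y unfolding ab carrier_DirProd carrT by simp
    have bm: "b i l \<in> carrier (integer_mod_group (n i))" if "i \<in> {1..k}" "l < p i - p (i - 1)" for i l
      using PiE_mem[OF PiE_mem[OF b that(1)], of l] that by simp
    have p0: "p 0 \<le> p k" by (rule mono') auto
    show "g y \<in> carrier (cyclic_product (p k) q) \<and> h (g y) = y"
    proof
      have "(if j < p 0 then a j else b (blk j) (j - p (blk j - 1))) \<in> carrier (integer_mod_group (q j))"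
        if "j < p k" for j
      proof (cases "j < p 0")
        case True
        then show ?thesis using free by (simp add: carrier_integer_mod_group)
      next
        case False
        then have j: "p 0 \<le> j" by simp
        note bl = blk[OF j that]
        have "j - p (blk j - 1) < p (blk j) - p (blk j - 1)" using bl by simp
        then show ?thesis using False bm[OF bl(1)] tors[OF bl] by simp
      qed
      then show "g y \<in> carrier (cyclic_product (p k) q)" by (simp add: g_def ab PiE_iff)
      have "(\<lambda>j\<in>{..<p 0}. g y j) = a"
      proof
        fix j show "(\<lambda>j\<in>{..<p 0}. g y j) j = a j"
          using a p0 by (cases "j < p 0") (auto simp: g_def ab PiE_iff extensional_def)
      qed
      moreover have "(\<lambda>i\<in>{1..k}. \<lambda>l\<in>{..<p i - p (i - 1)}. g y (p (i - 1) + l)) = b"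
      proof
        fix i
        show "(\<lambda>i\<in>{1..k}. \<lambda>l\<in>{..<p i - p (i - 1)}. g y (p (i - 1) + l)) i = b i"
        proof (cases "i \<in> {1..k}")
          case i: True
          have "(\<lambda>l\<in>{..<p i - p (i - 1)}. g y (p (i - 1) + l)) l = b i l" for l
          proof -
            have bi: "b i \<in> {..<p i - p (i - 1)} \<rightarrow>\<^sub>E carrier (integer_mod_group (n i))"
              using PiE_mem[OF b i] .
            show ?thesis
            proof (cases "l < p i - p (i - 1)")
              case True
              have "i - 1 \<le> k" using i by auto
              then have "\<not> p (i - 1) + l < p 0" using mono'[of 0 "i - 1"] by simp
              then show ?thesis using i True idx[OF i True] blk_eq[OF i True] by (simp add: g_def ab)
            next
              case False
              then show ?thesis using i bi by (auto simp: PiE_iff extensional_def)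
            qed
          qed
          then show ?thesis using i by (simp add: fun_eq_iff)
        next
          case False
          then have "b i = undefined" using b by (auto simp: PiE_iff extensional_def)
          with False show ?thesis by auto
        qed
      qed
      ultimately show "h (g y) = y" by (simp add: h_def ab)
    qed
  next
    fix v assume v: "v \<in> carrier (cyclic_product (p k) q)"
    show "g (h v) = v"
    proof
      fix j
      show "g (h v) j = v j"
      proof (cases "j < p k")
        case True
        show ?thesis
        proof (cases "j < p 0")
          case False
          then have "p 0 \<le> j" by simp
          note bl = blk[OF this True]
          then show ?thesis using True False by (auto simp: g_def h_def)
        qed (use True in \<open>simp add: g_def h_def\<close>)
      next
        case False
        then show ?thesis using v by (auto simp: g_def h_def PiE_iff extensional_def)
      qed
    qed
  qed
qed

text \<open>The shift in \<open>n (j - m + 1)\<close> arises because the summands of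
  \<open>n\<close> are counted from 1, while the coordinates are counted from 0 with the
  \<open>m\<close> free ones in front.\<close>

lemma cyclic_product_split:
  "cyclic_product (m + k) (\<lambda>j. if j < m then 0 else n (j - m + 1)) \<cong>
    direct_copies integer_group m \<times>\<times> sum_group {1..k} (\<lambda>i. integer_mod_group (n i))"
proof -
  let ?q = "\<lambda>j. if j < m then 0 else n (j - m + 1)"
  let ?R = "direct_copies integer_group m \<times>\<times> sum_group {1..k} (\<lambda>i. integer_mod_group (n i))"
  have carrT: "carrier (sum_group {1..k} (\<lambda>i. integer_mod_group (n i))) = (\<Pi>\<^sub>E i\<in>{1..k}. carrier (integer_mod_group (n i)))"
    by (subst carrier_finite_sum_group) auto
  have carrZ: "carrier (direct_copies integer_group m) = {..<m} \<rightarrow>\<^sub>E UNIV"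
    by (simp add: carrier_direct_copies)
  define h where "h = (\<lambda>v :: nat \<Rightarrow> int. (\<lambda>j\<in>{..<m}. v j, \<lambda>i\<in>{1..k}. v (m + i - 1)))"
  define g where "g = (\<lambda>(a :: nat \<Rightarrow> int, b). \<lambda>j\<in>{..<m + k}. if j < m then a j else b (j - m + 1))"
  show ?thesis
  proof (rule isoI_inverse[of h _ _ g])
    show "h \<in> hom (cyclic_product (m + k) ?q) ?R"
    proof (rule homI)
      fix v assume v: "v \<in> carrier (cyclic_product (m + k) ?q)"
      have "v (m + i - 1) \<in> carrier (integer_mod_group (n i))" if "i \<in> {1..k}" for i
      proof -
        have v': "v \<in> (\<Pi>\<^sub>E j\<in>{..<m + k}. carrier (integer_mod_group (?q j)))" using v by simp
        have "v (m + i - 1) \<in> carrier (integer_mod_group (?q (m + i - 1)))"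
          by (rule PiE_mem[OF v']) (use that in auto)
        moreover have "?q (m + i - 1) = n i" using that by auto
        ultimately show ?thesis by metis
      qed
      then show "h v \<in> carrier ?R" unfolding h_def carrier_DirProd carrT carrZ by auto
    next
      fix v w
      have "?q (m + i - 1) = n i" "m + i - 1 < m + k" if "i \<in> {1..k}" for i using that by auto
      then show "h (v \<otimes>\<^bsub>cyclic_product (m + k) ?q\<^esub> w) = h v \<otimes>\<^bsub>?R\<^esub> h w"
        by (auto simp: h_def mult_direct_copies intro!: restrict_ext)
    qed
  next
    fix y assume y: "y \<in> carrier ?R"
    obtain a b where ab: "y = (a, b)" by (cases y)
    have a: "a \<in> {..<m} \<rightarrow>\<^sub>E UNIV" using y unfolding ab carrier_DirProd carrZ by simp
    have b: "b \<in> (\<Pi>\<^sub>E i\<in>{1..k}. carrier (integer_mod_group (n i)))"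
      using y unfolding ab carrier_DirProd carrT by simp
    show "g y \<in> carrier (cyclic_product (m + k) ?q) \<and> h (g y) = y"
    proof
      have "(if j < m then a j else b (j - m + 1)) \<in> carrier (integer_mod_group (?q j))" if "j < m + k" for j
        using PiE_mem[OF b, of "j - m + 1"] that by (auto simp: carrier_integer_mod_group[of 0])
      then show "g y \<in> carrier (cyclic_product (m + k) ?q)" by (simp add: g_def ab PiE_iff)
      have "(\<lambda>j\<in>{..<m}. g y j) = a"
        using a by (auto simp: g_def ab PiE_iff extensional_def fun_eq_iff)
      moreover have "(\<lambda>i\<in>{1..k}. g y (m + i - 1)) = b"
        using b by (auto simp: g_def ab PiE_iff extensional_def fun_eq_iff)
      ultimately show "h (g y) = y" by (simp add: h_def ab)
    qed
  next
    fix v assume v: "v \<in> carrier (cyclic_product (m + k) ?q)"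
    then show "g (h v) = v"
      by (auto simp: g_def h_def PiE_iff extensional_def fun_eq_iff)
  qed
qed

lemma (in normal) derived_subset_of_comm_FactGroup:
  assumes "comm_group (G Mod H)"
  shows "commutator_subgroup G (carrier G) (carrier G) \<subseteq> H"
proof (rule commutator_subgroup_least[OF subgroup_axioms])
  interpret Q: comm_group "G Mod H" by fact
  fix a b assume ab: "a \<in> carrier G" "b \<in> carrier G"
  then have "H #> a \<in> carrier (G Mod H)" "H #> b \<in> carrier (G Mod H)" by (auto simp: carrier_FactGroup)
  then show "group_commutator G a b \<in> H"
    unfolding commutator_in_iff[OF ab] by (subst Q.commutator_eq_one_iff) (use Q.m_comm in auto)
qed

lemma (in group) foldl_poly_step_subset:
  assumes "subgroup B G"
  shows "foldl (\<lambda>H c. iterated_commutator G H H c) B cs \<subseteq> B"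
  using assms
proof (induction cs arbitrary: B)
  case (Cons c cs)
  show ?case
    using Cons.IH[OF subgroup_iterated_commutator[OF Cons.prems Cons.prems, of c]]
      iterated_commutator_subset[OF Cons.prems, of B c] by auto
qed simp

lemma poly_witt_mono: "i \<le> d \<Longrightarrow> poly_witt cs i \<le> poly_witt cs d"
  unfolding poly_witt_def by (induction cs arbitrary: i d) (simp_all add: witt_mono)

lemma sum_group_cong:
  "(\<And>i. i \<in> I \<Longrightarrow> G i = H i) \<Longrightarrow> sum_group I G = sum_group I H"
  by (simp add: sum_group_def product_group_def cong: PiE_cong restrict_cong conj_cong)

theorem theorem2p3:
  fixes cs :: "nat list"
    and m k :: nat
    and n :: "nat \<Rightarrow> nat"
    and G :: "('g, 'c) monoid_scheme"
    and F :: "('a, 'b) monoid_scheme"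
    and S R :: "'a set"
    and V :: "nat gword set"
  assumes "cs \<noteq> []" and "\<forall>c \<in> set cs. c \<ge> 1"
    and "\<forall>i \<in> {1..k}. n i > 0"
    and "\<forall>i. 1 \<le> i \<and> i < k \<longrightarrow> n (i + 1) dvd n i"
    and "group G"
    and "G \<cong> direct_copies integer_group m \<times>\<times> sum_group {1..k} (\<lambda>i. integer_mod_group (n i))"
    and "free_group_on F S" and "R \<lhd> F" and "F Mod R \<cong> G"
    and "words_of_variety V (polynilpotent cs)"
  shows "baer_invariant F R V \<cong>
    direct_copies integer_group (poly_witt cs m) \<times>\<times>
    sum_group {1..k} (\<lambda>i. direct_copies (integer_mod_group (n i))
      (poly_witt cs (m + i) - poly_witt cs (m + i - 1)))"
proof -
  interpret R: normal R F by fact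
  interpret Q: group "F Mod R" by (rule R.factorgroup_is_group)
  \<comment> \<open>The free summands get order 0 and come first; this fits the divisibility chain
    because everything divides 0.\<close>
  define q where "q = (\<lambda>j. if j < m then 0 else n (j - m + 1))"
  have C: "comm_group (cyclic_product (m + k) q)"
    by (rule group.group_comm_groupI) (auto simp: add.commute intro!: restrict_ext)
  interpret C: comm_group "cyclic_product (m + k) q" by (rule C)
  have "cyclic_product (m + k) q \<cong> direct_copies integer_group m \<times>\<times> sum_group {1..k} (\<lambda>i. integer_mod_group (n i))"
    unfolding q_def by (rule cyclic_product_split)
  moreover have "direct_copies integer_group m \<times>\<times> sum_group {1..k} (\<lambda>i. integer_mod_group (n i)) \<cong> G"
    by (rule group.iso_sym[OF assms(5,6)])
  moreover have "G \<cong> F Mod R" by (rule Q.iso_sym[OF assms(9)])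
  ultimately have iso: "cyclic_product (m + k) q \<cong> F Mod R" by (meson iso_trans)
  have "comm_group (F Mod R)" by (rule C.iso_imp_comm_group[OF iso Q.is_monoid])
  then have der: "commutator_subgroup F (carrier F) (carrier F) \<subseteq> R"
    by (rule R.derived_subset_of_comm_FactGroup)
  have ndvd: "n j dvd n i" if "i \<le> j" "1 \<le> i" "j \<le> k" for i j
    using that
  proof (induction rule: dec_induct)
    case (step j)
    then have "n (j + 1) dvd n j" "n j dvd n i" using assms(4) by simp_all
    then show ?case by (metis Suc_eq_plus1 dvd_trans)
  qed simp
  have chain: "q j dvd q i" if "i \<le> j" "j < m + k" for i j
    using that by (auto simp: q_def intro: ndvd)
  obtain B' N' where fold: "foldl (poly_step F) (carrier F, R) cs = (B', N')"
    by (cases "foldl (poly_step F) (carrier F, R) cs")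
  have "\<exists>r. cyclic_product (poly_witt cs (m + k)) (\<lambda>j. q (r j)) \<cong> (F\<lparr>carrier := B'\<rparr> Mod N')
    \<and> (\<forall>i\<le>m + k. poly_witt cs i \<le> poly_witt cs (m + k))
    \<and> (\<forall>i j. i \<le> m + k \<longrightarrow> j < poly_witt cs (m + k) \<longrightarrow> (r j < i \<longleftrightarrow> j < poly_witt cs i))"
    by (rule free_subgroup_poly_quotient[where f = "\<lambda>i. i" and r = "\<lambda>j. j",
          OF assms(7) R.subgroup_self _ der _ _ _ chain assms(2) fold])
       (use iso R.normal_axioms in auto)
  then obtain r where r: "cyclic_product (poly_witt cs (m + k)) (\<lambda>j. q (r j)) \<cong> (F\<lparr>carrier := B'\<rparr> Mod N')"
    "\<And>i j. i \<le> m + k \<Longrightarrow> j < poly_witt cs (m + k) \<Longrightarrow> r j < i \<longleftrightarrow> j < poly_witt cs i"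
    by blast
  have "B' \<subseteq> R"
  proof -
    \<comment> \<open>The first class is at least 1, so already the innermost step lands in the
      derived subgroup of \<open>F\<close>, which lies in \<open>R\<close>.\<close>
    obtain c cs' where cs: "cs = c # cs'" "c \<ge> 1" using assms(1,2) by (cases cs) auto
    have "B' = foldl (\<lambda>H c. iterated_commutator F H H c) (carrier F) cs"
      using fst_foldl_poly_step[of F "carrier F" R cs] fold by simp
    also have "\<dots> \<subseteq> iterated_commutator F (carrier F) (carrier F) c"
      using R.foldl_poly_step_subset[OF normal_imp_subgroup[OF R.normal_lcs], of c cs'] cs by simp
    also have "\<dots> \<subseteq> iterated_commutator F (carrier F) (carrier F) (Suc 0)"
      by (rule R.iterated_commutator_antimono[OF R.normal_self]) (use cs in simp)
    finally show ?thesis using der by (auto simp: iterated_commutator_Suc)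
  qed
  then have "R \<inter> B' = B'" by blast
  then have baer: "baer_invariant F R V = (F\<lparr>carrier := B'\<rparr> Mod N')"
    using R.baer_invariant_eq[OF assms(10,8) fold] by simp
  define p where "p = (\<lambda>i. poly_witt cs (m + i))"
  have p_mono: "p i \<le> p j" if "i \<le> j" for i j using that by (simp add: p_def poly_witt_mono)
  have rank: "r j < m + i \<longleftrightarrow> j < p i" if "i \<le> k" "j < p k" for i j
    using r(2)[of "m + i" j] that by (simp add: p_def)
  have "cyclic_product (p k) (\<lambda>j. q (r j)) \<cong> direct_copies integer_group (p 0) \<times>\<times>
      sum_group {1..k} (\<lambda>i. direct_copies (integer_mod_group (n i)) (p i - p (i - 1)))"
  proof (rule cyclic_product_regroup)
    fix j assume j: "j < p 0"
    then have "j < p k" using p_mono[of 0 k] by simp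
    then show "q (r j) = 0" using rank[of 0 j] j by (simp add: q_def)
  next
    fix i j assume i: "i \<in> {1..k}" and j: "p (i - 1) \<le> j" "j < p i"
    then have "j < p k" using p_mono[of i k] by simp
    moreover have "i \<le> k" "i - 1 \<le> k" using i by auto
    ultimately have "r j < m + i" "\<not> r j < m + (i - 1)"
      using rank[of i j] rank[of "i - 1" j] j by (simp_all only: not_less)
    \<comment> \<open>The bounds at \<open>i\<close> and at \<open>i - 1\<close> squeeze the index
      of the summand, so the whole block has order \<open>n i\<close>.\<close>
    then have "r j = m + (i - 1)" by simp
    moreover have "1 \<le> i" using i by simp
    ultimately have "\<not> r j < m" "r j - m + 1 = i" by linarith+
    then show "q (r j) = n i" by (simp add: q_def)
  qed (simp add: p_mono)
  moreover have "sum_group {1..k} (\<lambda>i. direct_copies (integer_mod_group (n i)) (p i - p (i - 1)))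
      = sum_group {1..k} (\<lambda>i. direct_copies (integer_mod_group (n i))
          (poly_witt cs (m + i) - poly_witt cs (m + i - 1)))"
    by (rule sum_group_cong) (simp add: p_def)
  moreover have "(F\<lparr>carrier := B'\<rparr> Mod N') \<cong> cyclic_product (p k) (\<lambda>j. q (r j))"
    unfolding p_def by (rule group.iso_sym[OF group_cyclic_product r(1)])
  moreover have "p 0 = poly_witt cs m" by (simp add: p_def)
  ultimately show ?thesis
    unfolding baer using iso_trans by fastforce
qed

end
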